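(* Let $N\ge 2$ and $0<s<1$. The problem $$(-\Delta)^s u = u-1\ \text{ in } \mathbb{R}^N_+,\qquad u=0\ \text{ in } \mathbb{R}^N\setminus\mathbb{R}^N_+$$ does not admit any bounded, nonnegative, nontrivial (i.e. $u\not\equiv0$) classical solution.
   Context: Notation: $x=(x',x_N)\in\mathbb{R}^{N-1}\times\mathbb{R}$ and $\mathbb{R}^N_+=\{x\in\mathbb{R}^N: x_N>0\}$. The fractional Laplacian is $(-\Delta)^s u(x)=\mathrm{P.V.}\int_{\mathbb{R}^N}\frac{u(x)-u(y)}{|x-y|^{N+2s}}\,dy$ (normalization constant omitted), equivalently, for bounded, sufficiently smooth functions, $(-\Delta)^s u(x)=\frac12\int_{\mathbb{R}^N}\frac{2u(x)-u(x+y)-u(x-y)}{|y|^{N+2s}}\,dy$. A bounded classical solution is a bounded function $u:\mathbb{R}^N\to\mathbb{R}$, continuous in $\mathbb{R}^N$, of class $C^{2s+\beta}$ (locally) in $\mathbb{R}^N_+$ for some $\beta\in(0,1)$, satisfying the equation pointwise in $\mathbb{R}^N_+$ and vanishing in $\mathbb{R}^N\setminus\mathbb{R}^N_+$. *)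

theory Defs
  imports "HOL-Analysis.Analysis"
begin

definition frac_kernel_diff :: "real \<Rightarrow> ('a::euclidean_space \<Rightarrow> real) \<Rightarrow> 'a \<Rightarrow> 'a \<Rightarrow> real" where
  "frac_kernel_diff s u x y = (u x - u y) / norm (x - y) powr (real DIM('a) + 2 * s)"

text \<open>
  \<open>has_frac_laplacian s u x v\<close>: the principal value integral defining
  \<open>(-\<Delta>)\<^sup>s u(x)\<close> (without normalization constant) exists and equals \<open>v\<close>.
  Integrability away from \<open>x\<close> is required explicitly because the Bochner integral of a
  non-integrable function is 0.
\<close>
definition has_frac_laplacian :: "real \<Rightarrow> ('a::euclidean_space \<Rightarrow> real) \<Rightarrow> 'a \<Rightarrow> real \<Rightarrow> bool" where
  "has_frac_laplacian s u x v \<longleftrightarrow>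
     (\<forall>\<epsilon>>0. set_integrable lborel {y. \<epsilon> < norm (x - y)} (frac_kernel_diff s u x)) \<and>
     ((\<lambda>\<epsilon>. LINT y:{y. \<epsilon> < norm (x - y)}|lborel. frac_kernel_diff s u x y) \<longlongrightarrow> v) (at_right 0)"

definition locally_hoelder_on :: "real \<Rightarrow> ('a::euclidean_space \<Rightarrow> real) \<Rightarrow> 'a set \<Rightarrow> bool" where
  "locally_hoelder_on \<gamma> f \<Omega> \<longleftrightarrow>
     (\<forall>K. compact K \<and> K \<subseteq> \<Omega> \<longrightarrow>
        (\<exists>C. \<forall>x\<in>K. \<forall>y\<in>K. \<bar>f x - f y\<bar> \<le> C * norm (x - y) powr \<gamma>))"

text \<open>
  The class of functions that are \<open>k\<close> times differentiable in the open set \<open>\<Omega>\<close> and whose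
  partial derivatives of order \<open>k\<close> are locally Hoelder continuous with exponent \<open>\<gamma>\<close>.
\<close>
primrec C_hoelder_loc ::
  "nat \<Rightarrow> real \<Rightarrow> ('a::euclidean_space \<Rightarrow> real) \<Rightarrow> 'a set \<Rightarrow> bool" where
  "C_hoelder_loc 0 \<gamma> f \<Omega> \<longleftrightarrow> locally_hoelder_on \<gamma> f \<Omega>"
| "C_hoelder_loc (Suc k) \<gamma> f \<Omega> \<longleftrightarrow>
     (\<forall>x\<in>\<Omega>. f differentiable (at x)) \<and>
     (\<forall>b\<in>Basis. C_hoelder_loc k \<gamma> (\<lambda>x. frechet_derivative f (at x) b) \<Omega>)"

text \<open>
  Local \<open>C\<^sup>\<alpha>\<close> regularity for real \<open>\<alpha> > 0\<close>: write \<open>\<alpha> = k + \<gamma>\<close> with \<open>k\<close> a natural number and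
  \<open>0 < \<gamma> \<le> 1\<close>. An integer \<open>\<alpha>\<close> is thus read as \<open>k = \<alpha> - 1\<close>, \<open>\<gamma> = 1\<close>; in the definition of
  classical solutions below this choice is immaterial, as \<open>\<beta>\<close> may always be decreased.
\<close>
definition C_real_loc :: "real \<Rightarrow> ('a::euclidean_space \<Rightarrow> real) \<Rightarrow> 'a set \<Rightarrow> bool" where
  "C_real_loc \<alpha> f \<Omega> \<longleftrightarrow>
     (let k = nat (\<lceil>\<alpha>\<rceil> - 1) in C_hoelder_loc k (\<alpha> - real k) f \<Omega>)"

text \<open>
  Points of \<open>\<real>\<^sup>N\<close> are pairs \<open>(x', x\<^sub>N)\<close>, of type \<open>(real ^ 'm) \<times> real\<close> with \<open>N = CARD('m) + 1\<close>.
  The library's norm and Lebesgue measure on this product type are the Euclidean ones. Since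
  \<open>'m\<close> is an arbitrary (nonempty) finite type, \<open>N\<close> ranges over exactly the integers \<open>\<ge> 2\<close>.
\<close>
lemma DIM_split: "DIM((real ^ 'm) \<times> real) = CARD('m) + 1" "DIM((real ^ 'm) \<times> real) \<ge> 2"
  by (simp_all add: Suc_le_eq)

definition half_space :: "((real ^ 'm) \<times> real) set" where
  "half_space = {x. snd x > 0}"

definition bounded_classical_solution ::
  "real \<Rightarrow> (real \<Rightarrow> real) \<Rightarrow> ((real ^ 'm) \<times> real \<Rightarrow> real) \<Rightarrow> bool" where
  "bounded_classical_solution s f u \<longleftrightarrow>
     bounded (range u) \<and>
     continuous_on UNIV u \<and>
     (\<exists>\<beta>. 0 < \<beta> \<and> \<beta> < 1 \<and> C_real_loc (2 * s + \<beta>) u half_space) \<and>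
     (\<forall>x\<in>half_space. has_frac_laplacian s u x (f (u x))) \<and>
     (\<forall>x. x \<notin> half_space \<longrightarrow> u x = 0)"

end

theory Submission
  imports Defs
begin

text \<open>
  Averaging a solution over larger and larger balls in the tangential variables, weighted by a
  smooth cutoff, gives bounded functions \<open>U\<close> of \<open>x\<^sub>N\<close> alone which almost solve the same linear equation
  on the half line; after a dilation it reads \<open>(-\<Delta>)\<^sup>s U = \<mu> (U - 1)\<close> with any prescribed \<open>\<mu> > 0\<close>.

  Let \<open>\<psi>\<close> be the Dirichlet eigenfunction of \<open>(-\<Delta>)\<^sup>s\<close> on \<open>(0, 2)\<close> that is odd about 1 and positive on
  \<open>(0, 1)\<close>, and let \<open>\<mu>\<close> be its eigenvalue. Its integral vanishes, so testing the equation with \<open>\<psi>\<close> gives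
  \<open>\<integral> U ((-\<Delta>)\<^sup>s \<psi> - \<mu> \<psi>) = 0\<close>. The bracket vanishes on \<open>(0, 2)\<close>; it is strictly positive beyond 2, because
  the negative part of \<open>\<psi>\<close> is the closer one there. This nonlocal effect has no counterpart for \<open>s = 1\<close>.
  Hence \<open>U = 0\<close> on \<open>(2, \<infinity>)\<close>, and far out the equation reads \<open>(-\<Delta>)\<^sup>s U = - \<mu>\<close> although the left side tends
  to 0.

  The singular kernel is replaced by \<open>(|z|\<^sup>2 + \<epsilon>\<^sup>2) powr (- (N + 2 s) / 2)\<close>. The operator is then bounded, \<open>\<psi>\<close>
  is only needed approximately, and it is obtained from a Neumann series at the edge of convergence
  rather than from a compactness argument. These kernels are compatible with integrating out the
  tangential variables.
\<close>

section \<open>Regularised kernels\<close>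

text \<open>The averages are used only as bounded measurable functions, so the singular operator
  cannot be applied to them. With \<epsilon> > 0 the operator has an integrable kernel and can be
  moved around by Fubini; the burden shifts to estimates uniform in \<epsilon>. The mass of the
  kernel blows up as \<epsilon> tends to 0, but it cancels: only the gap \<mu> between this mass and
  the edge of convergence matters, and it stays between two positive constants. As \<mu> still
  varies with \<epsilon>, a limit along a sequence is fixed first, and the dilation is adjusted to
  it. Oddness about 1 turns the sign change of \<psi> into positivity: on (0, 1) the convolution
  acts through the nonnegative kernel \<open>odd_kernel\<close>, so nonnegative series suffice. The
  equation holds only inside the half line, so the test function is placed on (\<delta>, \<delta> +
  2). What U contributes to the left of \<delta> is its small size there times a flux, which the
  eigenvalue bounds. No limit of averages is taken: a fixed tolerance \<nu>, chosen before U,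
  already gives the contradiction.\<close>

text \<open>The function is dominated by the sum of \<open>c j\<close> times the indicator of
  \<open>cball 0 (r j)\<close>, and the volume of a ball is proportional to
  \<open>r j ^ DIM('a)\<close>. It is applied with dyadic radii.\<close>

lemma integrable_dyadic:
  fixes f :: "'a::euclidean_space \<Rightarrow> real"
  assumes [measurable]: "f \<in> borel_measurable borel"
    and nn: "\<And>z. 0 \<le> f z" and c: "\<And>j::nat. 0 \<le> c j" and r: "\<And>j. 0 \<le> r j"
    and bd: "\<And>z. f z \<noteq> 0 \<Longrightarrow> \<exists>j. norm z \<le> r j \<and> f z \<le> c j"
    and sm: "summable (\<lambda>j. c j * r j ^ DIM('a))"
  shows "integrable lborel f"
proof (rule integrableI_bounded)
  let ?V = "unit_ball_vol (real DIM('a))"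
  have "(\<integral>\<^sup>+ z. ennreal (norm (f z)) \<partial>lborel) \<le> nn_integral lborel (\<lambda>z::'a. \<Sum>j. ennreal (c j) * indicator (cball 0 (r j)) z)"
  proof (intro nn_integral_mono)
    fix z :: 'a
    show "ennreal (norm (f z)) \<le> (\<Sum>j. ennreal (c j) * indicator (cball 0 (r j)) z)"
    proof (cases "f z = 0")
      case False
      then obtain j where j: "norm z \<le> r j" "f z \<le> c j" using bd by blast
      have "ennreal (norm (f z)) \<le> ennreal (c j) * indicator (cball 0 (r j)) z"
        using j nn[of z] by (auto simp: indicator_def intro!: ennreal_leI)
      also have "\<dots> = (\<Sum>i\<in>{j}. ennreal (c i) * indicator (cball 0 (r i)) z)" by (simp only: sum.insert_remove sum.empty finite.emptyI) simp
      also have "\<dots> \<le> (\<Sum>j. ennreal (c j) * indicator (cball 0 (r j)) z)"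
        by (rule sum_le_suminf) auto
      finally show ?thesis .
    qed simp
  qed
  also have "\<dots> = (\<Sum>j. nn_integral lborel (\<lambda>z::'a. ennreal (c j) * indicator (cball 0 (r j)) z))"
    by (intro nn_integral_suminf borel_measurable_times_ennreal borel_measurable_const borel_measurable_indicator) auto
  also have "\<dots> = (\<Sum>j. ennreal (?V * (c j * r j ^ DIM('a))))"
    using c r by (subst nn_integral_cmult_indicator)
      (auto simp: emeasure_cball ennreal_mult[symmetric] unit_ball_vol_nonneg mult_ac intro!: suminf_cong)
  also have "\<dots> < \<infinity>"
  proof -
    have "summable (\<lambda>j. ?V * (c j * r j ^ DIM('a)))" using sm by (rule summable_mult)
    moreover have "\<And>j. 0 \<le> ?V * (c j * r j ^ DIM('a))" using c r by (simp add: unit_ball_vol_nonneg)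
    ultimately show ?thesis by (simp add: suminf_ennreal2 less_top)
  qed
  finally show "(\<integral>\<^sup>+ z. ennreal (norm (f z)) \<partial>lborel) < \<infinity>" .
qed simp

lemma dyadic_scale:
  fixes x :: real
  assumes "1 \<le> x"
  obtains j :: nat where "2 ^ j \<le> x" "x \<le> 2 ^ Suc j"
proof -
  define j where "j = nat \<lfloor>log 2 x\<rfloor>"
  have l: "0 \<le> log 2 x" using assms by simp
  then have j: "real j \<le> log 2 x" "log 2 x \<le> real (Suc j)" unfolding j_def by linarith+
  have "2 powr real j \<le> 2 powr (log 2 x)" "2 powr (log 2 x) \<le> 2 powr real (Suc j)"
    using j by (auto intro: powr_mono)
  then have "2 ^ j \<le> x" "x \<le> 2 ^ Suc j" using assms
    by (simp_all add: powr_realpow del: of_nat_Suc power_Suc)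
  then show ?thesis by (rule that)
qed

text \<open>On the shell between \<open>2 ^ j\<close> and \<open>2 ^ Suc j\<close>, height times
  volume is a constant times the j-th power of \<open>2 powr (real DIM('a) - q)\<close>, a ratio
  below 1.\<close>

lemma integrable_norm_powr_far:
  assumes q: "real DIM('a) < q"
  shows "integrable lborel (\<lambda>z::'a::euclidean_space. indicator {z. 1 \<le> norm z} z * norm z powr - q)"
proof (rule integrable_dyadic[where c = "\<lambda>j. (2 ^ j) powr - q" and r = "\<lambda>j. 2 ^ Suc j"])
  fix z :: 'a assume "indicator {z. 1 \<le> norm z} z * norm z powr - q \<noteq> 0"
  then have z: "1 \<le> norm z" by (auto simp: indicator_def split: if_splits)
  then obtain j where j: "2 ^ j \<le> norm z" "norm z \<le> 2 ^ Suc j" using dyadic_scale by blast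
  have "norm z powr - q \<le> (2 ^ j) powr - q" using j q by (intro powr_mono2') auto
  then show "\<exists>j. norm z \<le> 2 ^ Suc j \<and> indicator {z. 1 \<le> norm z} z * norm z powr - q \<le> (2 ^ j) powr - q"
    using j z by (auto simp: indicator_def)
next
  have "(2 ^ j) powr - q * (2 ^ Suc j) ^ DIM('a) = 2 ^ DIM('a) * (2 powr (real DIM('a) - q)) ^ j" for j :: nat
  proof -
    have "(2 ^ j) powr - q = (2::real) powr (- q * real j)"
      by (simp add: powr_powr powr_realpow[symmetric] mult.commute)
    moreover have "((2::real) ^ Suc j) ^ DIM('a) = 2 ^ DIM('a) * 2 powr (real DIM('a) * real j)"
      by (simp add: powr_realpow[symmetric] powr_powr power_mult_distrib mult.commute)
    moreover have "((2::real) powr (real DIM('a) - q)) ^ j = 2 powr ((real DIM('a) - q) * real j)"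
      by (simp add: powr_realpow[symmetric] powr_powr)
    ultimately show ?thesis by (simp add: powr_add[symmetric] algebra_simps)
  qed
  moreover have "norm ((2::real) powr (real DIM('a) - q)) < 1" using q by (simp add: powr_less_one)
  ultimately show "summable (\<lambda>j. (2 ^ j) powr - q * (2 ^ Suc j) ^ DIM('a))"
    by (simp add: summable_mult summable_geometric del: power_Suc)
qed auto

lemma integrable_norm_powr_near:
  assumes p: "p < real DIM('a)"
  shows "integrable lborel (\<lambda>z::'a::euclidean_space. indicator (cball 0 1) z * norm z powr - p)"
proof -
  \<comment> \<open>A nonnegative exponent makes the negative power decrease in its base; inside the
    unit ball, passing from p to q only enlarges the function.\<close>
  define q where "q = max 0 p"
  have q: "0 \<le> q" "q < real DIM('a)" "p \<le> q" using p by (auto simp: q_def)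
  show ?thesis
  proof (rule integrable_dyadic[where c = "\<lambda>j. (1 / 2 ^ Suc j) powr - q" and r = "\<lambda>j. 1 / 2 ^ j"])
    fix z :: 'a assume "indicator (cball 0 1) z * norm z powr - p \<noteq> 0"
    then have z: "norm z \<le> 1" "z \<noteq> 0" by (auto simp: indicator_def split: if_splits)
    then have "1 \<le> 1 / norm z" by simp
    then obtain j where j: "2 ^ j \<le> 1 / norm z" "1 / norm z \<le> 2 ^ Suc j" using dyadic_scale by blast
    have j': "norm z \<le> 1 / 2 ^ j" "1 / 2 ^ Suc j \<le> norm z" using j z by (auto simp: field_simps)
    have "norm z powr - p \<le> norm z powr - q" using z q by (intro powr_mono') auto
    also have "\<dots> \<le> (1 / 2 ^ Suc j) powr - q" using j' q by (intro powr_mono2') auto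
    finally show "\<exists>j. norm z \<le> 1 / 2 ^ j \<and> indicator (cball 0 1) z * norm z powr - p \<le> (1 / 2 ^ Suc j) powr - q"
      using j' z by (auto simp: indicator_def)
  next
    have "(1 / 2 ^ Suc j) powr - q * (1 / 2 ^ j) ^ DIM('a) = 2 powr q * (2 powr (q - real DIM('a))) ^ j" for j :: nat
    proof -
      have "(1 / 2 ^ Suc j) powr - q = (2::real) powr (q * real (Suc j))"
        by (simp add: powr_powr powr_realpow[symmetric] powr_minus_divide[symmetric] mult.commute del: power_Suc of_nat_Suc)
      moreover have "((1::real) / 2 ^ j) ^ DIM('a) = 2 powr (- real DIM('a) * real j)"
        by (simp add: powr_minus_divide powr_realpow[symmetric] powr_powr power_divide mult.commute)
      moreover have "((2::real) powr (q - real DIM('a))) ^ j = 2 powr ((q - real DIM('a)) * real j)"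
        by (simp add: powr_realpow[symmetric] powr_powr)
      ultimately show ?thesis by (simp add: powr_add[symmetric] algebra_simps)
    qed
    moreover have "norm ((2::real) powr (q - real DIM('a))) < 1" using q by (simp add: powr_less_one)
    ultimately show "summable (\<lambda>j. (1 / 2 ^ Suc j) powr - q * (1 / 2 ^ j) ^ DIM('a))"
      by (simp add: summable_mult summable_geometric del: power_Suc)
  next
    show "(\<lambda>z::'a. indicator (cball 0 1) z * norm z powr - p) \<in> borel_measurable borel"
      by (intro borel_measurable_times borel_measurable_indicator powr_real_measurable) auto
  qed auto
qed

text \<open>At \<open>z = 0\<close> the value is 0 because \<open>0 powr _ = 0\<close>; comparisons
  with this kernel therefore exclude the origin or treat it separately.\<close>

abbreviation singular_kernel :: "real \<Rightarrow> 'a::euclidean_space \<Rightarrow> real" where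
  "singular_kernel s z \<equiv> norm z powr - (real DIM('a) + 2 * s)"

text \<open>Near 0 the order of the singularity is \<open>DIM('a) + 2 * s - \<alpha>\<close>, below
  the dimension; at infinity the decay exceeds the dimension. This weight dominates second
  differences times the kernel, uniformly in the regularisation.\<close>

lemma integrable_min_norm_powr:
  assumes "0 < s" "2 * s < \<alpha>"
  shows "integrable lborel (\<lambda>z::'a::euclidean_space. min 1 (norm z powr \<alpha>) * singular_kernel s z)"
proof (rule Bochner_Integration.integrable_bound)
  show "integrable lborel (\<lambda>z::'a. indicator {z. 1 \<le> norm z} z * singular_kernel s z
     + indicator (cball 0 1) z * norm z powr - (real DIM('a) + 2 * s - \<alpha>))"
    using assms by (intro Bochner_Integration.integrable_add integrable_norm_powr_far integrable_norm_powr_near) auto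
  show "AE z::'a in lborel. norm (min 1 (norm z powr \<alpha>) * singular_kernel s z)
    \<le> norm (indicator {z. 1 \<le> norm z} z * singular_kernel s z
     + indicator (cball 0 1) z * norm z powr - (real DIM('a) + 2 * s - \<alpha>))"
  proof (rule AE_I2)
    fix z :: 'a
    have e: "norm z powr \<alpha> * singular_kernel s z = norm z powr - (real DIM('a) + 2 * s - \<alpha>)"
      by (simp add: powr_add[symmetric] algebra_simps)
    have "min 1 (norm z powr \<alpha>) * singular_kernel s z \<le>
      indicator {z. 1 \<le> norm z} z * singular_kernel s z
     + indicator (cball 0 1) z * norm z powr - (real DIM('a) + 2 * s - \<alpha>)"
    proof (cases "1 \<le> norm z")
      case True
      have "min 1 (norm z powr \<alpha>) * singular_kernel s z \<le> 1 * singular_kernel s z"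
        by (intro mult_right_mono) auto
      moreover have "0 \<le> indicat_real (cball 0 1) z * norm z powr - (real DIM('a) + 2 * s - \<alpha>)" by simp
      moreover have "indicat_real {z. 1 \<le> norm z} z = 1" using True by simp
      ultimately show ?thesis by (simp only: mult_1)
    next
      case False
      have "min 1 (norm z powr \<alpha>) * singular_kernel s z \<le> norm z powr \<alpha> * singular_kernel s z"
        by (intro mult_right_mono) auto
      then show ?thesis using False e by (simp add: indicator_def)
    qed
    then show "norm (min 1 (norm z powr \<alpha>) * singular_kernel s z)
      \<le> norm (indicator {z. 1 \<le> norm z} z * singular_kernel s z
       + indicator (cball 0 1) z * norm z powr - (real DIM('a) + 2 * s - \<alpha>))"
      by (auto simp: abs_mult)
  qed
qed simp

text \<open>The parameter enters like one more coordinate of z. Hence the homogeneity under joint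
  dilation of z and \<epsilon>, and slices of such a kernel in a product space are again kernels of
  this family.\<close>

definition reg_kernel :: "real \<Rightarrow> real \<Rightarrow> 'a::euclidean_space \<Rightarrow> real" where
  "reg_kernel s \<epsilon> z = ((norm z)\<^sup>2 + \<epsilon>\<^sup>2) powr (- ((real DIM('a) + 2 * s) / 2))"

lemma reg_kernel_measurable [measurable]: "reg_kernel s \<epsilon> \<in> borel_measurable borel"
  unfolding reg_kernel_def by measurable

lemma reg_kernel_nonneg [simp]: "0 \<le> reg_kernel s \<epsilon> z" by (simp add: reg_kernel_def)

lemma reg_kernel_uminus [simp]: "reg_kernel s \<epsilon> (- z) = reg_kernel s \<epsilon> z" by (simp add: reg_kernel_def)

lemma reg_kernel_zero:
  fixes z :: "'a::euclidean_space"
  assumes "z \<noteq> 0"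
  shows "reg_kernel s 0 z = singular_kernel s z"
proof -
  have "(norm z)\<^sup>2 = norm z powr 2" using assms by (simp add: powr_numeral)
  then have "reg_kernel s 0 z = (norm z powr 2) powr - ((real DIM('a) + 2 * s) / 2)" by (simp add: reg_kernel_def)
  moreover have "2 * - ((real DIM('a) + 2 * s) / 2) = - (real DIM('a) + 2 * s)" by (simp add: field_simps)
  ultimately show ?thesis unfolding powr_powr by metis
qed

text \<open>The last hypothesis keeps the smaller base positive: at base 0 \<open>powr\<close>
  returns 0, and a negative power is no longer decreasing.\<close>

lemma reg_kernel_antimono:
  fixes w z :: "'a::euclidean_space"
  assumes "0 < s" "(norm w)\<^sup>2 + \<delta>\<^sup>2 \<le> (norm z)\<^sup>2 + \<epsilon>\<^sup>2" "w \<noteq> 0 \<or> \<delta> \<noteq> 0"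
  shows "reg_kernel s \<epsilon> z \<le> reg_kernel s \<delta> w"
proof -
  have "0 < (norm w)\<^sup>2 + \<delta>\<^sup>2" using assms(3) by (auto intro: add_pos_nonneg add_nonneg_pos)
  then show ?thesis unfolding reg_kernel_def using assms by (intro powr_mono2') auto
qed

lemma reg_kernel_le:
  assumes "0 < s" "z \<noteq> 0"
  shows "reg_kernel s \<epsilon> (z::'a::euclidean_space) \<le> singular_kernel s z"
  using reg_kernel_antimono[of s z 0 z \<epsilon>] assms by (simp add: reg_kernel_zero)

lemma reg_kernel_le_const:
  fixes z :: "'a::euclidean_space"
  assumes "0 < s" "0 < \<epsilon>"
  shows "reg_kernel s \<epsilon> z \<le> reg_kernel s \<epsilon> (0::'a::euclidean_space)"
  using assms by (intro reg_kernel_antimono) auto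

lemma reg_kernel_integrable:
  assumes "0 < s" "0 < \<epsilon>"
  shows "integrable lborel (reg_kernel s \<epsilon> :: 'a::euclidean_space \<Rightarrow> real)"
proof (rule Bochner_Integration.integrable_bound)
  show "integrable lborel (\<lambda>z::'a. indicator {z. 1 \<le> norm z} z * singular_kernel s z
      + indicator (cball 0 1) z * reg_kernel s \<epsilon> (0::'a))"
    using assms by (intro Bochner_Integration.integrable_add integrable_norm_powr_far integrable_mult_left
        integrable_real_indicator emeasure_lborel_cball_finite) auto
  show "AE z::'a in lborel. norm (reg_kernel s \<epsilon> z) \<le> norm (indicator {z. 1 \<le> norm z} z * singular_kernel s z
      + indicator (cball 0 1) z * reg_kernel s \<epsilon> (0::'a))"
  proof (rule AE_I2)
    fix z :: 'a
    show "norm (reg_kernel s \<epsilon> z) \<le> norm (indicator {z. 1 \<le> norm z} z * singular_kernel s z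
      + indicator (cball 0 1) z * reg_kernel s \<epsilon> (0::'a))"
    proof (cases "1 \<le> norm z")
      case True
      then have "reg_kernel s \<epsilon> z \<le> singular_kernel s z" using assms by (intro reg_kernel_le) auto
      then show ?thesis using True by (auto simp: indicator_def add_increasing2)
    next
      case False
      then show ?thesis using reg_kernel_le_const[OF assms, of z] by (auto simp: indicator_def)
    qed
  qed
qed simp

lemma integrable_mult_bounded:
  fixes f g :: "'a \<Rightarrow> real"
  assumes "integrable M f" "g \<in> borel_measurable M" "\<And>x. \<bar>g x\<bar> \<le> C"
  shows "integrable M (\<lambda>x. g x * f x)" "integrable M (\<lambda>x. f x * g x)"
proof -
  show "integrable M (\<lambda>x. g x * f x)"
  proof (rule Bochner_Integration.integrable_bound)
    show "integrable M (\<lambda>x. C * f x)" using assms by simp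
    have "\<bar>g x\<bar> * \<bar>f x\<bar> \<le> \<bar>C\<bar> * \<bar>f x\<bar>" for x using assms(3)[of x] by (intro mult_right_mono) auto
    then show "AE x in M. norm (g x * f x) \<le> norm (C * f x)" by (auto simp: abs_mult)
  qed (use assms in \<open>auto intro: borel_measurable_times\<close>)
  then show "integrable M (\<lambda>x. f x * g x)" by (simp add: mult.commute)
qed

lemma integrable_tensor_product:
  fixes f :: "'a::euclidean_space \<Rightarrow> real" and g :: "'b::euclidean_space \<Rightarrow> real"
  assumes "integrable lborel f" "integrable lborel g"
  shows "integrable (lborel \<Otimes>\<^sub>M lborel) (\<lambda>(x, y). f x * g y)"
proof (rule lborel_pair.Fubini_integrable)
  have [measurable]: "f \<in> borel_measurable borel" "g \<in> borel_measurable borel" using assms by auto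
  show "(\<lambda>(x, y). f x * g y) \<in> borel_measurable (lborel \<Otimes>\<^sub>M lborel)" by measurable
qed (use assms in \<open>auto simp: abs_mult\<close>)

section \<open>A cutoff function and its second differences\<close>

text \<open>Of class C^{1,1}: its smoothness enters only through second differences, and as the
  squared positive part of a polynomial it has explicit constants.\<close>

definition bump :: "'a::real_inner \<Rightarrow> real" where
  "bump x = (max 0 (1 - (norm x)\<^sup>2))\<^sup>2"

lemma bump_nonneg [simp]: "0 \<le> bump x" by (simp add: bump_def)

lemma bump_le_1: "bump x \<le> 1"
  unfolding bump_def by (rule power_le_one) auto

lemma bump_eq_0: "1 \<le> norm x \<Longrightarrow> bump x = 0"
  using one_le_power[of "norm x" 2] unfolding bump_def by (subst max_absorb1) auto

lemma continuous_bump: "continuous_on UNIV bump"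
  unfolding bump_def by (intro continuous_intros)

lemma bump_measurable [measurable]: "bump \<in> borel_measurable (borel::'a::{euclidean_space} measure)"
  using continuous_bump by (rule borel_measurable_continuous_onI)

text \<open>The second derivative of the squared positive part takes only the values 0 and 2; the
  cases follow the position of the kink relative to the three points.\<close>

lemma positive_part_square_second_difference:
  fixes a b :: real
  shows "\<bar>(max 0 (a + b))\<^sup>2 + (max 0 (a - b))\<^sup>2 - 2 * (max 0 a)\<^sup>2\<bar> \<le> 2 * b\<^sup>2"
proof -
  have *: "\<bar>(max 0 (a + b))\<^sup>2 + (max 0 (a - b))\<^sup>2 - 2 * (max 0 a)\<^sup>2\<bar> \<le> 2 * b\<^sup>2" if "0 \<le> b" for b
  proof -
    consider "a + b \<le> 0" | "a \<le> 0" "0 \<le> a + b" | "0 \<le> a" "a \<le> b" | "b \<le> a" using that by linarith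
    then show ?thesis
    proof cases
      case 1
      then have "max 0 (a + b) = 0" "max 0 (a - b) = 0" "max 0 a = 0" using that by auto
      then show ?thesis by simp
    next
      case 2
      then have "(a + b)\<^sup>2 \<le> b\<^sup>2" using that by (intro power_mono) auto
      moreover have "max 0 (a + b) = a + b" "max 0 (a - b) = 0" "max 0 a = 0" using 2 that by auto
      moreover have "0 \<le> (a + b)\<^sup>2" "0 \<le> b\<^sup>2" by auto
      ultimately have "\<bar>(max 0 (a + b))\<^sup>2 + (max 0 (a - b))\<^sup>2 - 2 * (max 0 a)\<^sup>2\<bar> = (a + b)\<^sup>2" by simp
      also have "\<dots> \<le> b\<^sup>2" by fact
      also have "\<dots> \<le> 2 * b\<^sup>2" by simp
      finally show ?thesis .
    next
      case 3
      have "(a + b)\<^sup>2 - 2 * a\<^sup>2 = b\<^sup>2 + 2*a*b - a\<^sup>2" by (simp add: power2_eq_square algebra_simps)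
      moreover have "2*a*b - a\<^sup>2 \<le> b\<^sup>2" using zero_le_power2[of "a - b"] by (simp add: power2_eq_square algebra_simps)
      moreover have "a\<^sup>2 \<le> a * b" using 3 by (simp add: power2_eq_square mult_left_mono)
      moreover have "0 \<le> a * b" using 3 that by simp
      moreover have "max 0 (a + b) = a + b" "max 0 (a - b) = 0" "max 0 a = a" using 3 that by auto
      ultimately show ?thesis using zero_le_power2[of b] unfolding abs_le_iff
        by (simp only: zero_power2) linarith
    next
      case 4
      then show ?thesis using that by (auto simp: max_def power2_eq_square algebra_simps)
    qed
  qed
  show ?thesis
  proof (cases "0 \<le> b")
    case False
    then show ?thesis using *[of "-b"] by (simp add: add.commute)
  qed (rule *)
qed

text \<open>For \<open>norm h < 1\<close> and \<open>norm x \<le> 2\<close>, the polynomial inside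
  the positive part takes at \<open>x + h\<close> and \<open>x - h\<close> the values
  \<open>p - (norm h)\<^sup>2\<close> minus and plus \<open>2 * (x \<bullet> h)\<close>, where
  \<open>p = 1 - (norm x)\<^sup>2\<close>. The second difference about this centre costs
  \<open>32 * (norm h)\<^sup>2\<close>, and moving the centre to p costs twice
  \<open>2 * (norm h)\<^sup>2\<close>; together 36. Elsewhere all terms vanish or the trivial bound
  is enough.\<close>

lemma bump_second_difference:
  "\<bar>bump (x + h) + bump (x - h) - 2 * bump x\<bar> \<le> 36 * min 1 ((norm h)\<^sup>2)"
proof (cases "1 \<le> norm h")
  case True
  then have "1 \<le> (norm h)\<^sup>2" by (rule one_le_power)
  then show ?thesis using bump_le_1[of "x+h"] bump_le_1[of "x-h"] bump_le_1[of x]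
      bump_nonneg[of "x+h"] bump_nonneg[of "x-h"] bump_nonneg[of x] unfolding min_def abs_le_iff
    by (auto simp del: bump_nonneg)
next
  case False
  then have h1: "(norm h)\<^sup>2 \<le> 1" by (intro power_le_one) auto
  show ?thesis
  proof (cases "norm x \<le> 2")
    case True
    define p where "p = 1 - (norm x)\<^sup>2"
    define g where "g t = (max 0 t)\<^sup>2" for t :: real
    have e: "bump (x + h) = g (p - (norm h)\<^sup>2 + 2 * - (x \<bullet> h))" "bump (x - h) = g (p - (norm h)\<^sup>2 - 2 * - (x \<bullet> h))" "bump x = g p"
      unfolding bump_def g_def p_def
      by (simp_all add: power2_norm_eq_inner inner_simps inner_commute algebra_simps)
    have "\<bar>g (p - (norm h)\<^sup>2 + 2 * - (x \<bullet> h)) + g (p - (norm h)\<^sup>2 - 2 * - (x \<bullet> h)) - 2 * g (p - (norm h)\<^sup>2)\<bar> \<le> 2 * (2 * - (x \<bullet> h))\<^sup>2"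
      unfolding g_def by (rule positive_part_square_second_difference)
    also have "\<dots> = 8 * (x \<bullet> h)\<^sup>2" by (simp add: power_mult_distrib)
    also have "\<dots> \<le> 8 * (norm x * norm h)\<^sup>2"
      using Cauchy_Schwarz_ineq2[of x h] by (intro mult_left_mono power2_le_iff_abs_le[THEN iffD2]) auto
    also have "\<dots> \<le> 8 * (2 * norm h)\<^sup>2" using True by (intro mult_left_mono power_mono mult_right_mono) auto
    finally have 1: "\<bar>g (p - (norm h)\<^sup>2 + 2 * - (x \<bullet> h)) + g (p - (norm h)\<^sup>2 - 2 * - (x \<bullet> h)) - 2 * g (p - (norm h)\<^sup>2)\<bar> \<le> 32 * (norm h)\<^sup>2"
      by (simp add: power_mult_distrib)
    have p1: "p \<le> 1" by (simp add: p_def)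
    have 2: "\<bar>g p - g (p - (norm h)\<^sup>2)\<bar> \<le> 2 * (norm h)\<^sup>2"
    proof -
      define A where "A = max 0 p"
      define B where "B = max 0 (p - (norm h)\<^sup>2)"
      have A: "0 \<le> B" "B \<le> A" "A \<le> 1" "A - B \<le> (norm h)\<^sup>2" using p1 using zero_le_power2[of "norm h"] unfolding A_def B_def max_def by (simp_all add: not_le del: zero_le_power2, argo+)
      have "(A + B) * (A - B) \<le> 2 * (norm h)\<^sup>2" using A by (intro mult_mono) auto
      moreover have "0 \<le> (A + B) * (A - B)" using A by simp
      moreover have "g p - g (p - (norm h)\<^sup>2) = (A + B) * (A - B)"
        unfolding g_def A_def[symmetric] B_def[symmetric] by (simp add: power2_eq_square algebra_simps)
      ultimately show ?thesis by simp
    qed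
    show ?thesis using 1 2 h1 unfolding e by (simp add: min_def)
  next
    case far: False
    have "norm x - norm h \<le> norm (x + h)" by (metis diff_add_cancel norm_minus_commute norm_triangle_ineq2 add.commute add_diff_cancel norm_minus_cancel norm_diff_ineq)
    moreover have "norm x - norm h \<le> norm (x - h)" by (rule norm_triangle_ineq2)
    ultimately have "1 \<le> norm (x + h)" "1 \<le> norm (x - h)" "1 \<le> norm x" using far False by auto
    then show ?thesis by (simp add: bump_eq_0)
  qed
qed

section \<open>Affine changes of variables\<close>

text \<open>If one side of the integral formula is not integrable, neither is the other, and both
  integrals are 0 by convention.\<close>

lemma
  fixes f :: "'a::euclidean_space \<Rightarrow> real"
  shows lborel_integrable_affine_iff: "c \<noteq> 0 \<Longrightarrow> integrable lborel (\<lambda>x. f (t + c *\<^sub>R x)) \<longleftrightarrow> integrable lborel f"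
    and lborel_integral_affine: "c \<noteq> 0 \<Longrightarrow> (\<integral>x. f (t + c *\<^sub>R x) \<partial>lborel) = (\<integral>x. f x \<partial>lborel) / \<bar>c\<bar> ^ DIM('a)"
proof -
  assume c: "c \<noteq> 0"
  have *: "integrable lborel (\<lambda>x. f (t + c *\<^sub>R x)) \<and> (\<integral>x. f (t + c *\<^sub>R x) \<partial>lborel) = (\<integral>x. f x \<partial>lborel) / \<bar>c\<bar> ^ DIM('a)"
    if f: "integrable lborel f" and c: "c \<noteq> 0" for f :: "'a \<Rightarrow> real" and t c
  proof -
    have [measurable]: "f \<in> borel_measurable borel" using f by auto
    let ?T = "\<lambda>x::'a. t + c *\<^sub>R x"
    have 1: "(lborel::'a measure) = density (distr lborel borel ?T) (\<lambda>_. \<bar>c\<bar> ^ DIM('a))"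
      using c by (rule lborel_affine)
    have "integrable (density (distr lborel borel ?T) (\<lambda>_. \<bar>c\<bar> ^ DIM('a))) f" using f 1 by simp
    then have "integrable (distr lborel borel ?T) (\<lambda>x. \<bar>c\<bar> ^ DIM('a) *\<^sub>R f x)"
      by (subst (asm) integrable_density) auto
    then have i: "integrable lborel (\<lambda>x. \<bar>c\<bar> ^ DIM('a) *\<^sub>R f (?T x))" by (subst (asm) integrable_distr_eq) auto
    have "(\<integral>x. f x \<partial>lborel) = (\<integral>x. f x \<partial>density (distr lborel borel ?T) (\<lambda>_. \<bar>c\<bar> ^ DIM('a)))"
      using 1 by simp
    also have "\<dots> = (\<integral>x. \<bar>c\<bar> ^ DIM('a) *\<^sub>R f (?T x) \<partial>lborel)"
      by (subst integral_density) (auto simp: integral_distr)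
    finally show ?thesis using i c by (simp add: field_simps)
  qed
  have bwd: "integrable lborel f" if "integrable lborel (\<lambda>x. f (t + c *\<^sub>R x))"
    using *[OF that, of "1 / c" "- (1 / c) *\<^sub>R t"] c by (simp add: algebra_simps)
  show "integrable lborel (\<lambda>x. f (t + c *\<^sub>R x)) \<longleftrightarrow> integrable lborel f" using * c bwd by blast
  show "(\<integral>x. f (t + c *\<^sub>R x) \<partial>lborel) = (\<integral>x. f x \<partial>lborel) / \<bar>c\<bar> ^ DIM('a)"
  proof (cases "integrable lborel f")
    case False
    then have "\<not> integrable lborel (\<lambda>x. f (t + c *\<^sub>R x))" using bwd by blast
    then show ?thesis using not_integrable_integral_eq[of lborel f] False
        not_integrable_integral_eq[of lborel "\<lambda>x. f (t + c *\<^sub>R x)"] by simp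
  qed (use *[of f c t] c in blast)
qed

lemma
  fixes f :: "'a::euclidean_space \<Rightarrow> real"
  shows lborel_integrable_add_iff: "integrable lborel (\<lambda>x. f (t + x)) \<longleftrightarrow> integrable lborel f"
    and lborel_integral_add: "(\<integral>x. f (t + x) \<partial>lborel) = (\<integral>x. f x \<partial>lborel)"
    and lborel_integrable_reflect_iff: "integrable lborel (\<lambda>x. f (t - x)) \<longleftrightarrow> integrable lborel f"
    and lborel_integral_reflect: "(\<integral>x. f (t - x) \<partial>lborel) = (\<integral>x. f x \<partial>lborel)"
    and lborel_integrable_diff_iff: "integrable lborel (\<lambda>x. f (x - t)) \<longleftrightarrow> integrable lborel f"
    and lborel_integral_diff: "(\<integral>x. f (x - t) \<partial>lborel) = (\<integral>x. f x \<partial>lborel)"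
  using lborel_integrable_affine_iff[of 1 f t] lborel_integral_affine[of 1 f t]
    lborel_integrable_affine_iff[of "-1" f t] lborel_integral_affine[of "-1" f t]
    lborel_integrable_affine_iff[of 1 f "-t"] lborel_integral_affine[of 1 f "-t"] by simp_all

section \<open>The regularised operator\<close>

abbreviation kernel_mass :: "real \<Rightarrow> real \<Rightarrow> 'a::euclidean_space itself \<Rightarrow> real" where
  "kernel_mass s \<epsilon> _ \<equiv> (\<integral>z. reg_kernel s \<epsilon> (z::'a) \<partial>lborel)"

text \<open>This is the integral of \<open>(u x - u y) * reg_kernel s \<epsilon> (y - x)\<close>
  over y, split into a multiplication and a convolution; the split is possible because the kernel
  has finite mass.\<close>

definition reg_lap :: "real \<Rightarrow> real \<Rightarrow> ('a::euclidean_space \<Rightarrow> real) \<Rightarrow> 'a \<Rightarrow> real" where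
  "reg_lap s \<epsilon> u x = kernel_mass s \<epsilon> TYPE('a) * u x - (\<integral>y. reg_kernel s \<epsilon> (y - x) * u y \<partial>lborel)"

context
  fixes s \<epsilon> :: real
  assumes s: "0 < s" and \<epsilon>: "0 < \<epsilon>"
begin

lemma kernel_translate_integrable: "integrable lborel (\<lambda>y. reg_kernel s \<epsilon> (y - x :: 'a::euclidean_space))"
  by (subst lborel_integrable_diff_iff) (rule reg_kernel_integrable[OF s \<epsilon>])

lemma kernel_times_bounded_integrable:
  fixes u :: "'a::euclidean_space \<Rightarrow> real"
  assumes "u \<in> borel_measurable borel" "\<And>x. \<bar>u x\<bar> \<le> M"
  shows "integrable lborel (\<lambda>y. reg_kernel s \<epsilon> (y - x) * u y)"
  using assms by (intro integrable_mult_bounded(2)[OF kernel_translate_integrable, where C = M]) auto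

lemma kernel_times_integrable_integrable:
  fixes u :: "'a::euclidean_space \<Rightarrow> real"
  assumes "integrable lborel u"
  shows "integrable lborel (\<lambda>y. reg_kernel s \<epsilon> (y - x) * u y)"
  using reg_kernel_le_const[OF s \<epsilon>]
  by (intro integrable_mult_bounded(1)[OF assms, where C = "reg_kernel s \<epsilon> (0::'a)"]) auto

text \<open>Averaging the substitutions \<open>y = x + z\<close> and \<open>y = x - z\<close>, which
  the even kernel does not distinguish, produces second differences. For regular u these compensate
  the singularity that develops as \<epsilon> tends to 0.\<close>

lemma
  fixes u :: "'a::euclidean_space \<Rightarrow> real"
  assumes u: "u \<in> borel_measurable borel" "\<And>x. \<bar>u x\<bar> \<le> M"
  shows reg_lap_second_difference_integrable:
      "integrable lborel (\<lambda>z. (2 * u x - u (x + z) - u (x - z)) * reg_kernel s \<epsilon> z)"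
    and reg_lap_second_difference:
      "reg_lap s \<epsilon> u x = (\<integral>z. (2 * u x - u (x + z) - u (x - z)) * reg_kernel s \<epsilon> z \<partial>lborel) / 2"
proof -
  note [measurable] = u(1)
  note K = reg_kernel_integrable[OF s \<epsilon>, where 'a = 'a]
  have a: "integrable lborel (\<lambda>z. u (x + z) * reg_kernel s \<epsilon> z)"
    by (rule integrable_mult_bounded(1)[OF K, where C = M]) (use u in auto)
  have b: "integrable lborel (\<lambda>z. u (x - z) * reg_kernel s \<epsilon> z)"
    by (rule integrable_mult_bounded(1)[OF K, where C = M]) (use u in auto)
  have ia: "(\<integral>z. u (x + z) * reg_kernel s \<epsilon> z \<partial>lborel) = (\<integral>y. reg_kernel s \<epsilon> (y - x) * u y \<partial>lborel)"
    using lborel_integral_add[of "\<lambda>y. reg_kernel s \<epsilon> (y - x) * u y" x] by (simp add: mult.commute)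
  have ib: "(\<integral>z. u (x - z) * reg_kernel s \<epsilon> z \<partial>lborel) = (\<integral>y. reg_kernel s \<epsilon> (y - x) * u y \<partial>lborel)"
    using lborel_integral_reflect[of "\<lambda>y. reg_kernel s \<epsilon> (y - x) * u y" x] by (simp add: mult.commute)
  show "integrable lborel (\<lambda>z. (2 * u x - u (x + z) - u (x - z)) * reg_kernel s \<epsilon> z)"
    using a b K by (simp add: left_diff_distrib)
  show "reg_lap s \<epsilon> u x = (\<integral>z. (2 * u x - u (x + z) - u (x - z)) * reg_kernel s \<epsilon> z \<partial>lborel) / 2"
    using a b K by (simp add: left_diff_distrib reg_lap_def ia ib)
qed

text \<open>Away from 0 \<open>reg_kernel\<close> lies below the singular kernel, so the bound does
  not involve \<epsilon>, in contrast to the one through \<open>kernel_mass\<close>.\<close>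

lemma reg_lap_bound:
  fixes u :: "'a::euclidean_space \<Rightarrow> real"
  assumes u: "u \<in> borel_measurable borel" "\<And>x. \<bar>u x\<bar> \<le> M" and s1: "s < 1"
    and d: "\<And>z. \<bar>u (x + z) + u (x - z) - 2 * u x\<bar> \<le> L * min 1 ((norm z)\<^sup>2)"
  shows "\<bar>reg_lap s \<epsilon> u x\<bar> \<le> L * integral\<^sup>L lborel (\<lambda>z::'a. min 1 (norm z powr 2) * singular_kernel s z)"
proof -
  let ?g = "\<lambda>z::'a. min 1 (norm z powr 2) * singular_kernel s z"
  have i: "integrable lborel ?g" using s s1 by (intro integrable_min_norm_powr) auto
  have L: "0 \<le> L"
  proof -
    obtain b :: 'a where "b \<in> Basis" using nonempty_Basis by blast
    then show ?thesis using d[of b] by auto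
  qed
  have "\<bar>(\<integral>z. (2 * u x - u (x + z) - u (x - z)) * reg_kernel s \<epsilon> z \<partial>lborel)\<bar>
    \<le> (\<integral>z. \<bar>(2 * u x - u (x + z) - u (x - z)) * reg_kernel s \<epsilon> z\<bar> \<partial>lborel)"
    by (rule integral_abs_bound)
  also have "\<dots> \<le> (\<integral>z. L * ?g z \<partial>lborel)"
  proof (rule integral_mono)
    show "integrable lborel (\<lambda>z. \<bar>(2 * u x - u (x + z) - u (x - z)) * reg_kernel s \<epsilon> z\<bar>)"
      using reg_lap_second_difference_integrable[OF u] by (rule integrable_abs)
    show "integrable lborel (\<lambda>z. L * ?g z)" using i by simp
    fix z
    show "\<bar>(2 * u x - u (x + z) - u (x - z)) * reg_kernel s \<epsilon> z\<bar> \<le> L * ?g z"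
    proof (cases "z = 0")
      case False
      have "\<bar>2 * u x - u (x + z) - u (x - z)\<bar> \<le> L * min 1 (norm z powr 2)"
        using d[of z] False by (simp add: powr_numeral abs_minus_commute algebra_simps)
      moreover have "\<bar>reg_kernel s \<epsilon> z\<bar> \<le> singular_kernel s z" using reg_kernel_le[OF s False] by simp
      ultimately have "\<bar>2 * u x - u (x + z) - u (x - z)\<bar> * \<bar>reg_kernel s \<epsilon> z\<bar> \<le> L * min 1 (norm z powr 2) * singular_kernel s z"
        using L by (intro mult_mono) auto
      then show ?thesis by (simp only: abs_mult mult.assoc)
    qed simp
  qed
  also have "\<dots> = L * (\<integral>z. ?g z \<partial>lborel)" by simp
  finally have "2 * \<bar>reg_lap s \<epsilon> u x\<bar> \<le> L * (\<integral>z. ?g z \<partial>lborel)"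
    by (simp add: reg_lap_second_difference[OF u])
  moreover have "0 \<le> \<bar>reg_lap s \<epsilon> u x\<bar>" by simp
  ultimately show ?thesis by linarith
qed

lemma kernel_product_integrable:
  fixes f V :: "'a::euclidean_space \<Rightarrow> real"
  assumes f: "integrable lborel f" and V: "V \<in> borel_measurable borel" "\<And>x. \<bar>V x\<bar> \<le> M"
  shows "integrable (lborel \<Otimes>\<^sub>M lborel) (\<lambda>(x, y). f x * (reg_kernel s \<epsilon> (y - x) * V y))"
proof (rule lborel_pair.Fubini_integrable)
  have [measurable]: "f \<in> borel_measurable borel" using f by auto
  note [measurable] = V(1)
  show "(\<lambda>(x, y). f x * (reg_kernel s \<epsilon> (y - x) * V y)) \<in> borel_measurable (lborel \<Otimes>\<^sub>M lborel)" by measurable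
  have i: "integrable lborel (\<lambda>y. reg_kernel s \<epsilon> (y - x) * V y)" for x
    by (rule kernel_times_bounded_integrable[OF V])
  show "AE x in lborel. integrable lborel (\<lambda>y. case (x, y) of (x, y) \<Rightarrow> f x * (reg_kernel s \<epsilon> (y - x) * V y))"
    using i by simp
  show "integrable lborel (\<lambda>x. \<integral>y. norm (case (x, y) of (x, y) \<Rightarrow> f x * (reg_kernel s \<epsilon> (y - x) * V y)) \<partial>lborel)"
  proof (rule Bochner_Integration.integrable_bound)
    show "integrable lborel (\<lambda>x. kernel_mass s \<epsilon> TYPE('a) * M * f x)" using f by simp
    have "(\<lambda>x. \<integral>y. norm (f x * (reg_kernel s \<epsilon> (y - x) * V y)) \<partial>lborel) \<in> borel_measurable borel" by measurable
    then show "(\<lambda>x. \<integral>y. norm (case (x, y) of (x, y) \<Rightarrow> f x * (reg_kernel s \<epsilon> (y - x) * V y)) \<partial>lborel) \<in> borel_measurable lborel"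
      by simp
    show "AE x in lborel. norm (\<integral>y. norm (case (x, y) of (x, y) \<Rightarrow> f x * (reg_kernel s \<epsilon> (y - x) * V y)) \<partial>lborel)
        \<le> norm (kernel_mass s \<epsilon> TYPE('a) * M * f x)"
    proof (rule AE_I2)
      fix x
      have M: "0 \<le> M" using V(2)[of 0] by linarith
      have "(\<integral>y. \<bar>reg_kernel s \<epsilon> (y - x) * V y\<bar> \<partial>lborel) \<le> (\<integral>y. reg_kernel s \<epsilon> (y - x) * M \<partial>lborel)"
        using integrable_abs[OF i[of x]] kernel_translate_integrable[of x] V(2)
        by (intro integral_mono) (auto simp: abs_mult intro!: mult_left_mono)
      also have "\<dots> = kernel_mass s \<epsilon> TYPE('a) * M" by (simp add: lborel_integral_diff)
      finally have "\<bar>f x\<bar> * (\<integral>y. \<bar>reg_kernel s \<epsilon> (y - x) * V y\<bar> \<partial>lborel) \<le> \<bar>f x\<bar> * (kernel_mass s \<epsilon> TYPE('a) * M)"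
        by (intro mult_left_mono) auto
      moreover have "(\<integral>y. \<bar>f x * (reg_kernel s \<epsilon> (y - x) * V y)\<bar> \<partial>lborel) = \<bar>f x\<bar> * (\<integral>y. \<bar>reg_kernel s \<epsilon> (y - x) * V y\<bar> \<partial>lborel)"
        unfolding abs_mult[of "f x"] by (rule integral_mult_right_zero)
      moreover have "norm (kernel_mass s \<epsilon> TYPE('a) * M * f x) = \<bar>f x\<bar> * (kernel_mass s \<epsilon> TYPE('a) * M)"
        using M by (simp add: abs_mult mult.commute)
      ultimately show "norm (\<integral>y. norm (case (x, y) of (x, y) \<Rightarrow> f x * (reg_kernel s \<epsilon> (y - x) * V y)) \<partial>lborel)
        \<le> norm (kernel_mass s \<epsilon> TYPE('a) * M * f x)"
        by simp
    qed
  qed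
qed

text \<open>Fubini and the evenness of the kernel. The pairing is between an integrable and a
  bounded function, so the whole operator can be moved from a rough V onto f.\<close>

lemma reg_lap_selfadjoint:
  fixes f V :: "'a::euclidean_space \<Rightarrow> real"
  assumes f: "integrable lborel f" and V: "V \<in> borel_measurable borel" "\<And>x. \<bar>V x\<bar> \<le> M"
  shows "integrable lborel (\<lambda>x. f x * reg_lap s \<epsilon> V x)" "integrable lborel (\<lambda>x. V x * reg_lap s \<epsilon> f x)"
    "(\<integral>x. f x * reg_lap s \<epsilon> V x \<partial>lborel) = (\<integral>x. V x * reg_lap s \<epsilon> f x \<partial>lborel)"
proof -
  note P = kernel_product_integrable[OF f V]
  have sym: "reg_kernel s \<epsilon> (x - y) = reg_kernel s \<epsilon> (y - x)" for x y :: 'a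
    using reg_kernel_uminus[of s \<epsilon> "x - y"] by simp
  have fV: "integrable lborel (\<lambda>x. kernel_mass s \<epsilon> TYPE('a) * (f x * V x))"
    using integrable_mult_bounded(2)[OF f _ V(2)] V(1) by auto
  have 1: "integrable lborel (\<lambda>x. f x * (\<integral>y. reg_kernel s \<epsilon> (y - x) * V y \<partial>lborel))"
    using lborel_pair.integrable_fst'[OF P] by simp
  have e: "(\<integral>x. f x * (reg_kernel s \<epsilon> (y - x) * V y) \<partial>lborel) = V y * (\<integral>x. reg_kernel s \<epsilon> (x - y) * f x \<partial>lborel)" for y
  proof -
    have "(\<integral>x. f x * (reg_kernel s \<epsilon> (y - x) * V y) \<partial>lborel) = (\<integral>x. V y * (reg_kernel s \<epsilon> (x - y) * f x) \<partial>lborel)"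
      by (subst sym) (simp add: mult_ac)
    then show ?thesis by simp
  qed
  have 2: "integrable lborel (\<lambda>y. V y * (\<integral>x. reg_kernel s \<epsilon> (x - y) * f x \<partial>lborel))"
    using lborel_pair.integrable_snd[OF P] by (simp add: e)
  have 3: "(\<integral>x. f x * (\<integral>y. reg_kernel s \<epsilon> (y - x) * V y \<partial>lborel) \<partial>lborel)
     = (\<integral>y. V y * (\<integral>x. reg_kernel s \<epsilon> (x - y) * f x \<partial>lborel) \<partial>lborel)"
    using lborel_pair.Fubini_integral[OF P] by (simp add: e)
  have g: "f x * reg_lap s \<epsilon> V x = kernel_mass s \<epsilon> TYPE('a) * (f x * V x) - f x * (\<integral>y. reg_kernel s \<epsilon> (y - x) * V y \<partial>lborel)" for x
    by (simp add: reg_lap_def algebra_simps)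
  have h: "V x * reg_lap s \<epsilon> f x = kernel_mass s \<epsilon> TYPE('a) * (f x * V x) - V x * (\<integral>y. reg_kernel s \<epsilon> (y - x) * f y \<partial>lborel)" for x
    by (simp add: reg_lap_def algebra_simps)
  show "integrable lborel (\<lambda>x. f x * reg_lap s \<epsilon> V x)" unfolding g using fV 1 by (rule Bochner_Integration.integrable_diff)
  show "integrable lborel (\<lambda>x. V x * reg_lap s \<epsilon> f x)" unfolding h using fV 2 by (rule Bochner_Integration.integrable_diff)
  show "(\<integral>x. f x * reg_lap s \<epsilon> V x \<partial>lborel) = (\<integral>x. V x * reg_lap s \<epsilon> f x \<partial>lborel)"
    unfolding g h using Bochner_Integration.integral_diff[OF fV 1] Bochner_Integration.integral_diff[OF fV 2] 3 by simp
qed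

lemma reg_lap_shift: "reg_lap s \<epsilon> (\<lambda>x. u (c + x)) x = reg_lap s \<epsilon> u (c + x)"
  using lborel_integral_add[of "\<lambda>y. reg_kernel s \<epsilon> (y - (c + x)) * u y" c] by (simp add: reg_lap_def)

end

section \<open>Approximate principal eigenfunctions of bounded symmetric kernels\<close>

text \<open>Summing the contraction over m bounds a partial sum by its first N terms plus \<rho>
  times itself.\<close>

lemma summable_of_lagged_contraction:
  fixes c :: "nat \<Rightarrow> real"
  assumes nn: "\<And>m. 0 \<le> c m" and "0 \<le> \<rho>" "\<rho> < 1" and step: "\<And>m. c (m + N) \<le> \<rho> * c m"
  shows "summable c"
proof (rule bounded_imp_summable[where B = "sum c {..<N} / (1 - \<rho>)"])
  fix K
  have "sum c {..K} \<le> sum c {..<N} + \<rho> * sum c {..K}"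
  proof -
    have "sum c {..K} \<le> sum c {..<N + Suc K}" using nn by (intro sum_mono2) auto
    also have "\<dots> = sum c {..<N} + sum (\<lambda>m. c (m + N)) {..<Suc K}"
      by (induction K) (auto simp: add.commute)
    also have "sum (\<lambda>m. c (m + N)) {..<Suc K} \<le> \<rho> * sum c {..<Suc K}"
      unfolding sum_distrib_left by (intro sum_mono step)
    finally show ?thesis by (simp add: lessThan_Suc_atMost)
  qed
  then show "sum c {..K} \<le> sum c {..<N} / (1 - \<rho>)" using assms(3) by (simp add: field_simps)
qed (rule nn)

text \<open>By symmetry \<open>b\<close> also vanishes for y outside S. A bounded kernel sends
  integrable functions to bounded ones; this is the only smoothing that is used.\<close>

locale bounded_symmetric_kernel =
  fixes S :: "'a::euclidean_space set" and b :: "'a \<Rightarrow> 'a \<Rightarrow> real" and C :: real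
  assumes S [measurable]: "S \<in> sets borel" and S_fin: "emeasure lborel S < \<infinity>"
    and b_meas [measurable]: "(\<lambda>(x, y). b x y) \<in> borel_measurable (borel \<Otimes>\<^sub>M borel)"
    and b_nonneg: "0 \<le> b x y" and b_le: "b x y \<le> C"
    and b_sym: "b x y = b y x" and b_supp: "x \<notin> S \<Longrightarrow> b x y = 0"
begin

lemma C_nonneg: "0 \<le> C" using b_nonneg b_le order_trans by blast

definition bounded_supp :: "('a \<Rightarrow> real) \<Rightarrow> bool" where
  "bounded_supp f \<longleftrightarrow> f \<in> borel_measurable borel \<and> (\<exists>F. \<forall>x. \<bar>f x\<bar> \<le> F * indicator S x)"

definition kernel_op :: "('a \<Rightarrow> real) \<Rightarrow> 'a \<Rightarrow> real" where
  "kernel_op f x = (\<integral>y. b x y * f y \<partial>lborel)"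

lemma bounded_supp_I: "f \<in> borel_measurable borel \<Longrightarrow> (\<And>x. \<bar>f x\<bar> \<le> F * indicator S x) \<Longrightarrow> bounded_supp f"
  unfolding bounded_supp_def by blast

lemma bounded_supp_meas [measurable_dest]: "bounded_supp f \<Longrightarrow> f \<in> borel_measurable borel" by (simp add: bounded_supp_def)

lemma indicator_integrable: "integrable lborel (indicator S :: 'a \<Rightarrow> real)"
  using S_fin by (intro integrable_real_indicator) auto

lemma bounded_supp_integrable: assumes "bounded_supp f" shows "integrable lborel f"
proof -
  obtain F where F: "\<And>x. \<bar>f x\<bar> \<le> F * indicator S x" using assms unfolding bounded_supp_def by blast
  show ?thesis
    by (rule Bochner_Integration.integrable_bound[where f = "\<lambda>x. F * indicator S x"])
      (use F assms indicator_integrable in \<open>auto simp: bounded_supp_def intro: order_trans[OF F abs_ge_self]\<close>)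
qed

lemma bounded_supp_indicator: "bounded_supp (indicator S)" by (rule bounded_supp_I[where F = 1]) auto

lemma bounded_supp_mult: assumes "bounded_supp f" "bounded_supp g" shows "bounded_supp (\<lambda>x. f x * g x)"
proof -
  obtain F where F: "\<And>x. \<bar>f x\<bar> \<le> F * indicator S x" using assms unfolding bounded_supp_def by blast
  obtain G where G: "\<And>x. \<bar>g x\<bar> \<le> G * indicator S x" using assms unfolding bounded_supp_def by blast
  show ?thesis
  proof (rule bounded_supp_I[where F = "F * G"])
    show "(\<lambda>x. f x * g x) \<in> borel_measurable borel" using assms by (auto simp: bounded_supp_def)
    show "\<bar>f x * g x\<bar> \<le> F * G * indicator S x" for x
    proof (cases "x \<in> S")
      case True
      then have "\<bar>f x\<bar> \<le> F" "\<bar>g x\<bar> \<le> G" using F[of x] G[of x] by auto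
      then have "\<bar>f x\<bar> * \<bar>g x\<bar> \<le> F * G" by (intro mult_mono) auto
      then show ?thesis using True by (simp add: abs_mult)
    next
      case False then show ?thesis using F[of x] by simp
    qed
  qed
qed

lemma b_integrable: assumes "bounded_supp f" shows "integrable lborel (\<lambda>y. b x y * f y)"
  by (rule integrable_mult_bounded(1)[OF bounded_supp_integrable[OF assms], where C = C])
    (use b_nonneg b_le in auto)

lemma kernel_op_bound: assumes "bounded_supp f" shows "\<bar>kernel_op f x\<bar> \<le> C * (\<integral>y. \<bar>f y\<bar> \<partial>lborel) * indicator S x"
proof (cases "x \<in> S")
  case True
  have "\<bar>kernel_op f x\<bar> \<le> (\<integral>y. \<bar>b x y * f y\<bar> \<partial>lborel)" unfolding kernel_op_def by (rule integral_abs_bound)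
  also have "\<dots> \<le> (\<integral>y. C * \<bar>f y\<bar> \<partial>lborel)"
    using integrable_abs[OF b_integrable[OF assms, of x]] bounded_supp_integrable[OF assms] b_nonneg b_le
    by (intro integral_mono) (auto simp: abs_mult intro!: mult_right_mono)
  finally show ?thesis using True by simp
next
  case False then show ?thesis by (simp add: kernel_op_def b_supp)
qed

lemma bounded_supp_B: assumes "bounded_supp f" shows "bounded_supp (kernel_op f)"
proof (rule bounded_supp_I)
  have [measurable]: "f \<in> borel_measurable borel" using assms by (simp add: bounded_supp_def)
  have "(\<lambda>x. \<integral>y. b x y * f y \<partial>lborel) \<in> borel_measurable borel" by measurable
  then show "kernel_op f \<in> borel_measurable borel" by (simp add: kernel_op_def[abs_def])
qed (rule kernel_op_bound[OF assms])

lemma kernel_op_mono: assumes "bounded_supp f" "bounded_supp g" "\<And>x. f x \<le> g x" shows "kernel_op f x \<le> kernel_op g x"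
  unfolding kernel_op_def using assms b_nonneg by (intro integral_mono b_integrable mult_left_mono) auto

lemma kernel_op_nonneg: assumes "\<And>x. 0 \<le> f x" shows "0 \<le> kernel_op f x"
  unfolding kernel_op_def using assms b_nonneg by (intro integral_nonneg_AE AE_I2) auto

lemma product_integrable:
  assumes "bounded_supp f" "bounded_supp g"
  shows "integrable (lborel \<Otimes>\<^sub>M lborel) (\<lambda>(x, y). f x * (b x y * g y))"
proof (rule Bochner_Integration.integrable_bound)
  have [measurable]: "f \<in> borel_measurable borel" "g \<in> borel_measurable borel" using assms by (auto simp: bounded_supp_def)
  have "integrable (lborel \<Otimes>\<^sub>M lborel) (\<lambda>(x, y). f x * g y)"
    using assms by (intro integrable_tensor_product bounded_supp_integrable)
  then show "integrable (lborel \<Otimes>\<^sub>M lborel) (\<lambda>p. C * (case p of (x, y) \<Rightarrow> f x * g y))" by simp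
  show "(\<lambda>(x, y). f x * (b x y * g y)) \<in> borel_measurable (lborel \<Otimes>\<^sub>M lborel)" by measurable
  have "\<bar>f x\<bar> * (b x y * \<bar>g y\<bar>) \<le> C * (\<bar>f x\<bar> * \<bar>g y\<bar>)" for x y
    using mult_right_mono[OF b_le[of x y], of "\<bar>f x\<bar> * \<bar>g y\<bar>"] by (simp add: mult_ac)
  then show "AE p in lborel \<Otimes>\<^sub>M lborel. norm (case p of (x, y) \<Rightarrow> f x * (b x y * g y)) \<le> norm (C * (case p of (x, y) \<Rightarrow> f x * g y))"
    using C_nonneg b_nonneg by (auto simp: abs_mult)
qed

lemma kernel_op_selfadjoint:
  assumes "bounded_supp f" "bounded_supp g"
  shows "(\<integral>x. f x * kernel_op g x \<partial>lborel) = (\<integral>x. kernel_op f x * g x \<partial>lborel)"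
proof -
  have "(\<integral>x. f x * kernel_op g x \<partial>lborel) = (\<integral>x. \<integral>y. f x * (b x y * g y) \<partial>lborel \<partial>lborel)"
    by (simp add: kernel_op_def)
  also have "\<dots> = (\<integral>y. \<integral>x. f x * (b x y * g y) \<partial>lborel \<partial>lborel)"
    using lborel_pair.Fubini_integral[OF product_integrable[OF assms]] by simp
  also have "\<dots> = (\<integral>y. \<integral>x. (b y x * f x) * g y \<partial>lborel \<partial>lborel)"
    by (subst b_sym) (simp add: mult_ac)
  finally show ?thesis by (simp add: kernel_op_def)
qed

section \<open>Iterates of the operator and the Neumann series\<close>

definition iter :: "nat \<Rightarrow> 'a \<Rightarrow> real" where "iter n = (kernel_op ^^ n) (indicator S)"
definition iter_mass :: "nat \<Rightarrow> real" where "iter_mass n = (\<integral>x. iter n x \<partial>lborel)"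

lemma iter_Suc: "iter (Suc n) = kernel_op (iter n)" by (simp add: iter_def)
lemma bounded_supp_iter: "bounded_supp (iter n)" by (induction n) (auto simp: iter_def bounded_supp_indicator bounded_supp_B)
lemma iter_nonneg: "0 \<le> iter n x"
  by (induction n arbitrary: x) (auto simp: iter_Suc kernel_op_nonneg, simp add: iter_def)
lemma iter_mass_nonneg: "0 \<le> iter_mass n" unfolding iter_mass_def using iter_nonneg by (intro integral_nonneg_AE AE_I2)

lemma iter_Suc_le: "iter (Suc n) x \<le> C * iter_mass n"
proof -
  have "iter (Suc n) x \<le> C * iter_mass n * indicator S x"
    using kernel_op_bound[OF bounded_supp_iter[of n], of x] iter_nonneg by (simp add: iter_Suc iter_mass_def)
  also have "\<dots> \<le> C * iter_mass n" using C_nonneg iter_mass_nonneg by (intro mult_left_le) (auto simp: indicator_def)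
  finally show ?thesis .
qed

text \<open>Self-adjointness moves the operator from one factor to the other until
  \<open>iter 0\<close> is left, the indicator of S, which acts as a unit on functions supported in
  S.\<close>

lemma integral_iter_iter: "(\<integral>x. iter m x * iter n x \<partial>lborel) = iter_mass (m + n)"
proof (induction m arbitrary: n)
  case 0
  have "iter 0 x * iter n x = iter n x" for x
    using bounded_supp_iter[of n] unfolding bounded_supp_def by (cases "x \<in> S") (auto simp: iter_def, metis abs_le_zero_iff mult_zero_right indicator_simps(2) )
  then have "(\<lambda>x. iter 0 x * iter n x) = iter n" by auto
  then show ?case by (simp add: iter_mass_def)
next
  case (Suc m)
  show ?case using kernel_op_selfadjoint[OF bounded_supp_iter[of m] bounded_supp_iter[of n]] Suc[of "Suc n"] by (simp add: iter_Suc)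
qed

text \<open>One application of the operator is spent on passing from mass to supremum, by
  \<open>iter_Suc_le\<close>; hence the extra 1 in the index.\<close>

lemma iter_mass_submultiplicative: "iter_mass (m + n + 1) \<le> C * iter_mass m * iter_mass n"
proof -
  have "iter_mass (m + n + 1) = (\<integral>x. iter m x * iter (Suc n) x \<partial>lborel)" by (simp add: integral_iter_iter)
  also have "\<dots> \<le> (\<integral>x. iter m x * (C * iter_mass n) \<partial>lborel)"
    using bounded_supp_integrable[OF bounded_supp_mult[OF bounded_supp_iter[of m] bounded_supp_iter[of "Suc n"]]] bounded_supp_integrable[OF bounded_supp_iter[of m]] iter_nonneg iter_Suc_le
    by (intro integral_mono) (auto intro: mult_left_mono)
  finally show ?thesis by (simp add: iter_mass_def mult_ac)
qed

text \<open>The series is the integral of the resolvent of \<open>kernel_op\<close> at \<theta>,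
  applied to the indicator of S. For positive \<theta> its terms are nonnegative, so divergence
  means unbounded partial sums.\<close>

definition neumann_converges :: "real \<Rightarrow> bool" where "neumann_converges \<theta> \<longleftrightarrow> summable (\<lambda>n. iter_mass n / \<theta> ^ Suc n)"

lemma neumann_converges_mono:
  assumes "neumann_converges \<theta>" "0 < \<theta>" "\<theta> \<le> \<theta>'" shows "neumann_converges \<theta>'"
  unfolding neumann_converges_def
proof (rule summable_comparison_test')
  show "summable (\<lambda>n. iter_mass n / \<theta> ^ Suc n)" using assms by (simp add: neumann_converges_def)
  show "norm (iter_mass n / \<theta>' ^ Suc n) \<le> iter_mass n / \<theta> ^ Suc n" for n
    using assms iter_mass_nonneg[of n] by (auto simp del: power_Suc intro!: divide_left_mono power_mono mult_pos_pos)
qed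

text \<open>The set of parameters for which the Neumann series converges is open, because the
  coefficients are submultiplicative; hence the series diverges at its infimum.\<close>

lemma neumann_converges_open:
  assumes "neumann_converges \<theta>" "0 < \<theta>"
  shows "\<exists>\<theta>'. 0 < \<theta>' \<and> \<theta>' < \<theta> \<and> neumann_converges \<theta>'"
proof -
  have "(\<lambda>n. C * (iter_mass n / \<theta> ^ Suc n)) \<longlonglongrightarrow> C * 0"
    using assms summable_LIMSEQ_zero unfolding neumann_converges_def by (intro tendsto_mult_left) blast
  then have "\<forall>\<^sub>F n in sequentially. C * (iter_mass n / \<theta> ^ Suc n) < 1" by (rule order_tendstoD) simp
  then obtain n where n: "C * (iter_mass n / \<theta> ^ Suc n) < 1" by (auto simp: eventually_sequentially)
  have "((\<lambda>t. C * (iter_mass n / t ^ Suc n)) \<longlongrightarrow> C * (iter_mass n / \<theta> ^ Suc n)) (at_left \<theta>)"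
    using assms by (intro tendsto_intros) auto
  then have "\<forall>\<^sub>F t in at_left \<theta>. C * (iter_mass n / t ^ Suc n) < 1" using n by (rule order_tendstoD)
  moreover have "\<forall>\<^sub>F t in at_left \<theta>. t \<in> {0<..<\<theta>}" using assms(2) by (intro eventually_at_leftI[of 0]) auto
  ultimately have "\<forall>\<^sub>F t in at_left \<theta>. C * (iter_mass n / t ^ Suc n) < 1 \<and> t \<in> {0<..<\<theta>}" by (rule eventually_conj)
  then obtain t where t: "C * (iter_mass n / t ^ Suc n) < 1" "0 < t" "t < \<theta>"
    using eventually_happens'[OF trivial_limit_at_left_real] by force
  \<comment> \<open>The index n was chosen so that C times the n-th term is below 1 at \<theta>,
    hence also at t slightly to the left; the terms then contract with lag
    \<open>Suc n\<close>.\<close>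
  have "summable (\<lambda>m. iter_mass m / t ^ Suc m)"
  proof (rule summable_of_lagged_contraction[where \<rho> = "C * (iter_mass n / t ^ Suc n)" and N = "Suc n"])
    show "iter_mass (m + Suc n) / t ^ Suc (m + Suc n) \<le> C * (iter_mass n / t ^ Suc n) * (iter_mass m / t ^ Suc m)" for m
    proof -
      have "iter_mass (m + Suc n) \<le> C * iter_mass m * iter_mass n" using iter_mass_submultiplicative[of m n] by simp
      then have "iter_mass (m + Suc n) / t ^ Suc (m + Suc n) \<le> C * iter_mass m * iter_mass n / t ^ Suc (m + Suc n)"
        using t by (intro divide_right_mono) auto
      also have "\<dots> = C * (iter_mass n / t ^ Suc n) * (iter_mass m / t ^ Suc m)"
        by (simp add: power_add mult_ac)
      finally show ?thesis .
    qed
  qed (use t iter_mass_nonneg C_nonneg in auto)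
  then show ?thesis using t unfolding neumann_converges_def by blast
qed

lemma neumann_converges_ex: "\<exists>\<theta>>0. neumann_converges \<theta>"
proof -
  \<comment> \<open>The factor 2 makes the contraction ratio at most 1/2; the summand 1 keeps
    \<theta> positive when \<open>C * iter_mass 0\<close> is 0.\<close>
  define \<theta> where "\<theta> = 2 * C * iter_mass 0 + 1"
  have pos: "0 < \<theta>" using C_nonneg iter_mass_nonneg[of 0] by (auto simp: \<theta>_def intro: add_nonneg_pos)
  have "C * iter_mass 0 / \<theta> \<le> 1/2" using pos C_nonneg iter_mass_nonneg[of 0] by (simp add: \<theta>_def field_simps)
  have "summable (\<lambda>m. iter_mass m / \<theta> ^ Suc m)"
  proof (rule summable_of_lagged_contraction[where \<rho> = "C * iter_mass 0 / \<theta>" and N = 1])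
    show "iter_mass (m + 1) / \<theta> ^ Suc (m + 1) \<le> C * iter_mass 0 / \<theta> * (iter_mass m / \<theta> ^ Suc m)" for m
    proof -
      have "iter_mass (m + 1) \<le> C * iter_mass m * iter_mass 0" using iter_mass_submultiplicative[of m 0] by simp
      then have "iter_mass (m + 1) / \<theta> ^ Suc (m + 1) \<le> C * iter_mass m * iter_mass 0 / \<theta> ^ Suc (m + 1)"
        using pos by (intro divide_right_mono) auto
      also have "\<dots> = C * iter_mass 0 / \<theta> * (iter_mass m / \<theta> ^ Suc m)" by (simp add: power_add mult_ac)
      finally show ?thesis .
    qed
  qed (use pos iter_mass_nonneg C_nonneg \<open>C * iter_mass 0 / \<theta> \<le> 1/2\<close> in auto)
  then show ?thesis using pos unfolding neumann_converges_def by blast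
qed

definition neumann_sum :: "real \<Rightarrow> 'a \<Rightarrow> real" where "neumann_sum \<theta> x = (\<Sum>n. iter n x / \<theta> ^ Suc n)"

context
  fixes \<theta> assumes th: "neumann_converges \<theta>" "0 < \<theta>"
begin

lemma neumann_sum_summable: "summable (\<lambda>n. iter n x / \<theta> ^ Suc n)"
proof -
  have "summable (\<lambda>n. iter (Suc n) x / \<theta> ^ Suc (Suc n))"
  proof (rule summable_comparison_test')
    show "summable (\<lambda>n. C / \<theta> * (iter_mass n / \<theta> ^ Suc n))" using th unfolding neumann_converges_def by (intro summable_mult)
    show "norm (iter (Suc n) x / \<theta> ^ Suc (Suc n)) \<le> C / \<theta> * (iter_mass n / \<theta> ^ Suc n)" for n
      using th iter_nonneg[of "Suc n" x] divide_right_mono[OF iter_Suc_le[of n x], of "\<theta> ^ Suc (Suc n)"] by (simp add: mult_ac)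
  qed
  then show ?thesis by (subst (asm) summable_Suc_iff)
qed

lemma neumann_sum_nonneg: "0 \<le> neumann_sum \<theta> x"
  unfolding neumann_sum_def using th iter_nonneg by (intro suminf_nonneg neumann_sum_summable) auto

lemma neumann_sum_split: "neumann_sum \<theta> x = indicator S x / \<theta> + (\<Sum>n. iter (Suc n) x / \<theta> ^ Suc (Suc n))"
  unfolding neumann_sum_def using suminf_split_head[OF neumann_sum_summable[of x]] by (simp add: iter_def)

lemma neumann_sum_le: "neumann_sum \<theta> x \<le> (1 / \<theta> + C / \<theta> * (\<Sum>n. iter_mass n / \<theta> ^ Suc n)) * indicator S x"
proof (cases "x \<in> S")
  case True
  have s: "summable (\<lambda>n. C / \<theta> * (iter_mass n / \<theta> ^ Suc n))" using th unfolding neumann_converges_def by (intro summable_mult)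
  have "(\<Sum>n. iter (Suc n) x / \<theta> ^ Suc (Suc n)) \<le> (\<Sum>n. C / \<theta> * (iter_mass n / \<theta> ^ Suc n))"
  proof (rule suminf_le)
    show "iter (Suc n) x / \<theta> ^ Suc (Suc n) \<le> C / \<theta> * (iter_mass n / \<theta> ^ Suc n)" for n
      using th divide_right_mono[OF iter_Suc_le[of n x], of "\<theta> ^ Suc (Suc n)"] by (simp add: mult_ac)
    show "summable (\<lambda>n. iter (Suc n) x / \<theta> ^ Suc (Suc n))" using neumann_sum_summable[of x] by (subst summable_Suc_iff)
  qed (rule s)
  also have "\<dots> = C / \<theta> * (\<Sum>n. iter_mass n / \<theta> ^ Suc n)" using th unfolding neumann_converges_def by (intro suminf_mult)
  finally show ?thesis using True by (simp add: neumann_sum_split)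
next
  case False
  have "iter n x = 0" for n using bounded_supp_iter[of n] False unfolding bounded_supp_def by (metis abs_le_zero_iff indicator_simps(2) mult_zero_right)
  then show ?thesis using False by (simp add: neumann_sum_def)
qed

lemma bounded_supp_neumann_sum: "bounded_supp (neumann_sum \<theta>)"
proof (rule bounded_supp_I)
  have [measurable]: "iter n \<in> borel_measurable borel" for n using bounded_supp_iter by (simp add: bounded_supp_def)
  show "neumann_sum \<theta> \<in> borel_measurable borel" unfolding neumann_sum_def[abs_def] by measurable
  show "\<bar>neumann_sum \<theta> x\<bar> \<le> (1 / \<theta> + C / \<theta> * (\<Sum>n. iter_mass n / \<theta> ^ Suc n)) * indicator S x" for x
    using neumann_sum_le[of x] neumann_sum_nonneg[of x] by simp
qed

lemma integral_neumann_sum: "(\<integral>x. neumann_sum \<theta> x \<partial>lborel) = (\<Sum>n. iter_mass n / \<theta> ^ Suc n)"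
proof -
  have "(\<integral>x. neumann_sum \<theta> x \<partial>lborel) = (\<Sum>n. \<integral>x. iter n x / \<theta> ^ Suc n \<partial>lborel)"
    unfolding neumann_sum_def
  proof (rule integral_suminf)
    show "integrable lborel (\<lambda>x. iter n x / \<theta> ^ Suc n)" for n using bounded_supp_integrable[OF bounded_supp_iter[of n]] by simp
    show "AE x in lborel. summable (\<lambda>n. norm (iter n x / \<theta> ^ Suc n))"
      using neumann_sum_summable iter_nonneg th by auto
    show "summable (\<lambda>n. \<integral>x. norm (iter n x / \<theta> ^ Suc n) \<partial>lborel)"
      using th iter_nonneg by (simp add: iter_mass_def[symmetric] neumann_converges_def)
  qed
  then show ?thesis by (simp add: iter_mass_def)
qed

text \<open>The resolvent equation: applying the operator shifts the index of the series by one, and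
  the term that gets lost is \<open>indicator S x / \<theta>\<close>.\<close>

lemma kernel_op_neumann_sum: "kernel_op (neumann_sum \<theta>) x = \<theta> * neumann_sum \<theta> x - indicator S x"
proof -
  have "kernel_op (neumann_sum \<theta>) x = (\<integral>y. (\<Sum>n. b x y * iter n y / \<theta> ^ Suc n) \<partial>lborel)"
    unfolding kernel_op_def neumann_sum_def using suminf_mult[OF neumann_sum_summable] by (simp del: power_Suc)
  also have "\<dots> = (\<Sum>n. \<integral>y. b x y * iter n y / \<theta> ^ Suc n \<partial>lborel)"
  proof (rule integral_suminf)
    show "integrable lborel (\<lambda>y. b x y * iter n y / \<theta> ^ Suc n)" for n using b_integrable[OF bounded_supp_iter[of n]] by simp
    have "summable (\<lambda>n. b x y * (iter n y / \<theta> ^ Suc n))" for y using neumann_sum_summable by (intro summable_mult)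
    then show "AE y in lborel. summable (\<lambda>n. norm (b x y * iter n y / \<theta> ^ Suc n))"
      using iter_nonneg b_nonneg th by simp
    have "summable (\<lambda>n. \<theta> * (iter (Suc n) x / \<theta> ^ Suc (Suc n)))"
      using neumann_sum_summable[of x] by (intro summable_mult) (subst summable_Suc_iff)
    then show "summable (\<lambda>n. \<integral>y. norm (b x y * iter n y / \<theta> ^ Suc n) \<partial>lborel)"
      using iter_nonneg b_nonneg th by (simp add: kernel_op_def iter_Suc)
  qed
  also have "\<dots> = (\<Sum>n. \<theta> * (iter (Suc n) x / \<theta> ^ Suc (Suc n)))" using th by (simp add: kernel_op_def iter_Suc)
  also have "\<dots> = \<theta> * (\<Sum>n. iter (Suc n) x / \<theta> ^ Suc (Suc n))"
    by (rule suminf_mult) (use neumann_sum_summable[of x] in \<open>subst summable_Suc_iff\<close>)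
  also have "\<dots> = \<theta> * neumann_sum \<theta> x - indicator S x" using th by (simp add: neumann_sum_split field_simps)
  finally show ?thesis .
qed

end

section \<open>The edge of convergence\<close>

text \<open>Let \<open>r n\<close> be the integral of \<phi> against its n-th iterate and J that of
  its square. Cauchy-Schwarz gives \<open>(r n)\<^sup>2 \<le> J * r (n + n)\<close>, so the bound by
  the Rayleigh quotient doubles its exponent at each step. As \<phi> lies below the indicator of S,
  the masses \<open>iter_mass\<close> grow at least as fast; in this way a trial function bounds the
  edge of convergence from below.\<close>

lemma Rayleigh_powers:
  assumes "bounded_supp \<phi>" "\<And>x. 0 \<le> \<phi> x" "\<And>x. \<phi> x \<le> 1" and J: "0 < (\<integral>x. \<phi> x * \<phi> x \<partial>lborel)"
    and R: "\<xi> * (\<integral>x. \<phi> x * \<phi> x \<partial>lborel) \<le> (\<integral>x. \<phi> x * kernel_op \<phi> x \<partial>lborel)" and "0 < \<xi>"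
  shows "\<xi> ^ (2 ^ j) * (\<integral>x. \<phi> x * \<phi> x \<partial>lborel) \<le> iter_mass (2 ^ j)"
proof -
  let ?J = "\<integral>x. \<phi> x * \<phi> x \<partial>lborel"
  define g where "g n = (kernel_op ^^ n) \<phi>" for n
  have Xg: "bounded_supp (g n)" for n by (induction n) (auto simp: g_def assms bounded_supp_B)
  have g0: "0 \<le> g n x" for n x by (induction n arbitrary: x) (auto simp: g_def assms kernel_op_nonneg)
  have g_le: "g n x \<le> iter n x" for n x
  proof (induction n arbitrary: x)
    case 0
    show ?case using assms(1-3) unfolding bounded_supp_def
      by (cases "x \<in> S") (auto simp: g_def iter_def, metis abs_le_zero_iff mult_zero_right indicator_simps(2) order_refl)
  next
    case (Suc n)
    show ?case using kernel_op_mono[OF Xg bounded_supp_iter Suc] by (simp add: g_def iter_Suc)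
  qed
  define r where "r n = (\<integral>x. \<phi> x * g n x \<partial>lborel)" for n
  have gg: "(\<integral>x. g m x * g n x \<partial>lborel) = r (m + n)" for m n
  proof (induction m arbitrary: n)
    case (Suc m)
    show ?case using kernel_op_selfadjoint[OF Xg[of m] Xg[of n]] Suc[of "Suc n"] by (simp add: g_def)
  qed (simp add: g_def r_def)
  have CS: "(r n)\<^sup>2 \<le> ?J * r (n + n)" for n
  proof -
    have I: "integrable lborel (\<lambda>x. \<phi> x * \<phi> x)" "integrable lborel (\<lambda>x. \<phi> x * g n x)" "integrable lborel (\<lambda>x. g n x * g n x)"
      using assms Xg by (auto intro!: bounded_supp_integrable bounded_supp_mult)
    \<comment> \<open>This t minimises the integral of the square below, which turns its
      nonnegativity into Cauchy-Schwarz.\<close>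
    define t where "t = r n / ?J"
    have "0 \<le> (\<integral>x. (g n x - t * \<phi> x)\<^sup>2 \<partial>lborel)" by (intro integral_nonneg_AE AE_I2) auto
    also have "\<dots> = (\<integral>x. g n x * g n x - 2 * t * (\<phi> x * g n x) + t\<^sup>2 * (\<phi> x * \<phi> x) \<partial>lborel)"
      by (intro Bochner_Integration.integral_cong) (auto simp: power2_eq_square algebra_simps)
    also have "\<dots> = r (n + n) - 2 * t * r n + t\<^sup>2 * ?J"
      using I by (simp add: gg r_def)
    also have "\<dots> = r (n + n) - (r n)\<^sup>2 / ?J" using J by (simp add: t_def field_simps power2_eq_square)
    finally show ?thesis using J by (simp add: field_simps)
  qed
  have "\<xi> ^ (2 ^ j) * ?J \<le> r (2 ^ j)"
  proof (induction j)
    case 0 show ?case using R by (simp add: r_def g_def)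
  next
    case (Suc j)
    have "(\<xi> ^ (2 ^ j) * ?J)\<^sup>2 \<le> (r (2 ^ j))\<^sup>2" using Suc J assms(6) by (intro power_mono) auto
    also have "\<dots> \<le> ?J * r (2 ^ Suc j)" using CS[of "2 ^ j"] by (simp add: mult_2)
    finally have "?J * (\<xi> ^ (2 ^ Suc j) * ?J) \<le> ?J * r (2 ^ Suc j)"
      by (simp add: power2_eq_square power_mult mult_ac power_add mult_2)
    then show ?case using J by simp
  qed
  also have "r (2 ^ j) \<le> iter_mass (2 ^ j)"
    unfolding r_def iter_mass_def
  proof (rule integral_mono)
    show "\<phi> x * g (2 ^ j) x \<le> iter (2 ^ j) x" for x
      using mult_mono[OF assms(3)[of x] g_le[of "2 ^ j" x]] g0 by simp
  qed (auto intro!: bounded_supp_integrable bounded_supp_mult assms Xg bounded_supp_iter)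
  finally show ?thesis .
qed

text \<open>Take for \<theta> the infimum of the parameters at which the Neumann series converges.
  It diverges there, so for t slightly above \<theta> the resolvent applied to the indicator has
  arbitrarily large mass F. Divided by F, it solves the eigenvalue equation up to
  \<open>(t - \<theta>) + m / F\<close> in L1, where m is the measure of S. Only t, and not
  \<theta>, depends on \<tau>.\<close>

lemma approximate_eigenfunction:
  assumes \<phi>: "bounded_supp \<phi>" "\<And>x. 0 \<le> \<phi> x" "\<And>x. \<phi> x \<le> 1" and J: "0 < (\<integral>x. \<phi> x * \<phi> x \<partial>lborel)"
    and R: "\<xi> * (\<integral>x. \<phi> x * \<phi> x \<partial>lborel) \<le> (\<integral>x. \<phi> x * kernel_op \<phi> x \<partial>lborel)" and \<xi>: "0 < \<xi>"
  shows "\<exists>\<theta>\<ge>\<xi>. \<forall>\<tau>>0. \<exists>f. bounded_supp f \<and> (\<forall>x. 0 \<le> f x) \<and> (\<integral>x. f x \<partial>lborel) = 1 \<and> (\<integral>x. \<bar>\<theta> * f x - kernel_op f x\<bar> \<partial>lborel) \<le> \<tau>"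
proof -
  let ?J = "\<integral>x. \<phi> x * \<phi> x \<partial>lborel"
  have low: "\<xi> \<le> \<theta>" if c: "neumann_converges \<theta>" and "0 < \<theta>" for \<theta>
  proof (rule ccontr)
    assume "\<not> \<xi> \<le> \<theta>"
    have "(\<lambda>n. iter_mass n / \<theta> ^ Suc n) \<longlonglongrightarrow> 0" using c summable_LIMSEQ_zero unfolding neumann_converges_def by blast
    then have "\<forall>\<^sub>F n in sequentially. iter_mass n / \<theta> ^ Suc n < ?J / \<theta>" using J that by (intro order_tendstoD) auto
    then obtain N where N: "\<And>n. N \<le> n \<Longrightarrow> iter_mass n / \<theta> ^ Suc n < ?J / \<theta>" by (auto simp: eventually_sequentially)
    \<comment> \<open>The lower bound of \<open>Rayleigh_powers\<close> is available at powers of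
      two only, so a power of two beyond N is taken.\<close>
    have "N \<le> 2 ^ N" by (rule less_imp_le[OF less_exp])
    then have "iter_mass (2 ^ N) / \<theta> ^ Suc (2 ^ N) < ?J / \<theta>" by (rule N)
    then have "iter_mass (2 ^ N) < \<theta> ^ (2 ^ N) * ?J" using that by (simp add: field_simps)
    also have "\<dots> \<le> \<xi> ^ (2 ^ N) * ?J" using that J \<open>\<not> \<xi> \<le> \<theta>\<close> by (intro mult_right_mono power_mono) auto
    also have "\<dots> \<le> iter_mass (2 ^ N)" by (rule Rayleigh_powers[OF assms])
    finally show False by simp
  qed
  define T where "T = {\<theta>. 0 < \<theta> \<and> neumann_converges \<theta>}"
  have T: "T \<noteq> {}" "bdd_below T" using neumann_converges_ex low by (auto simp: T_def intro!: bdd_belowI[where m = 0])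
  define \<theta> where "\<theta> = Inf T"
  have th: "\<xi> \<le> \<theta>" unfolding \<theta>_def using T low by (intro cInf_greatest) (auto simp: T_def)
  then have th0: "0 < \<theta>" using \<xi> by simp
  have "\<not> neumann_converges \<theta>"
  proof
    assume "neumann_converges \<theta>"
    then obtain t where "0 < t" "t < \<theta>" "neumann_converges t" using neumann_converges_open th0 by blast
    then have "\<theta> \<le> t" unfolding \<theta>_def using T by (intro cInf_lower) (auto simp: T_def)
    then show False using \<open>t < \<theta>\<close> by simp
  qed
  have above: "neumann_converges t" if lt: "\<theta> < t" for t
  proof -
    obtain t' where "t' \<in> T" "t' < t" using cInf_lessD[OF T(1), of t] lt unfolding \<theta>_def by blast
    then show ?thesis using neumann_converges_mono[of t' t] by (auto simp: T_def)
  qed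
  define m where "m = measure lborel S"
  have m0: "0 \<le> m" by (simp add: m_def)
  have ind: "(\<integral>x. indicator S x \<partial>lborel) = m" by (simp add: m_def)
  show ?thesis
  proof (intro exI[of _ \<theta>] conjI allI impI th)
    fix \<tau> :: real assume \<tau>: "0 < \<tau>"
    \<comment> \<open>A mass F above Q gives \<open>m / F \<le> \<tau> / 2\<close>; the summand 1
      keeps Q positive even if S is a null set.\<close>
    define Q where "Q = 2 * m / \<tau> + 1"
    have Q: "0 < Q" using m0 \<tau> by (simp add: Q_def add_nonneg_pos)
    have "\<exists>K. Q < (\<Sum>n\<le>K. iter_mass n / \<theta> ^ Suc n)"
    proof (rule ccontr)
      assume "\<not> ?thesis"
      then have "summable (\<lambda>n. iter_mass n / \<theta> ^ Suc n)"
        using iter_mass_nonneg th0 by (intro bounded_imp_summable[where B = Q]) (auto simp: not_less)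
      then show False using \<open>\<not> neumann_converges \<theta>\<close> by (simp add: neumann_converges_def)
    qed
    then obtain K where K: "Q < (\<Sum>n\<le>K. iter_mass n / \<theta> ^ Suc n)" by blast
    \<comment> \<open>A finite partial sum is continuous in t; this carries the divergence at
      \<theta> over to parameters at which the series converges.\<close>
    have "((\<lambda>t. \<Sum>n\<le>K. iter_mass n / t ^ Suc n) \<longlongrightarrow> (\<Sum>n\<le>K. iter_mass n / \<theta> ^ Suc n)) (at_right \<theta>)"
      using th0 by (intro tendsto_intros) auto
    then have "\<forall>\<^sub>F t in at_right \<theta>. Q < (\<Sum>n\<le>K. iter_mass n / t ^ Suc n)" using K by (rule order_tendstoD)
    moreover have "\<forall>\<^sub>F t in at_right \<theta>. t \<in> {\<theta><..<\<theta> + \<tau> / 2}" using \<tau> by (intro eventually_at_rightI) auto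
    ultimately have "\<forall>\<^sub>F t in at_right \<theta>. Q < (\<Sum>n\<le>K. iter_mass n / t ^ Suc n) \<and> t \<in> {\<theta><..<\<theta> + \<tau> / 2}" by (rule eventually_conj)
    then obtain t where t: "Q < (\<Sum>n\<le>K. iter_mass n / t ^ Suc n)" "\<theta> < t" "t < \<theta> + \<tau> / 2"
      using eventually_happens'[OF trivial_limit_at_right_real] by force
    have c: "neumann_converges t" "0 < t" using above t th0 by auto
    define F where "F = (\<Sum>n. iter_mass n / t ^ Suc n)"
    have "(\<Sum>n\<le>K. iter_mass n / t ^ Suc n) \<le> F"
      unfolding F_def using c iter_mass_nonneg by (intro sum_le_suminf) (auto simp: neumann_converges_def)
    then have F: "Q < F" "0 < F" using t Q by auto
    have IF: "(\<integral>x. neumann_sum t x \<partial>lborel) = F" using integral_neumann_sum[OF c] by (simp add: F_def)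
    define f where "f x = neumann_sum t x / F" for x
    obtain G where G: "\<And>x. \<bar>neumann_sum t x\<bar> \<le> G * indicator S x" using bounded_supp_neumann_sum[OF c] unfolding bounded_supp_def by blast
    have Xf: "bounded_supp f"
    proof (rule bounded_supp_I[where F = "G / F"])
      show "f \<in> borel_measurable borel" unfolding f_def[abs_def] using bounded_supp_neumann_sum[OF c] by (auto simp: bounded_supp_def)
      show "\<bar>f x\<bar> \<le> G / F * indicator S x" for x
        using divide_right_mono[OF G[of x], of F] F by (simp add: f_def)
    qed
    have Bf: "kernel_op f x = (t * neumann_sum t x - indicator S x) / F" for x
      using kernel_op_neumann_sum[OF c, of x] unfolding kernel_op_def f_def by simp
    have "(\<integral>x. \<bar>\<theta> * f x - kernel_op f x\<bar> \<partial>lborel) \<le> (\<integral>x. ((t - \<theta>) * neumann_sum t x + indicator S x) / F \<partial>lborel)"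
    proof (rule integral_mono)
      have "integrable lborel (\<lambda>x. \<theta> * f x - kernel_op f x)"
        using bounded_supp_integrable[OF Xf] bounded_supp_integrable[OF bounded_supp_B[OF Xf]] by simp
      then show "integrable lborel (\<lambda>x. \<bar>\<theta> * f x - kernel_op f x\<bar>)" by (rule integrable_abs)
      show "integrable lborel (\<lambda>x. ((t - \<theta>) * neumann_sum t x + indicator S x) / F)"
        using bounded_supp_integrable[OF bounded_supp_neumann_sum[OF c]] indicator_integrable by simp
      show "\<bar>\<theta> * f x - kernel_op f x\<bar> \<le> ((t - \<theta>) * neumann_sum t x + indicator S x) / F" for x
      proof -
        have "\<theta> * f x - kernel_op f x = (- ((t - \<theta>) * neumann_sum t x) + indicator S x) / F"
          unfolding Bf f_def by (simp add: algebra_simps diff_divide_distrib add_divide_distrib)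
        moreover have "\<bar>- ((t - \<theta>) * neumann_sum t x) + indicator S x\<bar> \<le> (t - \<theta>) * neumann_sum t x + indicator S x"
          using t neumann_sum_nonneg[OF c, of x] by (intro order_trans[OF abs_triangle_ineq]) (auto simp: abs_mult)
        ultimately show ?thesis using F by (simp add: divide_right_mono)
      qed
    qed
    also have "\<dots> = ((t - \<theta>) * F + m) / F"
      using bounded_supp_integrable[OF bounded_supp_neumann_sum[OF c]] indicator_integrable by (simp add: IF m_def)
    also have "\<dots> = (t - \<theta>) + m / F" using F by (simp add: field_simps)
    also have "\<dots> \<le> \<tau> / 2 + \<tau> / 2"
    proof (intro add_mono)
      have "2 * m / \<tau> \<le> F" using F by (simp add: Q_def)
      then show "m / F \<le> \<tau> / 2" using F \<tau> by (simp add: field_simps)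
    qed (use t in simp)
    finally have "(\<integral>x. \<bar>\<theta> * f x - kernel_op f x\<bar> \<partial>lborel) \<le> \<tau>" by simp
    moreover have "(\<integral>x. f x \<partial>lborel) = 1" unfolding f_def using IF F by simp
    moreover have "\<forall>x. 0 \<le> f x" using neumann_sum_nonneg[OF c] F by (simp add: f_def)
    ultimately show "\<exists>f. bounded_supp f \<and> (\<forall>x. 0 \<le> f x) \<and> (\<integral>x. f x \<partial>lborel) = 1 \<and> (\<integral>x. \<bar>\<theta> * f x - kernel_op f x\<bar> \<partial>lborel) \<le> \<tau>"
      using Xf by blast
  qed
qed

end

section \<open>Odd eigenfunctions on an interval\<close>

lemma integrable_indicator_Icc [simp]: "integrable lborel (indicator {a..b::real} :: real \<Rightarrow> real)"
  by (intro integrable_real_indicator) (auto simp: emeasure_lborel_Icc_eq)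

text \<open>The point \<open>2 - y\<close> is the mirror image of y in 1. Convolving the odd
  extension \<open>f x - f (2 - x)\<close> with \<open>reg_kernel\<close> amounts to integrating f
  alone against this difference.\<close>

definition odd_kernel :: "real \<Rightarrow> real \<Rightarrow> real \<Rightarrow> real \<Rightarrow> real" where
  "odd_kernel s \<epsilon> x y = reg_kernel s \<epsilon> (x - y) - reg_kernel s \<epsilon> (2 - x - y)"

definition odd_pot :: "real \<Rightarrow> real \<Rightarrow> (real \<Rightarrow> real) \<Rightarrow> real \<Rightarrow> real" where
  "odd_pot s \<epsilon> f x = (\<integral>y. odd_kernel s \<epsilon> x y * f y \<partial>lborel)"

text \<open>On \<open>{h..2 * h}\<close>, and for \<epsilon> between 0 and h, the base of
  \<open>reg_kernel\<close> is at most \<open>5 * h\<^sup>2\<close>; the factor h is the length of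
  the interval. The product is a constant times \<open>h powr - (2 * s)\<close>.\<close>

definition tail_low :: "real \<Rightarrow> real \<Rightarrow> real" where
  "tail_low s h = h * (5 * h\<^sup>2) powr (- ((1 + 2 * s) / 2))"

context
  fixes s :: real
  assumes s0: "0 < s" and s1: "s < 1"
begin

section \<open>One-dimensional kernel masses\<close>

lemma kernel_real_antimono:
  assumes "0 < \<epsilon>" "\<bar>x\<bar> \<le> \<bar>y\<bar>" shows "reg_kernel s \<epsilon> (y::real) \<le> reg_kernel s \<epsilon> x"
  using assms s0 by (intro reg_kernel_antimono) (auto simp: abs_le_square_iff)

lemma kernel_real_le: assumes "0 < a" "a \<le> \<bar>x\<bar>" shows "reg_kernel s \<epsilon> (x::real) \<le> a powr - (1 + 2 * s)"
proof -
  have "x \<noteq> 0" using assms by auto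
  then have "reg_kernel s \<epsilon> x \<le> \<bar>x\<bar> powr - (1 + 2 * s)" using reg_kernel_le[OF s0, of x \<epsilon>] by simp
  also have "\<dots> \<le> a powr - (1 + 2 * s)" using assms s0 by (intro powr_mono2') auto
  finally show ?thesis .
qed

lemma tail_low_pos: "0 < h \<Longrightarrow> 0 < tail_low s h" by (simp add: tail_low_def)

lemma tail_low_unbounded: "\<exists>h. 0 < h \<and> h < 1 / 2 \<and> Q \<le> tail_low s h"
proof -
  define p where "p = (1 + 2 * s) / 2"
  \<comment> \<open>With h chosen below, \<open>h powr - (2 * s)\<close> equals H. The summand 5
    puts H above 4, hence \<open>h < 1 / 2\<close> because \<open>2 powr (2 * s)\<close> is at most
    4; the other summand brings \<open>5 powr - p * H\<close> up to Q.\<close>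
  define H where "H = 5 + \<bar>Q\<bar> * 5 powr p"
  have H: "4 < H" "Q \<le> 5 powr - p * H"
  proof -
    have "0 \<le> \<bar>Q\<bar> * 5 powr p" by simp
    then show "4 < H" unfolding H_def by linarith
    have "\<bar>Q\<bar> = 5 powr - p * (\<bar>Q\<bar> * 5 powr p)" by (simp add: powr_minus field_simps)
    also have "\<dots> \<le> 5 powr - p * H" by (intro mult_left_mono) (auto simp: H_def)
    finally show "Q \<le> 5 powr - p * H" by simp
  qed
  define h where "h = H powr (- (1 / (2 * s)))"
  have h: "0 < h" using H by (simp add: h_def)
  have "tail_low s h = 5 powr - p * (h * (h powr 2) powr - p)"
    using h by (simp add: tail_low_def p_def powr_mult powr_numeral)
  also have "h * (h powr 2) powr - p = h powr (1 + 2 * (- p))"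
    using h by (simp only: powr_powr powr_add powr_one)
  also have "1 + 2 * (- p) = - (2 * s)" by (simp add: p_def field_simps)
  also have "h powr - (2 * s) = H" using s0 H by (simp add: h_def powr_powr)
  finally have "Q \<le> tail_low s h" using H by simp
  moreover have "h < 1 / 2"
  proof -
    have "(2::real) powr (2 * s) \<le> 2 powr 2" using s1 by (intro powr_mono) auto
    then have "2 powr (2 * s) < H" using H by (simp add: powr_numeral)
    then have "(2 powr (2 * s)) powr (1 / (2 * s)) < H powr (1 / (2 * s))" using s0 by (intro powr_less_mono2) auto
    then have "2 < H powr (1 / (2 * s))" using s0 by (simp add: powr_powr)
    then have "inverse (H powr (1 / (2 * s))) < inverse 2" by (intro less_imp_inverse_less) auto
    then show ?thesis by (simp add: h_def powr_minus)
  qed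
  ultimately show ?thesis using h by blast
qed

lemma tail_low_le:
  assumes "0 < \<epsilon>" "\<epsilon> \<le> h"
  shows "tail_low s h \<le> (\<integral>x. reg_kernel s \<epsilon> x * indicator {h..2 * h} x \<partial>lborel)"
proof -
  have h: "0 < h" using assms by simp
  have "tail_low s h = (\<integral>x. (5 * h\<^sup>2) powr (- ((1 + 2 * s) / 2)) * indicator {h..2 * h} x \<partial>lborel)"
    using h by (simp add: tail_low_def)
  also have "\<dots> \<le> (\<integral>x. reg_kernel s \<epsilon> x * indicator {h..2 * h} x \<partial>lborel)"
  proof (rule integral_mono)
    show "integrable lborel (\<lambda>x. (5 * h\<^sup>2) powr (- ((1 + 2 * s) / 2)) * indicator {h..2 * h} x)" by simp
    show "integrable lborel (\<lambda>x. reg_kernel s \<epsilon> x * indicator {h..2 * h} x)"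
      by (rule integrable_mult_bounded(2)[OF reg_kernel_integrable[OF s0 assms(1)], where C = 1]) (auto simp: indicator_def)
    fix x :: real
    show "(5 * h\<^sup>2) powr (- ((1 + 2 * s) / 2)) * indicator {h..2 * h} x \<le> reg_kernel s \<epsilon> x * indicator {h..2 * h} x"
    proof (cases "x \<in> {h..2 * h}")
      case True
      have "x\<^sup>2 \<le> (2 * h)\<^sup>2" "\<epsilon>\<^sup>2 \<le> h\<^sup>2" using True assms by (intro power_mono; simp)+
      then have "x\<^sup>2 + \<epsilon>\<^sup>2 \<le> 5 * h\<^sup>2" by (simp add: power_mult_distrib)
      moreover have "0 < x\<^sup>2 + \<epsilon>\<^sup>2" using assms by (intro add_nonneg_pos) auto
      ultimately have "(5 * h\<^sup>2) powr (- ((1 + 2 * s) / 2)) \<le> reg_kernel s \<epsilon> x"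
        unfolding reg_kernel_def using s0 by (simp only: DIM_real real_norm_def power2_abs of_nat_1) (intro powr_mono2', auto)
      then show ?thesis using True by simp
    qed simp
  qed
  finally show ?thesis .
qed

lemma kernel_mass_ge:
  assumes "0 < \<epsilon>" "\<epsilon> \<le> h" shows "tail_low s h \<le> kernel_mass s \<epsilon> TYPE(real)"
proof -
  note tail_low_le[OF assms]
  also have "(\<integral>x. reg_kernel s \<epsilon> x * indicator {h..2 * h} x \<partial>lborel) \<le> kernel_mass s \<epsilon> TYPE(real)"
    by (intro integral_mono reg_kernel_integrable[OF s0 assms(1)]
        integrable_mult_bounded(2)[OF reg_kernel_integrable[OF s0 assms(1)], where C = 1]) (auto simp: indicator_def)
  finally show ?thesis .
qed

section \<open>The odd kernel and a trial function for it\<close>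

lemma odd_kernel_measurable [measurable]: "(\<lambda>(x, y). odd_kernel s \<epsilon> x y) \<in> borel_measurable (borel \<Otimes>\<^sub>M borel)"
  unfolding odd_kernel_def by measurable

lemma odd_kernel_sym: "odd_kernel s \<epsilon> x y = odd_kernel s \<epsilon> y x"
  using reg_kernel_uminus[of s \<epsilon> "x - y"] by (simp add: odd_kernel_def algebra_simps)

lemma odd_kernel_reflect: "odd_kernel s \<epsilon> (2 - x) y = - odd_kernel s \<epsilon> x y"
  by (simp add: odd_kernel_def)

text \<open>Left of 1, a point is closer to y than to the mirror image of y. This positivity lets an
  eigenfunction that is odd on (0, 2) be treated as a principal one on (0, 1).\<close>

lemma odd_kernel_nonneg: assumes "0 < \<epsilon>" "x \<le> 1" "y \<le> 1" shows "0 \<le> odd_kernel s \<epsilon> x y"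
  unfolding odd_kernel_def using kernel_real_antimono[OF assms(1), of "x - y" "2 - x - y"] assms by auto

lemma odd_kernel_le: assumes "0 < \<epsilon>" shows "odd_kernel s \<epsilon> x y \<le> reg_kernel s \<epsilon> (0::real)"
  unfolding odd_kernel_def using reg_kernel_le_const[OF s0 assms, of "x - y"] reg_kernel_nonneg[of s \<epsilon> "2 - x - y"] by linarith

text \<open>A trial function for the Rayleigh quotient; its support in [1/4, 3/4] stays at distance
  1/2 from its mirror image in 1.\<close>

definition phi :: "real \<Rightarrow> real" where "phi x = bump (4 * (x - 1 / 2))"

lemma phi_meas [measurable]: "phi \<in> borel_measurable borel" unfolding phi_def by measurable
lemma phi_nonneg: "0 \<le> phi x" by (simp add: phi_def)
lemma phi_le_1: "phi x \<le> 1" by (simp add: phi_def bump_le_1)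
lemma phi_supp: "phi x \<noteq> 0 \<Longrightarrow> 1 / 4 < x \<and> x < 3 / 4"
  using bump_eq_0[of "4 * (x - 1 / 2)"] unfolding phi_def by (force simp: not_le abs_less_iff)

lemma phi_le_indicator: "phi x \<le> indicator {1/4..3/4} x"
  using phi_supp[of x] phi_le_1[of x] by (cases "phi x = 0") (auto simp: indicator_def)

lemma phi_integrable: "integrable lborel phi"
  by (rule Bochner_Integration.integrable_bound[OF integrable_indicator_Icc[of "1/4" "3/4"]])
    (auto simp: phi_nonneg phi_le_indicator)

lemma phi_integral_le: "(\<integral>x. phi x \<partial>lborel) \<le> 1"
proof -
  have "(\<integral>x. phi x \<partial>lborel) \<le> (\<integral>x. indicator {1/4..3/4::real} x \<partial>lborel)"
    by (intro integral_mono phi_integrable) (auto simp: phi_le_indicator)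
  then show ?thesis by simp
qed

lemma phi_second_difference: "\<bar>phi (x + z) + phi (x - z) - 2 * phi x\<bar> \<le> 576 * min 1 ((norm z)\<^sup>2)"
proof -
  have "\<bar>phi (x + z) + phi (x - z) - 2 * phi x\<bar> \<le> 36 * min 1 ((norm (4 * z))\<^sup>2)"
    using bump_second_difference[of "4 * (x - 1 / 2)" "4 * z"] by (simp add: phi_def algebra_simps)
  also have "\<dots> \<le> 576 * min 1 ((norm z)\<^sup>2)" by (simp add: power_mult_distrib min_def)
  finally show ?thesis .
qed

lemma phi_square_pos: "0 < (\<integral>x. phi x * phi x \<partial>lborel)"
proof -

  have "(0::real) < (\<integral>x. 1/16 * indicator {1/2..5/8::real} x \<partial>lborel)" by simp
  also have "\<dots> \<le> (\<integral>x. phi x * phi x \<partial>lborel)"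
  proof (rule integral_mono)
    show "integrable lborel (\<lambda>x. 1/16 * indicator {1/2..5/8::real} x :: real)" by simp
    show "integrable lborel (\<lambda>x. phi x * phi x)"
      by (rule integrable_mult_bounded(1)[OF phi_integrable, where C = 1]) (auto simp: phi_nonneg phi_le_1)
    fix x :: real
    show "1/16 * indicator {1/2..5/8::real} x \<le> phi x * phi x"
    proof (cases "x \<in> {1/2..5/8}")
      case True
      then have "(4 * (x - 1 / 2))\<^sup>2 \<le> (1/2)\<^sup>2" by (intro power_mono) auto
      then have "(1/2)\<^sup>2 \<le> (max 0 (1 - (4 * (x - 1 / 2))\<^sup>2))\<^sup>2" by (intro power_mono) (auto simp: power2_eq_square)
      then have "1/4 \<le> phi x" by (simp add: phi_def bump_def power2_eq_square)
      then have "1/4 * (1/4) \<le> phi x * phi x" by (intro mult_mono) auto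
      then show ?thesis using True by simp
    qed (simp add: phi_nonneg)
  qed
  finally show ?thesis .
qed

text \<open>An upper bound, uniform in \<epsilon>, for the Rayleigh quotient of
  \<open>reg_lap\<close> on the odd extension of \<open>phi\<close>: \<open>576 = 36 * 16\<close>
  comes from the second differences of \<open>bump\<close> at scale 1/4, and
  \<open>(1 / 2) powr - (1 + 2 * s)\<close> bounds the interaction with the mirror image.\<close>

definition C\<^sub>1 :: real where
  "C\<^sub>1 = (576 * integral\<^sup>L lborel (\<lambda>z::real. min 1 (norm z powr 2) * singular_kernel s z)
      + (1 / 2) powr - (1 + 2 * s)) / (\<integral>x. phi x * phi x \<partial>lborel)"

lemma C1_pos: "0 < C\<^sub>1"
  unfolding C\<^sub>1_def using phi_square_pos
  by (intro divide_pos_pos add_nonneg_pos mult_nonneg_nonneg integral_nonneg_AE AE_I2) auto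

text \<open>Here \<open>odd_pot\<close> of \<open>phi\<close> is \<open>\<kappa> * phi\<close> minus
  \<open>reg_lap\<close> minus the mirror term, and the last two are bounded on the support of
  \<open>phi\<close> uniformly in \<epsilon>. So the quotient falls short of the large mass \<kappa>
  by at most \<open>C\<^sub>1\<close>.\<close>

lemma phi_energy:
  assumes \<epsilon>: "0 < \<epsilon>"
  defines "\<kappa> \<equiv> kernel_mass s \<epsilon> TYPE(real)"
  shows "(\<kappa> - C\<^sub>1) * (\<integral>x. phi x * phi x \<partial>lborel) \<le> (\<integral>x. phi x * odd_pot s \<epsilon> phi x \<partial>lborel)"
proof -
  let ?J = "\<integral>x. phi x * phi x \<partial>lborel"
  define Q where "Q = 576 * integral\<^sup>L lborel (\<lambda>z::real. min 1 (norm z powr 2) * singular_kernel s z)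
      + (1 / 2) powr - (1 + 2 * s)"
  have QJ: "Q = C\<^sub>1 * ?J" using phi_square_pos by (simp add: Q_def C\<^sub>1_def)
  have Q0: "0 \<le> Q" using C1_pos phi_square_pos QJ by simp
  have pm: "\<And>x. \<bar>phi x\<bar> \<le> 1" using phi_nonneg phi_le_1 by simp
  have i1: "integrable lborel (\<lambda>y. reg_kernel s \<epsilon> (y - x) * phi y)" for x
    by (rule kernel_times_integrable_integrable[OF s0 \<epsilon> phi_integrable])
  have i2: "integrable lborel (\<lambda>y. reg_kernel s \<epsilon> (2 - x - y) * phi y)" for x
    using reg_kernel_le_const[OF s0 \<epsilon>]
    by (intro integrable_mult_bounded(1)[OF phi_integrable, where C = "reg_kernel s \<epsilon> (0::real)"]) auto
  have pot: "odd_pot s \<epsilon> phi x = \<kappa> * phi x - reg_lap s \<epsilon> phi x - (\<integral>y. reg_kernel s \<epsilon> (2 - x - y) * phi y \<partial>lborel)" for x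
  proof -
    have "reg_kernel s \<epsilon> (x - y) = reg_kernel s \<epsilon> (y - x)" for y using reg_kernel_uminus[of s \<epsilon> "x - y"] by simp
    then show ?thesis using i1[of x] i2[of x] by (simp add: odd_pot_def odd_kernel_def reg_lap_def \<kappa>_def left_diff_distrib)
  qed
  have pw: "\<kappa> * (phi x * phi x) - Q * phi x \<le> phi x * odd_pot s \<epsilon> phi x" for x
  proof (cases "phi x = 0")
    case False
    then have x: "1 / 4 < x" "x < 3 / 4" using phi_supp by auto
    have "(\<integral>y. reg_kernel s \<epsilon> (2 - x - y) * phi y \<partial>lborel) \<le> (\<integral>y. (1 / 2) powr - (1 + 2 * s) * phi y \<partial>lborel)"
    proof (rule integral_mono[OF i2])
      show "integrable lborel (\<lambda>y. (1 / 2) powr - (1 + 2 * s) * phi y)" using phi_integrable by simp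
      fix y
      show "reg_kernel s \<epsilon> (2 - x - y) * phi y \<le> (1 / 2) powr - (1 + 2 * s) * phi y"
      proof (cases "phi y = 0")
        case False
        then have "1 / 2 \<le> \<bar>2 - x - y\<bar>" using phi_supp[of y] x by linarith
        then show ?thesis using kernel_real_le[of "1/2" "2 - x - y" \<epsilon>] phi_nonneg by (intro mult_right_mono) auto
      qed simp
    qed
    also have "\<dots> \<le> (1 / 2) powr - (1 + 2 * s) * 1" using phi_integral_le
      by (simp add: mult_left_mono)
    finally have 1: "(\<integral>y. reg_kernel s \<epsilon> (2 - x - y) * phi y \<partial>lborel) \<le> (1 / 2) powr - (1 + 2 * s)" by simp
    have "\<bar>reg_lap s \<epsilon> phi x\<bar> \<le> Q - (1 / 2) powr - (1 + 2 * s)"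
      using reg_lap_bound[OF s0 \<epsilon> phi_meas pm s1 phi_second_difference] by (simp add: Q_def)
    then have "\<kappa> * phi x - Q \<le> odd_pot s \<epsilon> phi x" using 1 unfolding pot by linarith
    then have "phi x * (\<kappa> * phi x - Q) \<le> phi x * odd_pot s \<epsilon> phi x" using phi_nonneg by (intro mult_left_mono) auto
    then show ?thesis by (simp add: algebra_simps)
  qed simp
  have iJ: "integrable lborel (\<lambda>x. phi x * phi x)"
    by (rule integrable_mult_bounded(1)[OF phi_integrable _ pm]) auto
  have "(\<kappa> - C\<^sub>1) * ?J = \<kappa> * ?J - Q" by (simp add: QJ left_diff_distrib)
  also have "\<dots> \<le> \<kappa> * ?J - Q * (\<integral>x. phi x \<partial>lborel)" using phi_integral_le Q0 by (simp add: mult_left_le)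
  also have "\<dots> = (\<integral>x. \<kappa> * (phi x * phi x) - Q * phi x \<partial>lborel)" using iJ phi_integrable by simp
  also have "\<dots> \<le> (\<integral>x. phi x * odd_pot s \<epsilon> phi x \<partial>lborel)"
  proof (rule integral_mono[OF _ _ pw])
    show "integrable lborel (\<lambda>x. \<kappa> * (phi x * phi x) - Q * phi x)" using iJ phi_integrable by simp
    have [measurable]: "odd_pot s \<epsilon> phi \<in> borel_measurable borel"
      unfolding odd_pot_def[abs_def] by measurable
    have B: "\<bar>odd_pot s \<epsilon> phi x\<bar> \<le> 2 * reg_kernel s \<epsilon> (0::real)" for x
    proof -
      have "\<bar>odd_pot s \<epsilon> phi x\<bar> \<le> (\<integral>y. \<bar>odd_kernel s \<epsilon> x y * phi y\<bar> \<partial>lborel)"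
        unfolding odd_pot_def by (rule integral_abs_bound)
      also have "\<dots> \<le> (\<integral>y. 2 * reg_kernel s \<epsilon> (0::real) * phi y \<partial>lborel)"
      proof (rule integral_mono)
        have K: "\<bar>odd_kernel s \<epsilon> x y\<bar> \<le> 2 * reg_kernel s \<epsilon> (0::real)" for y
          using reg_kernel_le_const[OF s0 \<epsilon>, of "x - y"] reg_kernel_le_const[OF s0 \<epsilon>, of "2 - x - y"]
            reg_kernel_nonneg[of s \<epsilon> "x - y"] reg_kernel_nonneg[of s \<epsilon> "2 - x - y"]
          unfolding odd_kernel_def by linarith
        have "(\<lambda>y. odd_kernel s \<epsilon> x y) \<in> borel_measurable borel" by measurable
        then show "integrable lborel (\<lambda>y. \<bar>odd_kernel s \<epsilon> x y * phi y\<bar>)"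
          by (intro integrable_abs integrable_mult_bounded(1)[OF phi_integrable _ K]) simp
        show "\<bar>odd_kernel s \<epsilon> x y * phi y\<bar> \<le> 2 * reg_kernel s \<epsilon> (0::real) * phi y" for y
          using K[of y] phi_nonneg by (auto simp: abs_mult intro!: mult_right_mono)
      qed (use phi_integrable in simp)
      also have "\<dots> \<le> 2 * reg_kernel s \<epsilon> (0::real) * 1" using phi_integral_le
        by (simp add: mult_left_mono mult_left_le)
      finally show ?thesis by simp
    qed
    show "integrable lborel (\<lambda>x. phi x * odd_pot s \<epsilon> phi x)"
      by (rule integrable_mult_bounded(2)[OF phi_integrable _ B]) simp
  qed
  finally show ?thesis .
qed

text \<open>The abstract result for the odd kernel restricted to (0, 1) yields \<theta>. Subtracting
  it from the mass of the kernel gives the eigenvalue \<mu> of the regularised operator, and the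
  large mass cancels in \<open>\<mu> \<le> C\<^sub>1\<close>. The hypothesis \<open>big\<close>
  makes the lower bound for the Rayleigh quotient positive.\<close>

lemma odd_eigenfunction:
  assumes \<epsilon>: "0 < \<epsilon>" and big: "C\<^sub>1 < kernel_mass s \<epsilon> TYPE(real)"
  shows "\<exists>\<mu>\<le>C\<^sub>1. \<forall>\<tau>>0. \<exists>f. f \<in> borel_measurable borel \<and> (\<exists>F. \<forall>x. \<bar>f x\<bar> \<le> F * indicator {0<..<1} x) \<and> (\<forall>x. 0 \<le> f x) \<and>
     (\<integral>x. f x \<partial>lborel) = 1 \<and>
     (\<integral>x. \<bar>(kernel_mass s \<epsilon> TYPE(real) - \<mu>) * f x - indicator {0<..<1} x * odd_pot s \<epsilon> f x\<bar> \<partial>lborel) \<le> \<tau>"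
proof -
  let ?S = "{0<..<1::real}"
  define b where "b x y = indicator ?S x * indicator ?S y * odd_kernel s \<epsilon> x y" for x y
  interpret bounded_symmetric_kernel ?S b "reg_kernel s \<epsilon> (0::real)"
  proof
    show "(\<lambda>(x, y). b x y) \<in> borel_measurable (borel \<Otimes>\<^sub>M borel)" unfolding b_def by measurable
    show "0 \<le> b x y" "b x y \<le> reg_kernel s \<epsilon> (0::real)" for x y
      using odd_kernel_nonneg[OF \<epsilon>, of x y] odd_kernel_le[OF \<epsilon>, of x y] by (auto simp: b_def indicator_def)
    show "b x y = b y x" for x y unfolding b_def by (subst odd_kernel_sym) (simp add: mult_ac)
  qed (auto simp: b_def)
  have op: "kernel_op f x = indicator ?S x * odd_pot s \<epsilon> f x" if f: "bounded_supp f" for f x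
  proof -
    have "f y = indicator ?S y * f y" for y using f unfolding bounded_supp_def
      by (metis abs_le_zero_iff indicator_simps(1) indicator_simps(2) mult_cancel_right1 mult_zero_right mult_1 mult_zero_left)
    then have "b x y * f y = indicator ?S x * (odd_kernel s \<epsilon> x y * f y)" for y
      unfolding b_def by (metis mult.assoc mult.commute)
    then have "kernel_op f x = (\<integral>y. indicator ?S x * (odd_kernel s \<epsilon> x y * f y) \<partial>lborel)" unfolding kernel_op_def by (simp only:)
    then show ?thesis by (simp add: odd_pot_def)
  qed
  have supp: "bounded_supp phi"
  proof (rule bounded_supp_I[where F = 1])
    show "\<bar>phi x\<bar> \<le> 1 * indicator ?S x" for x
      using phi_supp[of x] phi_le_1[of x] phi_nonneg[of x] by (cases "phi x = 0") (auto simp: indicator_def)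
  qed simp
  have p: "phi x * kernel_op phi x = phi x * odd_pot s \<epsilon> phi x" for x
    using phi_supp[of x] by (cases "phi x = 0") (auto simp: op[OF supp])
  have "\<exists>\<theta>\<ge>kernel_mass s \<epsilon> TYPE(real) - C\<^sub>1. \<forall>\<tau>>0. \<exists>f. bounded_supp f \<and> (\<forall>x. 0 \<le> f x) \<and> (\<integral>x. f x \<partial>lborel) = 1 \<and> (\<integral>x. \<bar>\<theta> * f x - kernel_op f x\<bar> \<partial>lborel) \<le> \<tau>"
    using phi_energy[OF \<epsilon>] big
    by (intro approximate_eigenfunction[OF supp phi_nonneg phi_le_1 phi_square_pos]) (auto simp: p)
  then obtain \<theta> where \<theta>: "kernel_mass s \<epsilon> TYPE(real) - C\<^sub>1 \<le> \<theta>"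
    "\<And>\<tau>. \<tau> > 0 \<Longrightarrow> \<exists>f. bounded_supp f \<and> (\<forall>x. 0 \<le> f x) \<and> (\<integral>x. f x \<partial>lborel) = 1 \<and> (\<integral>x. \<bar>\<theta> * f x - kernel_op f x\<bar> \<partial>lborel) \<le> \<tau>"
    by blast
  show ?thesis
  proof (intro exI[of _ "kernel_mass s \<epsilon> TYPE(real) - \<theta>"] conjI allI impI)
    fix \<tau> :: real assume "0 < \<tau>"
    then obtain f where "bounded_supp f" "\<forall>x. 0 \<le> f x" "(\<integral>x. f x \<partial>lborel) = 1" "(\<integral>x. \<bar>\<theta> * f x - kernel_op f x\<bar> \<partial>lborel) \<le> \<tau>"
      using \<theta>(2) by blast
    then show "\<exists>f. f \<in> borel_measurable borel \<and> (\<exists>F. \<forall>x. \<bar>f x\<bar> \<le> F * indicator ?S x) \<and> (\<forall>x. 0 \<le> f x) \<and>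
     (\<integral>x. f x \<partial>lborel) = 1 \<and>
     (\<integral>x. \<bar>(kernel_mass s \<epsilon> TYPE(real) - (kernel_mass s \<epsilon> TYPE(real) - \<theta>)) * f x - indicator ?S x * odd_pot s \<epsilon> f x\<bar> \<partial>lborel) \<le> \<tau>"
      using op by (intro exI[of _ f]) (auto simp: bounded_supp_def)
  qed (use \<theta> in auto)
qed


section \<open>Testing bounded functions with an approximate odd eigenfunction\<close>

context
  fixes \<epsilon> :: real and f :: "real \<Rightarrow> real" and F :: real
  assumes \<epsilon>: "0 < \<epsilon>" and f_meas [measurable]: "f \<in> borel_measurable borel"
    and f_bound: "\<And>x. \<bar>f x\<bar> \<le> F * indicator {0<..<1} x" and f_nonneg: "\<And>x. 0 \<le> f x"
    and f_int: "(\<integral>x. f x \<partial>lborel) = 1"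
begin

lemma f_supp: "f x \<noteq> 0 \<Longrightarrow> 0 < x \<and> x < 1"
  using f_bound[of x] by (cases "0 < x \<and> x < 1") auto

text \<open>If f were not integrable, its integral would be 0 by convention and not 1.\<close>

lemma f_integrable: "integrable lborel f"
  using f_int not_integrable_integral_eq[of lborel f] by fastforce

lemma f_reflect_integrable: "integrable lborel (\<lambda>x. f (2 - x))"
  by (subst lborel_integrable_reflect_iff) (rule f_integrable)

lemma odd_pot_integrand_integrable: "integrable lborel (\<lambda>y. odd_kernel s \<epsilon> x y * f y)"
proof (rule integrable_mult_bounded(1)[OF f_integrable])
  have "(\<lambda>y. odd_kernel s \<epsilon> x y) \<in> borel_measurable borel" by measurable
  then show "(\<lambda>y. odd_kernel s \<epsilon> x y) \<in> borel_measurable lborel" by simp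
  show "\<bar>odd_kernel s \<epsilon> x y\<bar> \<le> 2 * reg_kernel s \<epsilon> (0::real)" for y
    using reg_kernel_le_const[OF s0 \<epsilon>, of "x - y"] reg_kernel_le_const[OF s0 \<epsilon>, of "2 - x - y"]
      reg_kernel_nonneg[of s \<epsilon> "x - y"] reg_kernel_nonneg[of s \<epsilon> "2 - x - y"]
    unfolding odd_kernel_def by linarith
qed

lemma odd_pot_measurable [measurable]: "odd_pot s \<epsilon> f \<in> borel_measurable borel"
  unfolding odd_pot_def[abs_def] by measurable

lemma odd_pot_nonneg: assumes "x \<le> 1" shows "0 \<le> odd_pot s \<epsilon> f x"
  unfolding odd_pot_def
proof (intro integral_nonneg_AE AE_I2)
  fix y show "0 \<le> odd_kernel s \<epsilon> x y * f y"
    using odd_kernel_nonneg[OF \<epsilon> assms, of y] f_nonneg[of y] f_supp[of y] by (cases "f y = 0") auto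
qed

lemma odd_pot_reflect: "odd_pot s \<epsilon> f (2 - x) = - odd_pot s \<epsilon> f x"
  by (simp add: odd_pot_def odd_kernel_reflect)

lemma odd_pot_1: "odd_pot s \<epsilon> f 1 = 0" using odd_pot_reflect[of 1] by simp

lemma reg_lap_odd_extension:
  "reg_lap s \<epsilon> (\<lambda>x. f x - f (2 - x)) x = kernel_mass s \<epsilon> TYPE(real) * (f x - f (2 - x)) - odd_pot s \<epsilon> f x"
proof -
  have i: "integrable lborel (\<lambda>y. reg_kernel s \<epsilon> (y - x) * f y)"
    by (rule kernel_times_integrable_integrable[OF s0 \<epsilon> f_integrable])
  have i2: "integrable lborel (\<lambda>y. reg_kernel s \<epsilon> (y - x) * f (2 - y))"
    by (rule kernel_times_integrable_integrable[OF s0 \<epsilon> f_reflect_integrable])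
  have i3: "integrable lborel (\<lambda>y. reg_kernel s \<epsilon> (2 - x - y) * f y)"
    using lborel_integrable_reflect_iff[of "\<lambda>y. reg_kernel s \<epsilon> (2 - x - y) * f y" 2] i2 by simp
  have e: "(\<integral>y. reg_kernel s \<epsilon> (y - x) * f (2 - y) \<partial>lborel) = (\<integral>y. reg_kernel s \<epsilon> (2 - x - y) * f y \<partial>lborel)"
    using lborel_integral_reflect[of "\<lambda>y. reg_kernel s \<epsilon> (2 - x - y) * f y" 2] by simp
  have c: "reg_kernel s \<epsilon> (x - y) = reg_kernel s \<epsilon> (y - x)" for y using reg_kernel_uminus[of s \<epsilon> "x - y"] by simp
  have "(\<integral>y. reg_kernel s \<epsilon> (y - x) * (f y - f (2 - y)) \<partial>lborel) =
     (\<integral>y. reg_kernel s \<epsilon> (y - x) * f y \<partial>lborel) - (\<integral>y. reg_kernel s \<epsilon> (2 - x - y) * f y \<partial>lborel)"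
    using i i2 by (simp add: right_diff_distrib e)
  also have "\<dots> = odd_pot s \<epsilon> f x"
    using i i3 by (simp add: odd_pot_def odd_kernel_def left_diff_distrib c)
  finally show ?thesis by (simp add: reg_lap_def)
qed

lemma odd_extension_integrable: "integrable lborel (\<lambda>x. f x - f (2 - x))"
  using f_integrable f_reflect_integrable by simp

text \<open>\<open>reg_lap\<close> maps integrable functions to integrable ones, as the pairing with
  the constant 1 shows; apply this to the odd extension of f.\<close>

lemma odd_pot_integrable: "integrable lborel (odd_pot s \<epsilon> f)"
proof -
  have "integrable lborel (\<lambda>x. 1 * reg_lap s \<epsilon> (\<lambda>x. f x - f (2 - x)) x)"
    by (rule reg_lap_selfadjoint(2)[OF s0 \<epsilon> odd_extension_integrable, where V = "\<lambda>_. 1" and M = 1]) auto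
  then have "integrable lborel (\<lambda>x. kernel_mass s \<epsilon> TYPE(real) * (f x - f (2 - x)) - 1 * reg_lap s \<epsilon> (\<lambda>x. f x - f (2 - x)) x)"
    using odd_extension_integrable by (intro Bochner_Integration.integrable_diff) auto
  moreover have "kernel_mass s \<epsilon> TYPE(real) * (f x - f (2 - x)) - 1 * reg_lap s \<epsilon> (\<lambda>x. f x - f (2 - x)) x = odd_pot s \<epsilon> f x" for x
    by (simp add: reg_lap_odd_extension)
  ultimately show ?thesis by (simp only:)
qed

text \<open>The operator is moved from V to the odd extension of f, where
  \<open>reg_lap_odd_extension\<close> evaluates it. The half line beyond 1 is then folded back by
  reflection, under which \<open>odd_pot\<close> changes sign.\<close>

lemma odd_test_identity:
  fixes V :: "real \<Rightarrow> real"
  assumes V: "V \<in> borel_measurable borel" "\<And>x. \<bar>V x\<bar> \<le> M"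
  shows "integrable lborel (\<lambda>y. f y * (reg_lap s \<epsilon> V y - reg_lap s \<epsilon> V (2 - y)))"
   "integrable lborel (\<lambda>y. f y * (V y - V (2 - y)))"
   "integrable lborel (\<lambda>x. indicator {..1} x * ((V x - V (2 - x)) * odd_pot s \<epsilon> f x))"
   "(\<integral>y. f y * (reg_lap s \<epsilon> V y - reg_lap s \<epsilon> V (2 - y)) \<partial>lborel) =
     kernel_mass s \<epsilon> TYPE(real) * (\<integral>y. f y * (V y - V (2 - y)) \<partial>lborel)
      - (\<integral>x. indicator {..1} x * ((V x - V (2 - x)) * odd_pot s \<epsilon> f x) \<partial>lborel)"
proof -
  note [measurable] = V(1)
  have 1: "integrable lborel (\<lambda>y. f y * reg_lap s \<epsilon> V y)" by (rule reg_lap_selfadjoint(1)[OF s0 \<epsilon> f_integrable V])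
  have 2: "integrable lborel (\<lambda>y. f (2 - y) * reg_lap s \<epsilon> V y)" by (rule reg_lap_selfadjoint(1)[OF s0 \<epsilon> f_reflect_integrable V])
  have 3: "integrable lborel (\<lambda>y. f y * reg_lap s \<epsilon> V (2 - y))"
    using lborel_integrable_reflect_iff[of "\<lambda>y. f y * reg_lap s \<epsilon> V (2 - y)" 2] 2 by simp
  have e3: "(\<integral>y. f (2 - y) * reg_lap s \<epsilon> V y \<partial>lborel) = (\<integral>y. f y * reg_lap s \<epsilon> V (2 - y) \<partial>lborel)"
    using lborel_integral_reflect[of "\<lambda>y. f y * reg_lap s \<epsilon> V (2 - y)" 2] by simp
  show "integrable lborel (\<lambda>y. f y * (reg_lap s \<epsilon> V y - reg_lap s \<epsilon> V (2 - y)))"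
    using 1 3 by (simp add: right_diff_distrib)
  have 4: "integrable lborel (\<lambda>y. f y * V y)" "integrable lborel (\<lambda>y. f y * V (2 - y))" "integrable lborel (\<lambda>y. f (2 - y) * V y)"
    by (rule integrable_mult_bounded(2)[OF f_integrable, where C = M] integrable_mult_bounded(2)[OF f_reflect_integrable, where C = M],
        measurable, rule V(2))+
  have e4: "(\<integral>y. f (2 - y) * V y \<partial>lborel) = (\<integral>y. f y * V (2 - y) \<partial>lborel)"
    using lborel_integral_reflect[of "\<lambda>y. f y * V (2 - y)" 2] by simp
  show "integrable lborel (\<lambda>y. f y * (V y - V (2 - y)))" using 4 by (simp add: right_diff_distrib)
  let ?D = "odd_pot s \<epsilon> f"
  have VD: "integrable lborel (\<lambda>x. V x * ?D x)" "integrable lborel (\<lambda>x. indicator {..1} x * (V x * ?D x))"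
      "integrable lborel (\<lambda>x. indicator {1<..} x * (V x * ?D x))" "integrable lborel (\<lambda>x. indicator {1..} x * (V x * ?D x))"
    "integrable lborel (\<lambda>x. indicator {..1} x * (V (2 - x) * ?D x))"
  proof -
    show a: "integrable lborel (\<lambda>x. V x * ?D x)" by (rule integrable_mult_bounded(1)[OF odd_pot_integrable, where C = M]) (use V in auto)
    show "integrable lborel (\<lambda>x. indicator {..1} x * (V x * ?D x))"
      by (rule integrable_mult_bounded(1)[OF a, where C = 1]) (auto simp: indicator_def)
    show "integrable lborel (\<lambda>x. indicator {1<..} x * (V x * ?D x))"
      by (rule integrable_mult_bounded(1)[OF a, where C = 1]) (auto simp: indicator_def)
    show "integrable lborel (\<lambda>x. indicator {1..} x * (V x * ?D x))"
      by (rule integrable_mult_bounded(1)[OF a, where C = 1]) (auto simp: indicator_def)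
    have "integrable lborel (\<lambda>x. V (2 - x) * ?D x)" by (rule integrable_mult_bounded(1)[OF odd_pot_integrable, where C = M]) (use V in auto)
    then show "integrable lborel (\<lambda>x. indicator {..1} x * (V (2 - x) * ?D x))"
      by (rule integrable_mult_bounded(1)[where C = 1]) (auto simp: indicator_def)
  qed
  have spl: "(\<lambda>x. indicator {..1} x * ((V x - V (2 - x)) * ?D x)) = (\<lambda>x. indicator {..1} x * (V x * ?D x) - indicator {..1} x * (V (2 - x) * ?D x))"
    by (auto simp: algebra_simps)
  show "integrable lborel (\<lambda>x. indicator {..1} x * ((V x - V (2 - x)) * ?D x))"
    unfolding spl using VD by (intro Bochner_Integration.integrable_diff)
  have "(\<integral>x. V x * ?D x \<partial>lborel) = (\<integral>x. indicator {..1} x * (V x * ?D x) + indicator {1<..} x * (V x * ?D x) \<partial>lborel)"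
    by (intro Bochner_Integration.integral_cong) (auto simp: indicator_def)
  also have "\<dots> = (\<integral>x. indicator {..1} x * (V x * ?D x) \<partial>lborel) + (\<integral>x. indicator {1<..} x * (V x * ?D x) \<partial>lborel)"
    using VD by simp
  \<comment> \<open>Adding the point 1, where \<open>odd_pot\<close> vanishes, makes the reflected
    set exactly \<open>{..1}\<close>.\<close>
  also have "(\<integral>x. indicator {1<..} x * (V x * ?D x) \<partial>lborel) = (\<integral>x. indicator {1..} x * (V x * ?D x) \<partial>lborel)"
    by (intro Bochner_Integration.integral_cong) (auto simp: indicator_def odd_pot_1)
  also have "\<dots> = (\<integral>x. indicator {1..} (2 - x) * (V (2 - x) * ?D (2 - x)) \<partial>lborel)"
    by (rule lborel_integral_reflect[symmetric])
  also have "\<dots> = (\<integral>x. - (indicator {..1} x * (V (2 - x) * ?D x)) \<partial>lborel)"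
    by (intro Bochner_Integration.integral_cong) (auto simp: indicator_def odd_pot_reflect)
  also have "\<dots> = - (\<integral>x. indicator {..1} x * (V (2 - x) * ?D x) \<partial>lborel)" by simp
  finally have VDi: "(\<integral>x. V x * ?D x \<partial>lborel) = (\<integral>x. indicator {..1} x * ((V x - V (2 - x)) * ?D x) \<partial>lborel)"
    unfolding spl using VD by simp
  have "(\<integral>y. f y * (reg_lap s \<epsilon> V y - reg_lap s \<epsilon> V (2 - y)) \<partial>lborel) = (\<integral>y. f y * reg_lap s \<epsilon> V y \<partial>lborel) - (\<integral>y. f (2 - y) * reg_lap s \<epsilon> V y \<partial>lborel)"
    using 1 3 by (simp add: right_diff_distrib e3)
  also have "\<dots> = (\<integral>y. (f y - f (2 - y)) * reg_lap s \<epsilon> V y \<partial>lborel)" using 1 2 by (simp add: left_diff_distrib)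
  also have "\<dots> = (\<integral>y. V y * reg_lap s \<epsilon> (\<lambda>x. f x - f (2 - x)) y \<partial>lborel)"
    by (rule reg_lap_selfadjoint(3)[OF s0 \<epsilon> odd_extension_integrable V])
  also have "\<dots> = (\<integral>y. kernel_mass s \<epsilon> TYPE(real) * (f y * V y - f (2 - y) * V y) - V y * ?D y \<partial>lborel)"
    by (intro Bochner_Integration.integral_cong) (auto simp: reg_lap_odd_extension algebra_simps)
  also have "\<dots> = kernel_mass s \<epsilon> TYPE(real) * ((\<integral>y. f y * V y \<partial>lborel) - (\<integral>y. f y * V (2 - y) \<partial>lborel)) - (\<integral>y. V y * ?D y \<partial>lborel)"
    using 4 VD by (simp add: e4)
  also have "(\<integral>y. f y * V y \<partial>lborel) - (\<integral>y. f y * V (2 - y) \<partial>lborel) = (\<integral>y. f y * (V y - V (2 - y)) \<partial>lborel)"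
    using 4 by (simp add: right_diff_distrib)
  finally show "(\<integral>y. f y * (reg_lap s \<epsilon> V y - reg_lap s \<epsilon> V (2 - y)) \<partial>lborel) =
     kernel_mass s \<epsilon> TYPE(real) * (\<integral>y. f y * (V y - V (2 - y)) \<partial>lborel)
      - (\<integral>x. indicator {..1} x * ((V x - V (2 - x)) * odd_pot s \<epsilon> f x) \<partial>lborel)"
    unfolding VDi .
qed

context
  fixes \<mu> \<tau> :: real
  assumes eig: "(\<integral>x. \<bar>(kernel_mass s \<epsilon> TYPE(real) - \<mu>) * f x - indicator {0<..<1} x * odd_pot s \<epsilon> f x\<bar> \<partial>lborel) \<le> \<tau>"
begin

text \<open>On (0, 1) the eigenvalue equation replaces \<open>odd_pot\<close> by the mass minus
  \<mu>, times f, so that the large mass cancels. There remains the part over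
  \<open>x \<le> 0\<close>, where \<open>odd_pot\<close> is a nonnegative weight. The error is
  \<tau> times the bound \<open>2 * M\<close> for \<open>V x - V (2 - x)\<close>.\<close>

lemma odd_test_approximate:
  fixes V :: "real \<Rightarrow> real"
  assumes V: "V \<in> borel_measurable borel" "\<And>x. \<bar>V x\<bar> \<le> M"
  shows "integrable lborel (\<lambda>x. indicator {..0} x * ((V x - V (2 - x)) * odd_pot s \<epsilon> f x))"
   "\<bar>(\<integral>y. f y * (reg_lap s \<epsilon> V y - reg_lap s \<epsilon> V (2 - y)) \<partial>lborel) - \<mu> * (\<integral>y. f y * (V y - V (2 - y)) \<partial>lborel)
      + (\<integral>x. indicator {..0} x * ((V x - V (2 - x)) * odd_pot s \<epsilon> f x) \<partial>lborel)\<bar> \<le> 2 * M * \<tau>"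
proof -
  note [measurable] = V(1)
  note I = odd_test_identity[OF V]
  let ?D = "odd_pot s \<epsilon> f" let ?W = "\<lambda>x. V x - V (2 - x)" let ?\<kappa> = "kernel_mass s \<epsilon> TYPE(real)"
  have W: "\<bar>?W x\<bar> \<le> 2 * M" for x using V(2)[of x] V(2)[of "2 - x"] by linarith
  have WD: "integrable lborel (\<lambda>x. ?W x * ?D x)"
    by (rule integrable_mult_bounded(1)[OF odd_pot_integrable _ W]) measurable
  show i0: "integrable lborel (\<lambda>x. indicator {..0} x * (?W x * ?D x))"
    by (rule integrable_mult_bounded(1)[OF WD, where C = 1]) (auto simp: indicator_def)
  have i1: "integrable lborel (\<lambda>x. indicator {0<..<1} x * (?W x * ?D x))"
    by (rule integrable_mult_bounded(1)[OF WD, where C = 1]) (auto simp: indicator_def)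
  have "(\<integral>x. indicator {..1} x * (?W x * ?D x) \<partial>lborel) = (\<integral>x. indicator {..0} x * (?W x * ?D x) + indicator {0<..<1} x * (?W x * ?D x) \<partial>lborel)"
  proof (intro Bochner_Integration.integral_cong refl)
    fix x :: real
    show "indicator {..1} x * (?W x * ?D x) = indicator {..0} x * (?W x * ?D x) + indicator {0<..<1} x * (?W x * ?D x)"
      by (cases "x = 1") (auto simp: indicator_def odd_pot_1)
  qed
  also have "\<dots> = (\<integral>x. indicator {..0} x * (?W x * ?D x) \<partial>lborel) + (\<integral>x. indicator {0<..<1} x * (?W x * ?D x) \<partial>lborel)"
    using i0 i1 by simp
  finally have e: "(\<integral>y. f y * (reg_lap s \<epsilon> V y - reg_lap s \<epsilon> V (2 - y)) \<partial>lborel) - \<mu> * (\<integral>y. f y * ?W y \<partial>lborel)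
      + (\<integral>x. indicator {..0} x * (?W x * ?D x) \<partial>lborel) = (?\<kappa> - \<mu>) * (\<integral>y. f y * ?W y \<partial>lborel) - (\<integral>x. indicator {0<..<1} x * (?W x * ?D x) \<partial>lborel)"
    using I(4) by (simp add: left_diff_distrib)
  also have "\<dots> = (\<integral>x. ?W x * ((?\<kappa> - \<mu>) * f x - indicator {0<..<1} x * ?D x) \<partial>lborel)"
  proof -
    have "(\<integral>x. ?W x * ((?\<kappa> - \<mu>) * f x - indicator {0<..<1} x * ?D x) \<partial>lborel) = (\<integral>x. (?\<kappa> - \<mu>) * (f x * ?W x) - indicator {0<..<1} x * (?W x * ?D x) \<partial>lborel)"
      by (intro Bochner_Integration.integral_cong) (auto simp: algebra_simps)
    then show ?thesis using I(2) i1 by simp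
  qed
  finally have e: "(\<integral>y. f y * (reg_lap s \<epsilon> V y - reg_lap s \<epsilon> V (2 - y)) \<partial>lborel) - \<mu> * (\<integral>y. f y * ?W y \<partial>lborel)
      + (\<integral>x. indicator {..0} x * (?W x * ?D x) \<partial>lborel) = (\<integral>x. ?W x * ((?\<kappa> - \<mu>) * f x - indicator {0<..<1} x * ?D x) \<partial>lborel)" .
  have r: "integrable lborel (\<lambda>x. (?\<kappa> - \<mu>) * f x - indicator {0<..<1} x * ?D x)"
    using f_integrable integrable_mult_bounded(1)[OF odd_pot_integrable, of "indicator {0<..<1}" 1] by (auto simp: indicator_def)
  have "\<bar>(\<integral>x. ?W x * ((?\<kappa> - \<mu>) * f x - indicator {0<..<1} x * ?D x) \<partial>lborel)\<bar> \<le> (\<integral>x. \<bar>?W x * ((?\<kappa> - \<mu>) * f x - indicator {0<..<1} x * ?D x)\<bar> \<partial>lborel)"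
    by (rule integral_abs_bound)
  also have "\<dots> \<le> (\<integral>x. 2 * M * \<bar>(?\<kappa> - \<mu>) * f x - indicator {0<..<1} x * ?D x\<bar> \<partial>lborel)"
  proof (rule integral_mono)
    show "integrable lborel (\<lambda>x. \<bar>?W x * ((?\<kappa> - \<mu>) * f x - indicator {0<..<1} x * ?D x)\<bar>)"
      by (intro integrable_abs integrable_mult_bounded(1)[OF r _ W]) measurable
    show "\<bar>?W x * ((?\<kappa> - \<mu>) * f x - indicator {0<..<1} x * ?D x)\<bar> \<le> 2 * M * \<bar>(?\<kappa> - \<mu>) * f x - indicator {0<..<1} x * ?D x\<bar>" for x
      unfolding abs_mult[of "?W x"] using W[of x] by (intro mult_right_mono) auto
    show "integrable lborel (\<lambda>x. 2 * M * \<bar>(?\<kappa> - \<mu>) * f x - indicator {0<..<1} x * ?D x\<bar>)"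
      using integrable_abs[OF r] by simp
  qed
  also have "\<dots> \<le> 2 * M * \<tau>"
  proof -
    have "0 \<le> M" using V(2)[of 0] by linarith
    then show ?thesis using eig by (simp add: mult_left_mono)
  qed
  finally show "\<bar>(\<integral>y. f y * (reg_lap s \<epsilon> V y - reg_lap s \<epsilon> V (2 - y)) \<partial>lborel) - \<mu> * (\<integral>y. f y * ?W y \<partial>lborel)
      + (\<integral>x. indicator {..0} x * (?W x * ?D x) \<partial>lborel)\<bar> \<le> 2 * M * \<tau>" unfolding e .
qed

text \<open>Testing with the indicator of \<open>(-\<infinity>, 1)\<close> controls both the flux through 0 and the
  mass that the eigenfunction has near 1.\<close>

lemma flux_bound:
  defines "t \<equiv> \<lambda>y. \<integral>x. reg_kernel s \<epsilon> (x - y) * indicator {1..} x \<partial>lborel"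
  shows "(\<integral>y. f y * t y \<partial>lborel) + (\<integral>x. indicator {..0} x * odd_pot s \<epsilon> f x \<partial>lborel) \<le> \<mu> + 2 * \<tau>"
    "integrable lborel (\<lambda>y. f y * t y)"
proof -
  define V where "V = (indicator {..<1} :: real \<Rightarrow> real)"
  have V: "V \<in> borel_measurable borel" "\<And>x. \<bar>V x\<bar> \<le> 1" by (auto simp: V_def indicator_def)
  note A = odd_test_approximate[OF V]
  have W1: "f y * (V y - V (2 - y)) = f y" for y
    using f_supp[of y] by (cases "f y = 0") (auto simp: V_def)
  have W2: "indicator {..0} x * ((V x - V (2 - x)) * odd_pot s \<epsilon> f x) = indicator {..0} x * odd_pot s \<epsilon> f x" for x
    by (auto simp: V_def indicator_def)
  have it: "integrable lborel (\<lambda>x. reg_kernel s \<epsilon> (x - y) * indicator {1..} x)" for y :: real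
    by (rule kernel_times_bounded_integrable[OF s0 \<epsilon>, where M = 1]) (auto simp: indicator_def)
  have iv: "integrable lborel (\<lambda>x. reg_kernel s \<epsilon> (x - y) * V x)" for y :: real
    by (rule kernel_times_bounded_integrable[OF s0 \<epsilon> V])
  have t: "reg_lap s \<epsilon> V y = t y" if "y < 1" for y
  proof -
    have "kernel_mass s \<epsilon> TYPE(real) = (\<integral>x. reg_kernel s \<epsilon> (x - y) * V x + reg_kernel s \<epsilon> (x - y) * indicator {1..} x \<partial>lborel)"
    proof -
      have "kernel_mass s \<epsilon> TYPE(real) = (\<integral>x. reg_kernel s \<epsilon> (x - y) \<partial>lborel)" by (rule lborel_integral_diff[symmetric])
      also have "\<dots> = (\<integral>x. reg_kernel s \<epsilon> (x - y) * V x + reg_kernel s \<epsilon> (x - y) * indicator {1..} x \<partial>lborel)"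
        by (intro Bochner_Integration.integral_cong) (auto simp: V_def indicator_def)
      finally show ?thesis .
    qed
    also have "\<dots> = (\<integral>x. reg_kernel s \<epsilon> (x - y) * V x \<partial>lborel) + t y"
      unfolding t_def using iv it by simp
    finally show ?thesis using that by (simp add: reg_lap_def V_def)
  qed
  have neg: "reg_lap s \<epsilon> V y \<le> 0" if "1 < y" for y
  proof -
    have "0 \<le> (\<integral>x. reg_kernel s \<epsilon> (x - y) * V x \<partial>lborel)"
      by (intro integral_nonneg_AE AE_I2) (auto simp: V_def)
    then show ?thesis using that by (simp add: reg_lap_def V_def)
  qed
  \<comment> \<open>Before 1, \<open>reg_lap\<close> of the indicator is the kernel mass t beyond 1;
    after 1 it is nonpositive.\<close>
  have ge: "f y * t y \<le> f y * (reg_lap s \<epsilon> V y - reg_lap s \<epsilon> V (2 - y))" for y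
  proof (cases "f y = 0")
    case False
    then have "y < 1" "1 < 2 - y" using f_supp[of y] by auto
    then show ?thesis using t[of y] neg[of "2 - y"] f_nonneg[of y] by (intro mult_left_mono) auto
  qed simp
  have ft: "f y * t y = f y * reg_lap s \<epsilon> V y" for y using t[of y] f_supp[of y] by (cases "f y = 0") auto
  show i: "integrable lborel (\<lambda>y. f y * t y)" unfolding ft by (rule reg_lap_selfadjoint(1)[OF s0 \<epsilon> f_integrable V])
  have "(\<integral>y. f y * t y \<partial>lborel) \<le> (\<integral>y. f y * (reg_lap s \<epsilon> V y - reg_lap s \<epsilon> V (2 - y)) \<partial>lborel)"
    by (rule integral_mono[OF i odd_test_identity(1)[OF V] ge])
  then show "(\<integral>y. f y * t y \<partial>lborel) + (\<integral>x. indicator {..0} x * odd_pot s \<epsilon> f x \<partial>lborel) \<le> \<mu> + 2 * \<tau>"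
    using A(2) by (simp add: W1 W2 f_int)
qed

text \<open>The interval from \<open>y + h\<close> to \<open>y + 2 * h\<close> lies beyond
  1.\<close>

lemma t_lower:
  assumes "0 < y" "y < 1" "\<epsilon> \<le> h" "1 - h \<le> y"
  shows "tail_low s h \<le> (\<integral>x. reg_kernel s \<epsilon> (x - y) * indicator {1..} x \<partial>lborel)"
proof -
  note tail_low_le[OF \<epsilon> assms(3)]
  also have "(\<integral>x. reg_kernel s \<epsilon> x * indicator {h..2 * h} x \<partial>lborel) = (\<integral>x. reg_kernel s \<epsilon> (x - y) * indicator {h..2 * h} (x - y) \<partial>lborel)"
    by (rule lborel_integral_diff[symmetric])
  also have "\<dots> \<le> (\<integral>x. reg_kernel s \<epsilon> (x - y) * indicator {1..} x \<partial>lborel)"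
  proof (rule integral_mono)
    show "integrable lborel (\<lambda>x. reg_kernel s \<epsilon> (x - y) * indicator {1..} x)"
      by (rule kernel_times_bounded_integrable[OF s0 \<epsilon>, where M = 1]) (auto simp: indicator_def)
    show "integrable lborel (\<lambda>x. reg_kernel s \<epsilon> (x - y) * indicator {h..2 * h} (x - y))"
      by (rule kernel_times_bounded_integrable[OF s0 \<epsilon>, where M = 1]) (auto simp: indicator_def)
  qed (use assms in \<open>auto simp: indicator_def\<close>)
  finally show ?thesis .
qed

text \<open>In \<open>t_lower\<close> the choice \<open>h = 1\<close> is admissible for every y in
  (0, 1). This keeps the eigenvalues away from 0 uniformly in \<epsilon>.\<close>

lemma eigenvalue_lower: assumes "\<epsilon> \<le> 1" shows "tail_low s 1 \<le> \<mu> + 2 * \<tau>"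
proof -
  let ?t = "\<lambda>y. \<integral>x. reg_kernel s \<epsilon> (x - y) * indicator {1..} x \<partial>lborel"
  have "tail_low s 1 = (\<integral>y. f y * tail_low s 1 \<partial>lborel)" by (simp add: f_int)
  also have "\<dots> \<le> (\<integral>y. f y * ?t y \<partial>lborel)"
  proof (rule integral_mono)
    show "f y * tail_low s 1 \<le> f y * ?t y" for y
      using f_supp[of y] f_nonneg[of y] t_lower[of y 1] assms by (cases "f y = 0") (auto intro!: mult_left_mono)
  qed (use f_integrable flux_bound(2) in auto)
  also have "\<dots> \<le> \<mu> + 2 * \<tau>"
  proof -
    have "0 \<le> (\<integral>x. indicator {..0} x * odd_pot s \<epsilon> f x \<partial>lborel)"
      by (intro integral_nonneg_AE AE_I2) (auto simp: indicator_def odd_pot_nonneg)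
    then show ?thesis using flux_bound(1) by linarith
  qed
  finally show ?thesis .
qed

lemma flux_le: "(\<integral>x. indicator {..0} x * odd_pot s \<epsilon> f x \<partial>lborel) \<le> \<mu> + 2 * \<tau>"
proof -
  have "0 \<le> (\<integral>y. f y * (\<integral>x. reg_kernel s \<epsilon> (x - y) * indicator {1..} x \<partial>lborel) \<partial>lborel)"
    using f_nonneg by (intro integral_nonneg_AE AE_I2 mult_nonneg_nonneg) auto
  then show ?thesis using flux_bound(1) by linarith
qed

text \<open>A Chebyshev argument: mass within h of 1 leaks across 1 at a rate of at least
  \<open>tail_low s h\<close>, while \<open>flux_bound\<close> limits the total leakage. Mass close
  to 1 must be excluded because there it nearly cancels with its mirror image.\<close>

lemma mass_away:
  assumes h: "0 < h" "\<epsilon> \<le> h" "2 * (\<mu> + 2 * \<tau>) \<le> tail_low s h"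
  shows "1 / 2 \<le> (\<integral>y. f y * indicator {..1 - h} y \<partial>lborel)"
proof -
  let ?t = "\<lambda>y. \<integral>x. reg_kernel s \<epsilon> (x - y) * indicator {1..} x \<partial>lborel"
  have i: "integrable lborel (\<lambda>y. f y * indicator {..1 - h} y)" "integrable lborel (\<lambda>y. f y * indicator {1 - h<..} y)"
    by (rule integrable_mult_bounded(2)[OF f_integrable, where C = 1]; auto simp: indicator_def)+
  have "tail_low s h * (\<integral>y. f y * indicator {1 - h<..} y \<partial>lborel) = (\<integral>y. tail_low s h * (f y * indicator {1 - h<..} y) \<partial>lborel)" by simp
  also have "\<dots> \<le> (\<integral>y. f y * ?t y \<partial>lborel)"
  proof (rule integral_mono)
    fix y :: real
    have t0: "0 \<le> ?t y" by (intro integral_nonneg_AE AE_I2) auto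
    show "tail_low s h * (f y * indicator {1 - h<..} y) \<le> f y * ?t y"
    proof (cases "f y = 0 \<or> y \<le> 1 - h")
      case False
      then have "tail_low s h * f y \<le> ?t y * f y"
        using f_supp[of y] f_nonneg[of y] t_lower[of y h] h by (intro mult_right_mono) auto
      then show ?thesis using False by (simp add: mult.commute)
    qed (use t0 f_nonneg in auto)
  qed (use i flux_bound(2) in auto)
  also have "\<dots> \<le> \<mu> + 2 * \<tau>"
  proof -
    have "0 \<le> (\<integral>x. indicator {..0} x * odd_pot s \<epsilon> f x \<partial>lborel)"
      by (intro integral_nonneg_AE AE_I2) (auto simp: indicator_def odd_pot_nonneg)
    then show ?thesis using flux_bound(1) by linarith
  qed
  also have "\<dots> \<le> tail_low s h * (1 / 2)" using h by simp
  finally have "(\<integral>y. f y * indicator {1 - h<..} y \<partial>lborel) \<le> 1 / 2" using tail_low_pos[OF h(1)] by simp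
  moreover have "1 = (\<integral>y. f y * indicator {..1 - h} y \<partial>lborel) + (\<integral>y. f y * indicator {1 - h<..} y \<partial>lborel)"
  proof -
    have "1 = (\<integral>y. f y * indicator {..1 - h} y + f y * indicator {1 - h<..} y \<partial>lborel)"
      unfolding f_int[symmetric] by (intro Bochner_Integration.integral_cong) (auto simp: indicator_def)
    then show ?thesis using i by simp
  qed
  ultimately show ?thesis by linarith
qed

end

lemma odd_pot_lower:
  fixes x h p :: real
  assumes mass: "1 / 2 \<le> (\<integral>y. f y * indicator {..1 - h} y \<partial>lborel)"
    and d: "\<And>y. 0 < y \<Longrightarrow> y \<le> 1 - h \<Longrightarrow> p \<le> odd_kernel s \<epsilon> x y" and "0 \<le> p" "x \<le> 1"
  shows "p / 2 \<le> odd_pot s \<epsilon> f x"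
proof -
  have "p / 2 \<le> p * (\<integral>y. f y * indicator {..1 - h} y \<partial>lborel)" using mass assms(3) mult_left_mono[OF mass assms(3)] by simp
  also have "\<dots> = (\<integral>y. p * (f y * indicator {..1 - h} y) \<partial>lborel)" by simp
  also have "\<dots> \<le> odd_pot s \<epsilon> f x"
    unfolding odd_pot_def
  proof (rule integral_mono)
    show "integrable lborel (\<lambda>y. p * (f y * indicator {..1 - h} y))"
      by (intro integrable_mult_right integrable_mult_bounded(2)[OF f_integrable, where C = 1]) (auto simp: indicator_def)
    show "p * (f y * indicator {..1 - h} y) \<le> odd_kernel s \<epsilon> x y * f y" for y :: real
      using d[of y] f_supp[of y] f_nonneg[of y] odd_kernel_nonneg[OF \<epsilon> assms(4), of y]
      by (cases "f y = 0") (auto simp: indicator_def mult_right_mono)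
  qed (rule odd_pot_integrand_integrable)
  finally show ?thesis .
qed

end

end

section \<open>Nonexistence in one dimension\<close>

lemma bump_integrable: "integrable lborel (bump :: 'a::euclidean_space \<Rightarrow> real)"
proof (rule Bochner_Integration.integrable_bound)
  show "integrable lborel (indicator (cball 0 1) :: 'a \<Rightarrow> real)"
    by (intro integrable_real_indicator emeasure_lborel_cball_finite) auto
  show "AE x::'a in lborel. norm (bump x) \<le> norm (indicator (cball 0 1) x :: real)"
  proof (rule AE_I2)
    fix x :: 'a
    show "norm (bump x) \<le> norm (indicator (cball 0 1) x :: real)"
      using bump_le_1[of x] bump_eq_0[of x] by (cases "norm x \<le> 1") auto
  qed
qed simp

lemma bump_ge: "norm x \<le> 1 / 2 \<Longrightarrow> 1 / 4 \<le> bump x"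
proof -
  assume "norm x \<le> 1 / 2"
  then have "(norm x)\<^sup>2 \<le> (1 / 2)\<^sup>2" by (intro power_mono) auto
  then have "(1 / 2)\<^sup>2 \<le> (max 0 (1 - (norm x)\<^sup>2))\<^sup>2" by (intro power_mono) (auto simp: power2_eq_square)
  then show ?thesis by (simp add: bump_def power2_eq_square)
qed

lemma bump_integral_pos: "0 < integral\<^sup>L lborel (bump :: 'a::euclidean_space \<Rightarrow> real)"
proof -
  have i: "integrable lborel (indicator (cball 0 (1/2)) :: 'a \<Rightarrow> real)"
    by (intro integrable_real_indicator emeasure_lborel_cball_finite) auto
  have "0 < 1 / 4 * measure lborel (cball (0::'a) (1/2))" by simp
  also have "\<dots> = integral\<^sup>L lborel (\<lambda>x::'a. 1 / 4 * indicator (cball 0 (1/2)) x)" by (simp add: i)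
  also have "\<dots> \<le> integral\<^sup>L lborel (bump :: 'a \<Rightarrow> real)"
  proof (rule integral_mono)
    show "integrable lborel (\<lambda>x::'a. 1 / 4 * indicator (cball 0 (1/2)) x :: real)" using i by simp
    show "1 / 4 * indicator (cball 0 (1/2)) x \<le> bump x" for x :: 'a
      using bump_ge[of x] by (auto simp: indicator_def)
  qed (rule bump_integrable)
  finally show ?thesis .
qed

lemma norm_powr_tail_vanishes:
  assumes "0 < s" "0 < \<eta>"
  shows "\<exists>d\<ge>1. integral\<^sup>L lborel (\<lambda>z::'a::euclidean_space. indicator {z. d \<le> norm z} z * singular_kernel s z) \<le> \<eta>"
proof -
  let ?g = "\<lambda>z::'a. singular_kernel s z"
  have "(\<lambda>n. integral\<^sup>L lborel (\<lambda>z::'a. indicator {z. real (Suc n) \<le> norm z} z * ?g z)) \<longlonglongrightarrow> integral\<^sup>L lborel (\<lambda>z::'a. 0)"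
  proof (rule integral_dominated_convergence)
    show "integrable lborel (\<lambda>z::'a. indicator {z. 1 \<le> norm z} z * ?g z)"
      using assms by (intro integrable_norm_powr_far) auto
    show "AE z::'a in lborel. (\<lambda>n. indicator {z. real (Suc n) \<le> norm z} z * ?g z) \<longlonglongrightarrow> 0"
    proof (rule AE_I2)
      fix z :: 'a
      obtain N where "norm z < real N" using reals_Archimedean2 by blast
      then have "\<forall>\<^sub>F n in sequentially. indicator {z. real (Suc n) \<le> norm z} z * ?g z = 0"
        by (intro eventually_sequentiallyI[of N]) auto
      then show "(\<lambda>n. indicator {z. real (Suc n) \<le> norm z} z * ?g z) \<longlonglongrightarrow> 0" by (rule tendsto_eventually)
    qed
  qed (auto simp: indicator_def)
  then have "\<forall>\<^sub>F n in sequentially. integral\<^sup>L lborel (\<lambda>z::'a. indicator {z. real (Suc n) \<le> norm z} z * ?g z) < \<eta>"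
    using assms by (intro order_tendstoD) auto
  then obtain n where "integral\<^sup>L lborel (\<lambda>z::'a. indicator {z. real (Suc n) \<le> norm z} z * ?g z) < \<eta>"
    by (auto simp: eventually_sequentially)
  then show ?thesis by (intro exI[of _ "real (Suc n)"]) auto
qed

text \<open>The equation is imposed on the regularised operators, for all small \<epsilon>, locally
  uniformly in the open half line and with a fixed tolerance \<nu>. Smallness for every \<eta>
  forces \<open>U x = 0\<close> for \<open>x \<le> 0\<close>, so the exterior condition is contained
  in it.\<close>

definition approx_half_line_solution :: "real \<Rightarrow> real \<Rightarrow> real \<Rightarrow> real \<Rightarrow> (real \<Rightarrow> real) \<Rightarrow> bool" where
  "approx_half_line_solution s \<mu> M \<nu> U \<longleftrightarrow> U \<in> borel_measurable borel \<and> (\<forall>x. 0 \<le> U x \<and> U x \<le> M) \<and>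
     (\<forall>\<eta>>0. \<exists>\<delta>>0. \<forall>x\<le>\<delta>. U x \<le> \<eta>) \<and>
     (\<forall>a b. 0 < a \<longrightarrow> (\<exists>\<epsilon>\<^sub>0>0. \<forall>\<epsilon>. 0 < \<epsilon> \<and> \<epsilon> < \<epsilon>\<^sub>0 \<longrightarrow> (\<forall>t\<in>{a..b}. \<bar>reg_lap s \<epsilon> U t - \<mu> * (U t - 1)\<bar> \<le> \<nu>)))"

context
  fixes s :: real
  assumes s0: "0 < s" and s1: "s < 1"
begin

text \<open>The quantities \<open>r1\<close> and \<open>r2\<close> are the squared distances from x
  to y and to the mirror image of y, both increased by \<open>\<epsilon>\<^sup>2\<close>. They
  differ by \<open>(2 - 2 * y) * (2 - 2 * x)\<close>, which is at least \<open>4 * h\<close>; the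
  mean value theorem for the power turns this into a gap between the kernels that does not depend on
  \<epsilon>.\<close>

lemma odd_kernel_lower:
  assumes "0 < h" "0 \<le> X" "- X \<le> x" "x \<le> 0" "0 < y" "y \<le> 1 - h" "0 < \<epsilon>" "\<epsilon> \<le> 1"
  shows "(1 + 2 * s) / 2 * ((2 + X)\<^sup>2 + 1) powr (- ((1 + 2 * s) / 2) - 1) * (4 * h) \<le> odd_kernel s \<epsilon> x y"
proof -
  define p where "p = (1 + 2 * s) / 2"
  have p: "0 < p" using s0 by (simp add: p_def)
  define r1 where "r1 = (x - y)\<^sup>2 + \<epsilon>\<^sup>2"
  define r2 where "r2 = (2 - x - y)\<^sup>2 + \<epsilon>\<^sup>2"
  have "r2 - r1 = (2 - 2 * y) * (2 - 2 * x)" by (simp add: r1_def r2_def power2_eq_square algebra_simps)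
  moreover have "(2 * h) * 2 \<le> (2 - 2 * y) * (2 - 2 * x)" using assms by (intro mult_mono) auto
  ultimately have d: "4 * h \<le> r2 - r1" by simp
  have r1: "0 < r1" using assms by (simp add: r1_def add_nonneg_pos)
  have "(2 - x - y)\<^sup>2 \<le> (2 + X)\<^sup>2" "\<epsilon>\<^sup>2 \<le> 1" using assms by (auto intro!: power_mono power_le_one)
  then have r2: "r2 \<le> (2 + X)\<^sup>2 + 1" by (simp add: r2_def)
  have "r1 < r2" using d assms by simp
  then obtain z where z: "r1 < z" "z < r2" "r2 powr - p - r1 powr - p = (r2 - r1) * (- p * z powr (- p - 1))"
  proof -
    have "\<exists>z. r1 < z \<and> z < r2 \<and> r2 powr - p - r1 powr - p = (r2 - r1) * (- p * z powr (- p - 1))"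
      using r1 \<open>r1 < r2\<close> by (intro MVT2) (auto intro!: derivative_eq_intros)
    then show ?thesis using that by blast
  qed
  have "((2 + X)\<^sup>2 + 1) powr (- p - 1) \<le> z powr (- p - 1)"
    using z r1 r2 p by (intro powr_mono2') auto
  then have "p * ((2 + X)\<^sup>2 + 1) powr (- p - 1) * (4 * h) \<le> p * z powr (- p - 1) * (r2 - r1)"
    using d p assms by (intro mult_mono mult_left_mono) auto
  also have "\<dots> = r1 powr - p - r2 powr - p" using z(3) by (simp add: algebra_simps)
  also have "\<dots> = odd_kernel s \<epsilon> x y" by (simp add: odd_kernel_def reg_kernel_def r1_def r2_def p_def)
  finally show ?thesis by (simp add: p_def)
qed

abbreviation approx_odd_eigenfunction :: "real \<Rightarrow> real \<Rightarrow> real \<Rightarrow> (real \<Rightarrow> real) \<Rightarrow> bool" where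
  "approx_odd_eigenfunction \<epsilon> \<mu> \<tau> f \<equiv> f \<in> borel_measurable borel \<and> (\<exists>F. \<forall>x. \<bar>f x\<bar> \<le> F * indicator {0<..<1} x) \<and> (\<forall>x. 0 \<le> f x) \<and>
     (\<integral>x. f x \<partial>lborel) = 1 \<and>
     (\<integral>x. \<bar>(kernel_mass s \<epsilon> TYPE(real) - \<mu>) * f x - indicator {0<..<1} x * odd_pot s \<epsilon> f x\<bar> \<partial>lborel) \<le> \<tau>"

text \<open>The order of the quantifiers is the point: \<mu> depends on \<epsilon> only and p on X
  only, while f may also depend on \<tau>. The bounds come from \<open>eigenvalue_lower\<close> and
  the trial function.\<close>

lemma odd_eigenfunction_family:
  obtains c\<^sub>0 \<epsilon>\<^sub>1 :: real and \<mu> :: "real \<Rightarrow> real" and c\<^sub>1 :: real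
  where "0 < c\<^sub>0" "0 < \<epsilon>\<^sub>1" "\<epsilon>\<^sub>1 \<le> 1"
    "\<And>\<epsilon>. 0 < \<epsilon> \<Longrightarrow> \<epsilon> < \<epsilon>\<^sub>1 \<Longrightarrow> c\<^sub>0 \<le> \<mu> \<epsilon> \<and> \<mu> \<epsilon> \<le> c\<^sub>1"
    "\<And>X. 0 \<le> X \<Longrightarrow> \<exists>p>0. \<forall>\<epsilon> \<tau>. 0 < \<epsilon> \<and> \<epsilon> < \<epsilon>\<^sub>1 \<and> 0 < \<tau> \<and> \<tau> \<le> 1 \<longrightarrow>
       (\<exists>f. approx_odd_eigenfunction \<epsilon> (\<mu> \<epsilon>) \<tau> f \<and> (\<forall>x. - X \<le> x \<and> x \<le> 0 \<longrightarrow> p \<le> odd_pot s \<epsilon> f x))"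
proof -
  \<comment> \<open>This h meets the hypothesis of \<open>mass_away\<close> for all eigenvalues up
    to \<open>C\<^sub>1 s\<close> and all \<tau> up to 1; the next one, \<open>h'\<close>, makes the
    mass of the kernel exceed \<open>C\<^sub>1 s\<close>.\<close>
  obtain h where h: "0 < h" "h < 1 / 2" "2 * (C\<^sub>1 s + 2) \<le> tail_low s h"
    using tail_low_unbounded[OF s0 s1] by blast
  obtain h' where h': "0 < h'" "h' < 1 / 2" "C\<^sub>1 s + 1 \<le> tail_low s h'"
    using tail_low_unbounded[OF s0 s1] by blast
  define \<epsilon>\<^sub>1 where "\<epsilon>\<^sub>1 = min h h'"
  have e1: "0 < \<epsilon>\<^sub>1" "\<epsilon>\<^sub>1 \<le> 1" using h h' by (auto simp: \<epsilon>\<^sub>1_def)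
  have "\<exists>\<mu>\<le>C\<^sub>1 s. \<forall>\<tau>>0. \<exists>f. approx_odd_eigenfunction \<epsilon> \<mu> \<tau> f" if "0 < \<epsilon>" "\<epsilon> < \<epsilon>\<^sub>1" for \<epsilon>
  proof (rule odd_eigenfunction[OF s0 s1 that(1)])
    have "tail_low s h' \<le> kernel_mass s \<epsilon> TYPE(real)" using that by (intro kernel_mass_ge[OF s0 s1]) (auto simp: \<epsilon>\<^sub>1_def)
    then show "C\<^sub>1 s < kernel_mass s \<epsilon> TYPE(real)" using h' by linarith
  qed
  then have "\<forall>\<epsilon>. \<exists>\<mu>. 0 < \<epsilon> \<and> \<epsilon> < \<epsilon>\<^sub>1 \<longrightarrow> \<mu> \<le> C\<^sub>1 s \<and> (\<forall>\<tau>>0. \<exists>f. approx_odd_eigenfunction \<epsilon> \<mu> \<tau> f)"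
    by blast
  from choice[OF this] obtain \<mu> where mu': "\<forall>\<epsilon>. 0 < \<epsilon> \<and> \<epsilon> < \<epsilon>\<^sub>1 \<longrightarrow> \<mu> \<epsilon> \<le> C\<^sub>1 s \<and> (\<forall>\<tau>>0. \<exists>f. approx_odd_eigenfunction \<epsilon> (\<mu> \<epsilon>) \<tau> f)"
    by (rule exE)
  have mu: "\<And>\<epsilon>. 0 < \<epsilon> \<Longrightarrow> \<epsilon> < \<epsilon>\<^sub>1 \<Longrightarrow> \<mu> \<epsilon> \<le> C\<^sub>1 s"
    "\<And>\<epsilon> \<tau>. 0 < \<epsilon> \<Longrightarrow> \<epsilon> < \<epsilon>\<^sub>1 \<Longrightarrow> 0 < \<tau> \<Longrightarrow> \<exists>f. approx_odd_eigenfunction \<epsilon> (\<mu> \<epsilon>) \<tau> f"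
    using mu' by blast+
  show ?thesis
  proof (rule that[of "tail_low s 1" \<epsilon>\<^sub>1 \<mu> "C\<^sub>1 s"])
    fix \<epsilon> assume e: "0 < \<epsilon>" "\<epsilon> < \<epsilon>\<^sub>1"
    \<comment> \<open>The eigenvalue does not depend on the tolerance of the eigenfunction, so the
      error term \<eta> can be sent to 0.\<close>
    have "tail_low s 1 \<le> \<mu> \<epsilon> + \<eta>" if eta: "0 < \<eta>" for \<eta>
    proof -
      obtain f F where f: "f \<in> borel_measurable borel" "\<And>x. \<bar>f x\<bar> \<le> F * indicator {0<..<1} x" "\<And>x. 0 \<le> f x"
        "(\<integral>x. f x \<partial>lborel) = 1"
        "(\<integral>x. \<bar>(kernel_mass s \<epsilon> TYPE(real) - \<mu> \<epsilon>) * f x - indicator {0<..<1} x * odd_pot s \<epsilon> f x\<bar> \<partial>lborel) \<le> \<eta> / 2"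
        using mu(2)[OF e, of "\<eta> / 2"] eta half_gt_zero by blast
      show ?thesis using eigenvalue_lower[OF s0 s1 e(1) f] e e1 by simp
    qed
    then show "tail_low s 1 \<le> \<mu> \<epsilon> \<and> \<mu> \<epsilon> \<le> C\<^sub>1 s" using mu(1)[OF e] field_le_epsilon by blast
  next
    fix X :: real assume X: "0 \<le> X"
    define q where "q = (1 + 2 * s) / 2 * ((2 + X)\<^sup>2 + 1) powr (- ((1 + 2 * s) / 2) - 1) * (4 * h)"
    have "0 < (2 + X)\<^sup>2 + 1" by (simp add: add_nonneg_pos)
    then have q: "0 < q" using s0 h unfolding q_def by (intro mult_pos_pos) auto
    show "\<exists>p>0. \<forall>\<epsilon> \<tau>. 0 < \<epsilon> \<and> \<epsilon> < \<epsilon>\<^sub>1 \<and> 0 < \<tau> \<and> \<tau> \<le> 1 \<longrightarrow>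
       (\<exists>f. approx_odd_eigenfunction \<epsilon> (\<mu> \<epsilon>) \<tau> f \<and> (\<forall>x. - X \<le> x \<and> x \<le> 0 \<longrightarrow> p \<le> odd_pot s \<epsilon> f x))"
    proof (intro exI[of _ "q / 2"] conjI allI impI)
      fix \<epsilon> \<tau> :: real assume e: "0 < \<epsilon> \<and> \<epsilon> < \<epsilon>\<^sub>1 \<and> 0 < \<tau> \<and> \<tau> \<le> 1"
      then obtain f where F: "approx_odd_eigenfunction \<epsilon> (\<mu> \<epsilon>) \<tau> f" using mu(2) by blast
      then obtain F where f: "f \<in> borel_measurable borel" "\<And>x. \<bar>f x\<bar> \<le> F * indicator {0<..<1} x" "\<And>x. 0 \<le> f x"
        "(\<integral>x. f x \<partial>lborel) = 1"
        "(\<integral>x. \<bar>(kernel_mass s \<epsilon> TYPE(real) - \<mu> \<epsilon>) * f x - indicator {0<..<1} x * odd_pot s \<epsilon> f x\<bar> \<partial>lborel) \<le> \<tau>"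
        by blast
      have e0: "0 < \<epsilon>" "\<epsilon> \<le> h" "\<epsilon> \<le> 1" "\<mu> \<epsilon> \<le> C\<^sub>1 s" using e e1 mu(1)[of \<epsilon>] by (auto simp: \<epsilon>\<^sub>1_def)
      have m: "1 / 2 \<le> (\<integral>y. f y * indicator {..1 - h} y \<partial>lborel)"
        using e0 h e by (intro mass_away[OF s0 s1 e0(1) f h(1)]) auto
      have "q / 2 \<le> odd_pot s \<epsilon> f x" if "- X \<le> x \<and> x \<le> 0" for x
      proof (rule odd_pot_lower[OF s0 s1 e0(1) f(1-4) m])
        show "q \<le> odd_kernel s \<epsilon> x y" if "0 < y" "y \<le> 1 - h" for y
          unfolding q_def using that \<open>- X \<le> x \<and> x \<le> 0\<close> X h e0 by (intro odd_kernel_lower) auto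
      qed (use that q in auto)
      then show "\<exists>f. approx_odd_eigenfunction \<epsilon> (\<mu> \<epsilon>) \<tau> f \<and> (\<forall>x. - X \<le> x \<and> x \<le> 0 \<longrightarrow> q / 2 \<le> odd_pot s \<epsilon> f x)"
        using F by blast
    qed (use q in simp)
  qed (use e1 tail_low_pos[OF s0 s1] in auto)
qed

text \<open>If U had little mass on the window G, the operator would be close to
  \<open>- \<mu>\<close> on average near T. Paired with a bump at T, however, the part of U inside G
  contributes at least \<open>- L\<close> times its mass, since the operator can be moved onto the
  bump; the part outside is seen only across distances of at least d and contributes at least
  \<open>- M * tail\<close> pointwise. This forces a lower bound for the mass on G.\<close>

lemma reg_lap_far_bump:
  fixes U :: "real \<Rightarrow> real" and T d M \<mu> \<nu> \<epsilon> :: real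
  assumes \<epsilon>: "0 < \<epsilon>" and U [measurable]: "U \<in> borel_measurable borel" and Ub: "\<And>x. 0 \<le> U x" "\<And>x. U x \<le> M"
    and d: "1 \<le> d"
  defines "G \<equiv> {T - 1 - d..T + 1 + d}"
    and "tail \<equiv> integral\<^sup>L lborel (\<lambda>z::real. indicator {z. d \<le> norm z} z * singular_kernel s z)"
    and "L \<equiv> 36 * integral\<^sup>L lborel (\<lambda>z::real. min 1 (norm z powr 2) * singular_kernel s z)"
  assumes eq: "\<And>t. t \<in> {T - 1..T + 1} \<Longrightarrow> reg_lap s \<epsilon> U t \<le> \<mu> * (U t - 1) + \<nu>" and mu: "0 \<le> \<mu>"
  shows "(\<mu> - \<nu> - M * tail) * integral\<^sup>L lborel (bump :: real \<Rightarrow> real) \<le> (\<mu> + L) * (\<integral>t. indicator G t * U t \<partial>lborel)"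
proof -
  have M: "0 \<le> M" using Ub order_trans by blast
  define \<zeta> where "\<zeta> t = bump (t - T)" for t :: real
  have chi: "0 \<le> \<zeta> t" "\<zeta> t \<le> 1" "\<bar>\<zeta> t\<bar> \<le> 1" for t using bump_le_1[of "t - T"] by (auto simp: \<zeta>_def)
  have chis: "t \<in> {T - 1..T + 1}" if "\<zeta> t \<noteq> 0" for t
  proof (rule ccontr)
    assume "t \<notin> {T - 1..T + 1}"
    then have "1 \<le> norm (t - T)" by auto
    then show False using that bump_eq_0[of "t - T"] unfolding \<zeta>_def by blast
  qed
  have chi_m [measurable]: "\<zeta> \<in> borel_measurable borel" unfolding \<zeta>_def by measurable
  have chi_i: "integrable lborel \<zeta>" unfolding \<zeta>_def by (subst lborel_integrable_diff_iff) (rule bump_integrable)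
  have chi_int: "(\<integral>t. \<zeta> t \<partial>lborel) = integral\<^sup>L lborel (bump :: real \<Rightarrow> real)" unfolding \<zeta>_def by (rule lborel_integral_diff)
  define U1 where "U1 t = indicator G t * U t" for t
  define U2 where "U2 t = indicator (- G) t * U t" for t
  have [measurable]: "G \<in> sets borel" by (simp add: G_def)
  have m1: "U1 \<in> borel_measurable borel" "U2 \<in> borel_measurable borel" unfolding U1_def U2_def by measurable
  have b1: "\<bar>U1 x\<bar> \<le> M" "\<bar>U2 x\<bar> \<le> M" for x using Ub[of x] M by (auto simp: U1_def U2_def indicator_def)
  have U1i: "integrable lborel U1"
    unfolding U1_def G_def
    by (rule integrable_mult_bounded(2)[OF integrable_indicator_Icc, where C = M]) (use Ub in auto)
  have tail_i: "integrable lborel (\<lambda>z::real. indicator {z. d \<le> norm z} z * singular_kernel s z)"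
  proof (rule Bochner_Integration.integrable_bound)
    show "integrable lborel (\<lambda>z::real. indicator {z. 1 \<le> norm z} z * singular_kernel s z)"
      using s0 by (intro integrable_norm_powr_far) auto
  qed (use d in \<open>auto simp: indicator_def\<close>)
  have split: "reg_lap s \<epsilon> U t = reg_lap s \<epsilon> U1 t + reg_lap s \<epsilon> U2 t" for t
  proof -
    have "reg_kernel s \<epsilon> (y - t) * U y = reg_kernel s \<epsilon> (y - t) * U1 y + reg_kernel s \<epsilon> (y - t) * U2 y" for y
      by (auto simp: U1_def U2_def indicator_def)
    moreover have "U t = U1 t + U2 t" by (auto simp: U1_def U2_def indicator_def)
    ultimately show ?thesis
      using kernel_times_bounded_integrable[OF s0 \<epsilon> m1(1) b1(1), of t] kernel_times_bounded_integrable[OF s0 \<epsilon> m1(2) b1(2), of t]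
      by (simp add: reg_lap_def algebra_simps)
  qed
  have far: "- (M * tail) \<le> reg_lap s \<epsilon> U2 t" if t: "t \<in> {T - 1..T + 1}" for t
  proof -
    have tt: "integrable lborel (\<lambda>y. indicator {z. d \<le> norm z} (y - t) * singular_kernel s (y - t))"
      by (subst lborel_integrable_diff_iff) (rule tail_i)
    have "(\<integral>y. reg_kernel s \<epsilon> (y - t) * U2 y \<partial>lborel) \<le>
      (\<integral>y. M * (indicator {z. d \<le> norm z} (y - t) * singular_kernel s (y - t)) \<partial>lborel)"
    proof (rule integral_mono[OF kernel_times_bounded_integrable[OF s0 \<epsilon> m1(2) b1(2)]])
      show "integrable lborel (\<lambda>y. M * (indicator {z. d \<le> norm z} (y - t) * singular_kernel s (y - t)))"
        using tt by simp
      fix y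
      show "reg_kernel s \<epsilon> (y - t) * U2 y \<le> M * (indicator {z. d \<le> norm z} (y - t) * singular_kernel s (y - t))"
      proof (cases "y \<in> G")
        case False
        then have "d \<le> norm (y - t)" "y - t \<noteq> 0" using t d by (auto simp: G_def)
        moreover have "reg_kernel s \<epsilon> (y - t) * U2 y \<le> singular_kernel s (y - t) * M"
          using reg_kernel_le[OF s0, of "y - t" \<epsilon>] \<open>y - t \<noteq> 0\<close> b1(2)[of y] Ub(1)[of y] M
          by (intro mult_mono) (auto simp: U2_def)
        ultimately show ?thesis by (simp add: mult.commute)
      qed (use M in \<open>simp add: U2_def\<close>)
    qed
    also have "\<dots> = M * tail"
      using lborel_integral_diff[of "\<lambda>z. indicator {z. d \<le> norm z} z * singular_kernel s z" t] by (simp add: tail_def)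
    finally have "(\<integral>y. reg_kernel s \<epsilon> (y - t) * U2 y \<partial>lborel) \<le> M * tail" .
    moreover have "U2 t = 0" using t d by (auto simp: U2_def G_def)
    ultimately show ?thesis by (simp add: reg_lap_def)
  qed
  have Ui: "integrable lborel (\<lambda>t. \<zeta> t * U t)" by (rule integrable_mult_bounded(2)[OF chi_i, where C = M]) (use Ub in auto)
  have pw: "\<zeta> t * reg_lap s \<epsilon> U1 t \<le> \<mu> * (\<zeta> t * U t) + (\<nu> + M * tail - \<mu>) * \<zeta> t" for t
  proof (cases "\<zeta> t = 0")
    case False
    then have t: "t \<in> {T - 1..T + 1}" by (rule chis)
    have "reg_lap s \<epsilon> U1 t \<le> \<mu> * (U t - 1) + \<nu> + M * tail" using eq[OF t] far[OF t] split[of t] by linarith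
    then have "\<zeta> t * reg_lap s \<epsilon> U1 t \<le> \<zeta> t * (\<mu> * (U t - 1) + \<nu> + M * tail)" using chi by (intro mult_left_mono) auto
    then show ?thesis by (simp add: algebra_simps)
  qed simp
  note sa = reg_lap_selfadjoint[OF s0 \<epsilon> chi_i m1(1) b1(1)]
  have "- L * (\<integral>t. U1 t \<partial>lborel) = (\<integral>t. - L * U1 t \<partial>lborel)" by simp
  also have "\<dots> \<le> (\<integral>t. U1 t * reg_lap s \<epsilon> \<zeta> t \<partial>lborel)"
  proof (rule integral_mono[OF _ sa(2)])
    show "integrable lborel (\<lambda>t. - L * U1 t)" using U1i by simp
    fix t
    have "\<bar>\<zeta> (t + z) + \<zeta> (t - z) - 2 * \<zeta> t\<bar> \<le> 36 * min 1 ((norm z)\<^sup>2)" for z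
      using bump_second_difference[of "t - T" z] by (simp add: \<zeta>_def algebra_simps)
    then have "\<bar>reg_lap s \<epsilon> \<zeta> t\<bar> \<le> L" unfolding L_def by (rule reg_lap_bound[OF s0 \<epsilon> chi_m chi(3) s1])
    then have "U1 t * - L \<le> U1 t * reg_lap s \<epsilon> \<zeta> t" using Ub by (intro mult_left_mono) (auto simp: U1_def)
    then show "- L * U1 t \<le> U1 t * reg_lap s \<epsilon> \<zeta> t" by (simp add: mult.commute)
  qed
  also have "\<dots> = (\<integral>t. \<zeta> t * reg_lap s \<epsilon> U1 t \<partial>lborel)" by (rule sa(3)[symmetric])
  also have "\<dots> \<le> (\<integral>t. \<mu> * (\<zeta> t * U t) + (\<nu> + M * tail - \<mu>) * \<zeta> t \<partial>lborel)"
    using Ui chi_i by (intro integral_mono[OF sa(1) _ pw]) auto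
  also have "\<dots> = \<mu> * (\<integral>t. \<zeta> t * U t \<partial>lborel) + (\<nu> + M * tail - \<mu>) * (\<integral>t. \<zeta> t \<partial>lborel)" using Ui chi_i by simp
  also have "\<mu> * (\<integral>t. \<zeta> t * U t \<partial>lborel) \<le> \<mu> * (\<integral>t. U1 t \<partial>lborel)"
  proof (intro mult_left_mono integral_mono[OF Ui U1i] mu)
    fix t show "\<zeta> t * U t \<le> U1 t"
    proof (cases "\<zeta> t = 0")
      case False
      then have "t \<in> G" using chis[OF False] d by (auto simp: G_def)
      then show ?thesis using chi[of t] Ub[of t] by (simp add: U1_def mult_left_le_one_le)
    qed (use Ub in \<open>simp add: U1_def\<close>)
  qed
  finally show ?thesis unfolding chi_int U1_def[symmetric] by (simp add: algebra_simps)
qed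

text \<open>U is compared with its reflection in \<open>1 + \<delta>\<close>, and subtracting the
  equations at y and \<open>2 - y\<close> removes the constant. The terms on the right are, in
  order: the error of the equation at two points, the exchange of the eigenvalues, the error of the
  eigenfunction, and \<eta> times the flux into \<open>x \<le> 0\<close>. On the left stand the
  reflected values from \<open>{- X..0}\<close>, where the weight is at least p.\<close>

lemma moving_plane_bound:
  fixes U :: "real \<Rightarrow> real"
  assumes \<epsilon>: "0 < \<epsilon>" and U [measurable]: "U \<in> borel_measurable borel" and Ub: "\<And>x. 0 \<le> U x" "\<And>x. U x \<le> M"
    and f: "approx_odd_eigenfunction \<epsilon> \<mu>' \<tau> f" and p: "\<And>x. - X \<le> x \<Longrightarrow> x \<le> 0 \<Longrightarrow> p \<le> odd_pot s \<epsilon> f x" "0 < p"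
    and \<delta>: "0 \<le> \<delta>" "\<delta> \<le> 1" and small: "\<And>x. x \<le> \<delta> \<Longrightarrow> U x \<le> \<eta>" "0 \<le> \<eta>"
    and eq: "\<And>t. t \<in> {\<delta>..\<delta> + 2} \<Longrightarrow> \<bar>reg_lap s \<epsilon> U t - \<mu> * (U t - 1)\<bar> \<le> \<nu>"
  shows "p * (\<integral>t. indicator {3..2 + X} t * U t \<partial>lborel) \<le> 2 * \<nu> + 2 * M * \<bar>\<mu> - \<mu>'\<bar> + 2 * M * \<tau> + \<eta> * (\<mu>' + 2 * \<tau>)"
proof -
  obtain F where F: "\<And>x. \<bar>f x\<bar> \<le> F * indicator {0<..<1} x" using f by blast
  have f': "f \<in> borel_measurable borel" "\<And>x. 0 \<le> f x" "(\<integral>x. f x \<partial>lborel) = 1"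
    "(\<integral>x. \<bar>(kernel_mass s \<epsilon> TYPE(real) - \<mu>') * f x - indicator {0<..<1} x * odd_pot s \<epsilon> f x\<bar> \<partial>lborel) \<le> \<tau>"
    using f by blast+
  note ff = f'(1) F f'(2,3)
  have fi: "integrable lborel f" by (rule f_integrable[OF s0 s1 \<epsilon> ff])
  have fs: "0 < x \<and> x < 1" if "f x \<noteq> 0" for x using F[of x] that by (cases "0 < x \<and> x < 1") auto
  \<comment> \<open>The shift by \<delta> puts the support of the eigenfunction where the equation
    is available; the price is that the function to its left is small instead of 0.\<close>
  define V where "V x = U (\<delta> + x)" for x
  have V: "V \<in> borel_measurable borel" "\<And>x. \<bar>V x\<bar> \<le> M" using Ub by (auto simp: V_def[abs_def])
  have M: "0 \<le> M" using Ub order_trans by blast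
  let ?D = "odd_pot s \<epsilon> f" let ?W = "\<lambda>x. V x - V (2 - x)"
  note A = odd_test_approximate[OF s0 s1 \<epsilon> ff f'(4) V]
  note B = odd_test_identity[OF s0 s1 \<epsilon> ff V]
  have Di: "integrable lborel ?D" by (rule odd_pot_integrable[OF s0 s1 \<epsilon> ff])
  have Dn: "0 \<le> ?D x" if "x \<le> 1" for x using odd_pot_nonneg[OF s0 s1 \<epsilon> ff that] .
  have r: "reg_lap s \<epsilon> V x = reg_lap s \<epsilon> U (\<delta> + x)" for x
    unfolding V_def by (rule reg_lap_shift[OF s0 \<epsilon>])
  let ?R = "\<lambda>y. reg_lap s \<epsilon> V y - reg_lap s \<epsilon> V (2 - y)"
  have "\<bar>(\<integral>y. f y * ?R y \<partial>lborel) - \<mu> * (\<integral>y. f y * ?W y \<partial>lborel)\<bar> = \<bar>(\<integral>y. f y * ?R y - \<mu> * (f y * ?W y) \<partial>lborel)\<bar>"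
    using B(1,2) by simp
  also have "\<dots> \<le> (\<integral>y. \<bar>f y * ?R y - \<mu> * (f y * ?W y)\<bar> \<partial>lborel)" by (rule integral_abs_bound)
  also have "\<dots> \<le> (\<integral>y. 2 * \<nu> * f y \<partial>lborel)"
  proof (rule integral_mono)
    show "integrable lborel (\<lambda>y. \<bar>f y * ?R y - \<mu> * (f y * ?W y)\<bar>)" using B(1,2) by (intro integrable_abs Bochner_Integration.integrable_diff) auto
    fix y
    show "\<bar>f y * ?R y - \<mu> * (f y * ?W y)\<bar> \<le> 2 * \<nu> * f y"
    proof (cases "f y = 0")
      case False
      then have y: "0 < y" "y < 1" using fs by auto
      have "\<bar>reg_lap s \<epsilon> V y - \<mu> * (V y - 1)\<bar> \<le> \<nu>" "\<bar>reg_lap s \<epsilon> V (2 - y) - \<mu> * (V (2 - y) - 1)\<bar> \<le> \<nu>"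
        unfolding r V_def using y by (auto intro!: eq)
      then have "\<bar>?R y - \<mu> * ?W y\<bar> \<le> 2 * \<nu>" by (simp add: algebra_simps)
      then have "f y * \<bar>?R y - \<mu> * ?W y\<bar> \<le> f y * (2 * \<nu>)" using f'(2) by (intro mult_left_mono) auto
      moreover have "\<bar>f y * ?R y - \<mu> * (f y * ?W y)\<bar> = f y * \<bar>?R y - \<mu> * ?W y\<bar>"
      proof -
        have "f y * ?R y - \<mu> * (f y * ?W y) = f y * (?R y - \<mu> * ?W y)" by (simp add: algebra_simps)
        then show ?thesis using f'(2)[of y] by (simp only: abs_mult abs_of_nonneg)
      qed
      ultimately show ?thesis by (simp add: mult.commute)
    qed simp
  qed (use fi in simp)
  also have "\<dots> = 2 * \<nu>" using f'(3) by simp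
  finally have 1: "\<bar>(\<integral>y. f y * ?R y \<partial>lborel) - \<mu> * (\<integral>y. f y * ?W y \<partial>lborel)\<bar> \<le> 2 * \<nu>" .
  have 2: "\<bar>(\<mu> - \<mu>') * (\<integral>y. f y * ?W y \<partial>lborel)\<bar> \<le> 2 * M * \<bar>\<mu> - \<mu>'\<bar>"
  proof -
    have "\<bar>(\<integral>y. f y * ?W y \<partial>lborel)\<bar> \<le> (\<integral>y. \<bar>f y * ?W y\<bar> \<partial>lborel)" by (rule integral_abs_bound)
    also have "\<dots> \<le> (\<integral>y. 2 * M * f y \<partial>lborel)"
    proof (rule integral_mono)
      show "\<bar>f y * ?W y\<bar> \<le> 2 * M * f y" for y
      proof -
        have "\<bar>?W y\<bar> \<le> 2 * M" using V(2)[of y] V(2)[of "2 - y"] by linarith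
        then have "f y * \<bar>?W y\<bar> \<le> f y * (2 * M)" using f'(2) by (intro mult_left_mono) auto
        then show ?thesis using f'(2)[of y] by (simp add: abs_mult mult.commute)
      qed
    qed (use B(2) fi in auto)
    finally have "\<bar>(\<integral>y. f y * ?W y \<partial>lborel)\<bar> \<le> 2 * M" using f'(3) by simp
    then have "\<bar>\<mu> - \<mu>'\<bar> * \<bar>(\<integral>y. f y * ?W y \<partial>lborel)\<bar> \<le> \<bar>\<mu> - \<mu>'\<bar> * (2 * M)" by (intro mult_left_mono) auto
    then show ?thesis by (simp add: abs_mult mult.commute)
  qed
  have 3: "- (\<integral>x. indicator {..0} x * (?W x * ?D x) \<partial>lborel) \<le> 2 * \<nu> + 2 * M * \<bar>\<mu> - \<mu>'\<bar> + 2 * M * \<tau>"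
  proof -
    have "(\<mu> - \<mu>') * (\<integral>y. f y * ?W y \<partial>lborel) = \<mu> * (\<integral>y. f y * ?W y \<partial>lborel) - \<mu>' * (\<integral>y. f y * ?W y \<partial>lborel)" by (rule left_diff_distrib)
    then show ?thesis using 1 2 A(2) by linarith
  qed
  have Dl: "integrable lborel (\<lambda>x. indicator {..0} x * ?D x)"
    by (rule integrable_mult_bounded(1)[OF Di, where C = 1]) (auto simp: indicator_def)
  have Ui: "integrable lborel (\<lambda>x. indicator {- X..0} x * V (2 - x))"
    by (rule integrable_mult_bounded(2)[OF integrable_indicator_Icc, where C = M]) (use V in auto)
  have "p * (\<integral>x. indicator {- X..0} x * V (2 - x) \<partial>lborel) - \<eta> * (\<integral>x. indicator {..0} x * ?D x \<partial>lborel)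
     = (\<integral>x. p * (indicator {- X..0} x * V (2 - x)) - \<eta> * (indicator {..0} x * ?D x) \<partial>lborel)"
    using Dl Ui by simp
  also have "\<dots> \<le> (\<integral>x. - (indicator {..0} x * (?W x * ?D x)) \<partial>lborel)"
  proof (rule integral_mono)
    show "integrable lborel (\<lambda>x. p * (indicator {- X..0} x * V (2 - x)) - \<eta> * (indicator {..0} x * ?D x))"
      using Dl Ui by simp
    show "integrable lborel (\<lambda>x. - (indicator {..0} x * (?W x * ?D x)))" using A(1) by simp
    fix x :: real
    show "p * (indicator {- X..0} x * V (2 - x)) - \<eta> * (indicator {..0} x * ?D x) \<le> - (indicator {..0} x * (?W x * ?D x))"
    proof (cases "x \<le> 0")
      case True
      have "V x * ?D x \<le> \<eta> * ?D x" using True small(1)[of "\<delta> + x"] Dn[of x] by (intro mult_right_mono) (auto simp: V_def)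
      moreover have "p * (indicator {- X..0} x * V (2 - x)) \<le> ?D x * V (2 - x)"
      proof (cases "- X \<le> x")
        case xx: True
        then show ?thesis using p(1)[of x] True Ub(1) by (auto intro!: mult_right_mono simp: V_def)
      next
        case False
        then show ?thesis using Dn[of x] True Ub(1) by (simp add: V_def)
      qed
      ultimately show ?thesis using True by (simp add: algebra_simps)
    qed (auto simp: indicator_def)
  qed
  also have "\<dots> = - (\<integral>x. indicator {..0} x * (?W x * ?D x) \<partial>lborel)" by simp
  finally have 4: "p * (\<integral>x. indicator {- X..0} x * V (2 - x) \<partial>lborel) - \<eta> * (\<integral>x. indicator {..0} x * ?D x \<partial>lborel)
     \<le> 2 * \<nu> + 2 * M * \<bar>\<mu> - \<mu>'\<bar> + 2 * M * \<tau>" using 3 by linarith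
  have 5: "\<eta> * (\<integral>x. indicator {..0} x * ?D x \<partial>lborel) \<le> \<eta> * (\<mu>' + 2 * \<tau>)"
    using flux_le[OF s0 s1 \<epsilon> ff f'(4)] small(2) by (intro mult_left_mono) auto
  \<comment> \<open>The reflected interval is \<open>{2 + \<delta>..2 + \<delta> + X}\<close>; the
    endpoints 3 and \<open>2 + X\<close> serve every \<delta> between 0 and 1.\<close>
  have 6: "(\<integral>t. indicator {3..2 + X} t * U t \<partial>lborel) \<le> (\<integral>x. indicator {- X..0} x * V (2 - x) \<partial>lborel)"
  proof -
    have "(\<integral>x. indicator {- X..0} x * V (2 - x) \<partial>lborel) = (\<integral>x. indicator {2 + \<delta>..2 + \<delta> + X} (2 + \<delta> - x) * U (2 + \<delta> - x) \<partial>lborel)"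
      by (intro Bochner_Integration.integral_cong) (auto simp: indicator_def V_def algebra_simps)
    also have "\<dots> = (\<integral>t. indicator {2 + \<delta>..2 + \<delta> + X} t * U t \<partial>lborel)" by (rule lborel_integral_reflect)
    also have "\<dots> \<ge> (\<integral>t. indicator {3..2 + X} t * U t \<partial>lborel)"
      by (rule integral_mono; (rule integrable_mult_bounded(2)[OF integrable_indicator_Icc, where C = M])?)
        (use Ub \<delta> in \<open>auto simp: indicator_def\<close>)
    finally show ?thesis .
  qed
  have "p * (\<integral>t. indicator {3..2 + X} t * U t \<partial>lborel) \<le> p * (\<integral>x. indicator {- X..0} x * V (2 - x) \<partial>lborel)"
    using 6 p(2) by (intro mult_left_mono) auto
  then show ?thesis using 4 5 by linarith
qed

text \<open>For \<mu> take a limit of the eigenvalues along a sequence of \<epsilon> tending to 0.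
  On the window \<open>{3..5 + 2 * d}\<close> the mass of U is bounded above by
  \<open>moving_plane_bound\<close>, proportionally to \<nu>, and below by
  \<open>reg_lap_far_bump\<close>; for \<nu> small in terms of M the two bounds collide.\<close>

lemma no_bounded_profile: "\<exists>\<mu>>0. \<forall>M>0. \<exists>\<nu>>0. \<forall>U. \<not> approx_half_line_solution s \<mu> M \<nu> U"
proof -
  obtain c\<^sub>0 c\<^sub>1 \<epsilon>\<^sub>1 m where fam: "0 < c\<^sub>0" "0 < \<epsilon>\<^sub>1" "\<epsilon>\<^sub>1 \<le> 1"
    "\<And>\<epsilon>. 0 < \<epsilon> \<Longrightarrow> \<epsilon> < \<epsilon>\<^sub>1 \<Longrightarrow> c\<^sub>0 \<le> m \<epsilon> \<and> m \<epsilon> \<le> c\<^sub>1"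
    "\<And>X. 0 \<le> X \<Longrightarrow> \<exists>p>0. \<forall>\<epsilon> \<tau>. 0 < \<epsilon> \<and> \<epsilon> < \<epsilon>\<^sub>1 \<and> 0 < \<tau> \<and> \<tau> \<le> 1 \<longrightarrow>
       (\<exists>f. approx_odd_eigenfunction \<epsilon> (m \<epsilon>) \<tau> f \<and> (\<forall>x. - X \<le> x \<and> x \<le> 0 \<longrightarrow> p \<le> odd_pot s \<epsilon> f x))"
  proof -
    show ?thesis by (rule odd_eigenfunction_family) (fact that)
  qed
  define \<epsilon> where "\<epsilon> n = \<epsilon>\<^sub>1 / real (n + 2)" for n
  have e: "0 < \<epsilon> n" "\<epsilon> n < \<epsilon>\<^sub>1" for n using fam(2) by (auto simp: \<epsilon>_def field_simps add_pos_nonneg)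
  have "\<forall>n. m (\<epsilon> n) \<in> {c\<^sub>0..c\<^sub>1}" using fam(4) e by auto
  then obtain \<mu> r where mu: "\<mu> \<in> {c\<^sub>0..c\<^sub>1}" and r: "strict_mono r" "((\<lambda>n. m (\<epsilon> n)) \<circ> r) \<longlonglongrightarrow> \<mu>"
    using compact_Icc[of c\<^sub>0 c\<^sub>1, unfolded compact_def, rule_format, of "\<lambda>n. m (\<epsilon> n)"] by blast
  have mu0: "0 < \<mu>" using mu fam(1) by auto
  have elim: "\<epsilon> \<longlonglongrightarrow> 0"
    unfolding \<epsilon>_def using LIMSEQ_ignore_initial_segment[OF lim_const_over_n[of \<epsilon>\<^sub>1], of 2] by simp
  \<comment> \<open>Only along the subsequence are the eigenvalues close to \<mu>, so the later
    \<epsilon> is selected from it.\<close>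
  have pick: "\<exists>n. \<epsilon> n < e' \<and> \<bar>\<mu> - m (\<epsilon> n)\<bar> < q" if "0 < e'" "0 < q" for e' q
  proof -
    have "(\<epsilon> \<circ> r) \<longlonglongrightarrow> 0" using elim r(1) by (rule LIMSEQ_subseq_LIMSEQ)
    then have "\<forall>\<^sub>F n in sequentially. (\<epsilon> \<circ> r) n < e'" using that(1) by (rule order_tendstoD(2))
    moreover have "\<forall>\<^sub>F n in sequentially. dist (((\<lambda>n. m (\<epsilon> n)) \<circ> r) n) \<mu> < q" using r(2) that by (intro tendstoD)
    ultimately have "\<forall>\<^sub>F n in sequentially. \<epsilon> (r n) < e' \<and> \<bar>\<mu> - m (\<epsilon> (r n))\<bar> < q"
      by eventually_elim (auto simp: dist_real_def)
    then show ?thesis by (auto simp: eventually_sequentially)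
  qed
  define c where "c = integral\<^sup>L lborel (bump :: real \<Rightarrow> real)"
  have c: "0 < c" unfolding c_def by (rule bump_integral_pos)
  define L where "L = 36 * integral\<^sup>L lborel (\<lambda>z::real. min 1 (norm z powr 2) * singular_kernel s z)"
  have L: "0 \<le> L" unfolding L_def by (intro mult_nonneg_nonneg integral_nonneg_AE AE_I2) auto
  show ?thesis
  proof (rule exI[of _ \<mu>], intro conjI allI impI mu0)
    fix M :: real assume M: "0 < M"
    \<comment> \<open>In the lower bound half of \<mu> has to survive: \<open>M * tail\<close> and
      \<nu> may take a quarter each.\<close>
    obtain d where d: "1 \<le> d" "integral\<^sup>L lborel (\<lambda>z::real. indicator {z. d \<le> norm z} z * singular_kernel s z) \<le> \<mu> / (4 * M)"
    proof -
      have "0 < \<mu> / (4 * M)" using mu0 M by simp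
      from norm_powr_tail_vanishes[OF s0 this, where 'a = real] show ?thesis using that by blast
    qed
    define tail where "tail = integral\<^sup>L lborel (\<lambda>z::real. indicator {z. d \<le> norm z} z * singular_kernel s z)"
    have tail: "M * tail \<le> \<mu> / 4" using d(2) M by (simp add: tail_def field_simps)
    \<comment> \<open>The centre \<open>T = 4 + d\<close> makes the window of
      \<open>reg_lap_far_bump\<close> start at 3, and \<open>X = 3 + 2 * d\<close> makes
      \<open>2 + X\<close> its right end.\<close>
    obtain p where p: "0 < p" "\<And>\<epsilon> \<tau>. 0 < \<epsilon> \<Longrightarrow> \<epsilon> < \<epsilon>\<^sub>1 \<Longrightarrow> 0 < \<tau> \<Longrightarrow> \<tau> \<le> 1 \<Longrightarrow>
       (\<exists>f. approx_odd_eigenfunction \<epsilon> (m \<epsilon>) \<tau> f \<and> (\<forall>x. - (3 + 2 * d) \<le> x \<and> x \<le> 0 \<longrightarrow> p \<le> odd_pot s \<epsilon> f x))"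
    proof -
      have "0 \<le> 3 + 2 * d" using d by simp
      from fam(5)[OF this] show ?thesis by (elim exE conjE) (rule that; blast)
    qed
    \<comment> \<open>With I the mass on the window, the upper bound will be
      \<open>p * I \<le> 5 * \<nu>\<close> and the lower one
      \<open>\<mu> / 2 * c \<le> (\<mu> + L) * I\<close>. They are incompatible once the 20 here is
      any number above 10.\<close>
    define \<nu> where "\<nu> = min (\<mu> / 4) (\<mu> * c * p / (20 * (\<mu> + L)))"
    have nu: "0 < \<nu>" "\<nu> \<le> \<mu> / 4" "20 * (\<mu> + L) * \<nu> \<le> \<mu> * c * p"
    proof -
      have "0 < \<mu> + L" using mu0 L by simp
      moreover have "\<nu> \<le> \<mu> * c * p / (20 * (\<mu> + L))" by (simp add: \<nu>_def)
      ultimately show "20 * (\<mu> + L) * \<nu> \<le> \<mu> * c * p" by (simp add: field_simps)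
      show "0 < \<nu>" using mu0 L c p by (auto simp: \<nu>_def intro!: divide_pos_pos)
      show "\<nu> \<le> \<mu> / 4" unfolding \<nu>_def by (rule min.cobounded1)
    qed
    have "\<not> approx_half_line_solution s \<mu> M \<nu> U" for U
    proof
      assume "approx_half_line_solution s \<mu> M \<nu> U"
      then have U: "U \<in> borel_measurable borel" and Ub: "\<forall>x. 0 \<le> U x \<and> U x \<le> M"
        and small: "\<forall>\<eta>>0. \<exists>\<delta>>0. \<forall>x\<le>\<delta>. U x \<le> \<eta>"
        and eq: "\<forall>a b. 0 < a \<longrightarrow> (\<exists>\<epsilon>\<^sub>0>0. \<forall>\<epsilon>. 0 < \<epsilon> \<and> \<epsilon> < \<epsilon>\<^sub>0 \<longrightarrow> (\<forall>t\<in>{a..b}. \<bar>reg_lap s \<epsilon> U t - \<mu> * (U t - 1)\<bar> \<le> \<nu>))"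
        unfolding approx_half_line_solution_def by - (elim conjE, assumption)+
      have c1: "0 < c\<^sub>1" using mu fam(1) by auto
      \<comment> \<open>This makes the boundary term
        \<open>\<eta> * (m (\<epsilon> n) + 2 * \<tau>)\<close> at most \<nu>, for every eigenvalue
        up to \<open>c\<^sub>1\<close> and \<tau> up to 1.\<close>
      define \<eta> where "\<eta> = \<nu> / (c\<^sub>1 + 2)"
      have eta: "0 < \<eta>" using nu c1 by (simp add: \<eta>_def)
      obtain \<delta>' where d': "0 < \<delta>'" "\<And>x. x \<le> \<delta>' \<Longrightarrow> U x \<le> \<eta>" using small eta by blast
      define \<delta> where "\<delta> = min \<delta>' 1"
      have del: "0 < \<delta>" "\<delta> \<le> 1" "\<And>x. x \<le> \<delta> \<Longrightarrow> U x \<le> \<eta>" using d' by (auto simp: \<delta>_def)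
      obtain ea where ea: "0 < ea" "\<And>\<epsilon> t. 0 < \<epsilon> \<Longrightarrow> \<epsilon> < ea \<Longrightarrow> t \<in> {\<delta>..\<delta> + 2} \<Longrightarrow> \<bar>reg_lap s \<epsilon> U t - \<mu> * (U t - 1)\<bar> \<le> \<nu>"
        using eq[rule_format, OF del(1), of "\<delta> + 2"] by blast
      obtain eb where eb: "0 < eb" "\<And>\<epsilon> t. 0 < \<epsilon> \<Longrightarrow> \<epsilon> < eb \<Longrightarrow> t \<in> {4 + d - 1..4 + d + 1} \<Longrightarrow> \<bar>reg_lap s \<epsilon> U t - \<mu> * (U t - 1)\<bar> \<le> \<nu>"
        using eq[rule_format, of "4 + d - 1" "4 + d + 1"] d by auto
      define \<tau> where "\<tau> = min 1 (\<nu> / (2 * M))"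
      have tau: "0 < \<tau>" "\<tau> \<le> 1" "2 * M * \<tau> \<le> \<nu>"
      proof -
        have "\<tau> \<le> \<nu> / (2 * M)" by (simp add: \<tau>_def)
        then show "2 * M * \<tau> \<le> \<nu>" using M by (simp add: field_simps)
      qed (use nu M in \<open>auto simp: \<tau>_def\<close>)
      obtain n where n: "\<epsilon> n < min ea eb" "\<bar>\<mu> - m (\<epsilon> n)\<bar> < \<nu> / (2 * M)"
        using pick[of "min ea eb" "\<nu> / (2 * M)"] ea eb nu M by auto
      obtain f where f: "approx_odd_eigenfunction (\<epsilon> n) (m (\<epsilon> n)) \<tau> f" "\<And>x. - (3 + 2 * d) \<le> x \<Longrightarrow> x \<le> 0 \<Longrightarrow> p \<le> odd_pot s (\<epsilon> n) f x"
        using p(2)[OF e tau(1,2)] by blast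
      define I where "I = (\<integral>t. indicator {3..5 + 2 * d} t * U t \<partial>lborel)"
      have "p * (\<integral>t. indicator {3..2 + (3 + 2 * d)} t * U t \<partial>lborel)
        \<le> 2 * \<nu> + 2 * M * \<bar>\<mu> - m (\<epsilon> n)\<bar> + 2 * M * \<tau> + \<eta> * (m (\<epsilon> n) + 2 * \<tau>)"
        using Ub n del eta by (intro moving_plane_bound[OF e(1) U _ _ f p(1)] ea(2)) (auto intro: e)
      moreover have "2 * M * \<bar>\<mu> - m (\<epsilon> n)\<bar> \<le> \<nu>" using n(2) M by (simp add: field_simps)
      moreover have "\<eta> * (m (\<epsilon> n) + 2 * \<tau>) \<le> \<nu>"
      proof -
        have "\<eta> * (m (\<epsilon> n) + 2 * \<tau>) \<le> \<eta> * (c\<^sub>1 + 2)" using fam(4)[OF e] tau eta by (intro mult_left_mono add_mono) auto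
        then show ?thesis using c1 by (simp add: \<eta>_def)
      qed
      moreover have "2 + (3 + 2 * d) = 5 + 2 * d" by simp
      ultimately have 1: "p * I \<le> 5 * \<nu>" using tau unfolding I_def by simp
      have up: "reg_lap s (\<epsilon> n) U t \<le> \<mu> * (U t - 1) + \<nu>" if "t \<in> {4 + d - 1..4 + d + 1}" for t
        using eb(2)[OF e(1) _ that] n by fastforce
      have "(\<mu> - \<nu> - M * tail) * c \<le> (\<mu> + L) * (\<integral>t. indicator {4 + d - 1 - d..4 + d + 1 + d} t * U t \<partial>lborel)"
        unfolding tail_def c_def L_def
        using Ub mu0 by (intro reg_lap_far_bump[OF e(1) U _ _ d(1) up]) auto
      moreover have "{4 + d - 1 - d..4 + d + 1 + d} = {3..5 + 2 * d}" by simp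
      ultimately have 2: "(\<mu> - \<nu> - M * tail) * c \<le> (\<mu> + L) * I" by (simp only: I_def)
      have "\<mu> / 2 * c \<le> (\<mu> - \<nu> - M * tail) * c" using nu tail c by (intro mult_right_mono) auto
      then have "\<mu> / 2 * c * p \<le> (\<mu> + L) * I * p" using 2 p(1) by (intro mult_right_mono) auto
      also have "\<dots> = (\<mu> + L) * (p * I)" by simp
      also have "\<dots> \<le> (\<mu> + L) * (5 * \<nu>)" using 1 mu0 L by (intro mult_left_mono) auto
      also have "\<dots> = 20 * (\<mu> + L) * \<nu> / 4" by simp
      also have "\<dots> \<le> \<mu> * c * p / 4" by (intro divide_right_mono nu(3)) simp
      finally have "\<mu> * c * p \<le> 0" by simp
      moreover have "0 < \<mu> * c * p" using mu0 c p by simp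
      ultimately show False by simp
    qed
    then show "\<exists>\<nu>>0. \<forall>U. \<not> approx_half_line_solution s \<mu> M \<nu> U" using nu(1) by blast
  qed
qed

end

section \<open>Uniform convergence of the regularised operators\<close>

text \<open>The mean value theorem for the sum of u at the points x plus and minus t times z, as a
  function of t, leaves a difference of gradients at two symmetric points, applied to z. Expanding z
  in the basis reduces it to partial derivatives and costs the factor
  \<open>DIM('a)\<close>.\<close>

lemma second_difference_of_hoelder_gradient:
  fixes u :: "'a::euclidean_space \<Rightarrow> real" and C \<rho> \<gamma> :: real
  assumes d: "\<And>y. y \<in> cball x \<rho> \<Longrightarrow> u differentiable (at y)"
    and h: "\<And>b z. b \<in> Basis \<Longrightarrow> norm z \<le> \<rho> \<Longrightarrow>
      \<bar>frechet_derivative u (at (x + z)) b - frechet_derivative u (at (x - z)) b\<bar> \<le> C * norm z powr \<gamma>"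
    and \<gamma>: "0 \<le> \<gamma>" and C: "0 \<le> C" and z: "norm z \<le> \<rho>" "z \<noteq> 0"
  shows "\<bar>2 * u x - u (x + z) - u (x - z)\<bar> \<le> DIM('a) * C * norm z powr (1 + \<gamma>)"
proof -
  let ?D = "\<lambda>y. frechet_derivative u (at y)"
  have der: "((\<lambda>t. u (x + t *\<^sub>R v)) has_real_derivative ?D (x + t *\<^sub>R v) v) (at t)"
    if "norm v = norm z" "0 \<le> t" "t \<le> 1" for v t
  proof -
    have "norm (t *\<^sub>R v) = t * norm z" using that by simp
    also have "\<dots> \<le> 1 * norm z" using that by (intro mult_right_mono) auto
    finally have "norm (t *\<^sub>R v) \<le> \<rho>" using z(1) by simp
    then have "u differentiable (at (x + t *\<^sub>R v))" by (intro d) (simp add: dist_norm)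
    then have D: "(u has_derivative ?D (x + t *\<^sub>R v)) (at (x + t *\<^sub>R v))" by (simp add: frechet_derivative_works)
    have "((\<lambda>t. x + t *\<^sub>R v) has_derivative (\<lambda>h. h *\<^sub>R v)) (at t)" by (auto intro!: derivative_eq_intros)
    then have "((\<lambda>t. u (x + t *\<^sub>R v)) has_derivative (\<lambda>h. ?D (x + t *\<^sub>R v) (h *\<^sub>R v))) (at t)"
      using D by (rule has_derivative_compose)
    moreover have "(\<lambda>h. ?D (x + t *\<^sub>R v) (h *\<^sub>R v)) = (*) (?D (x + t *\<^sub>R v) v)"
      using has_derivative_linear[OF D] by (auto simp: linear_cmul mult.commute)
    ultimately show ?thesis by (simp add: has_field_derivative_def)
  qed
  define \<phi> where "\<phi> t = u (x + t *\<^sub>R z) + u (x + t *\<^sub>R (- z))" for t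
  have "\<exists>t. 0 < t \<and> t < 1 \<and> \<phi> 1 - \<phi> 0 = (1 - 0) * (?D (x + t *\<^sub>R z) z + ?D (x + t *\<^sub>R (- z)) (- z))"
    unfolding \<phi>_def by (rule MVT2) (auto simp del: scaleR_minus_right intro!: DERIV_add der)
  then obtain t where t: "0 < t" "t < 1" "\<phi> 1 - \<phi> 0 = ?D (x + t *\<^sub>R z) z + ?D (x + t *\<^sub>R (- z)) (- z)" by auto
  have tz: "norm (t *\<^sub>R z) \<le> \<rho>" "norm (t *\<^sub>R z) \<le> norm z"
  proof -
    have "norm (t *\<^sub>R z) = t * norm z" using t by simp
    also have "\<dots> \<le> 1 * norm z" using t by (intro mult_right_mono) auto
    finally show "norm (t *\<^sub>R z) \<le> norm z" by simp
    then show "norm (t *\<^sub>R z) \<le> \<rho>" using z(1) by simp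
  qed
  have lin: "linear (?D y)" if "y \<in> cball x \<rho>" for y
    using d[OF that] by (rule linear_frechet_derivative)
  have expand: "?D y z = (\<Sum>b\<in>Basis. (z \<bullet> b) * ?D y b)" if "y \<in> cball x \<rho>" for y
  proof -
    have "?D y z = ?D y (\<Sum>b\<in>Basis. (z \<bullet> b) *\<^sub>R b)" by (simp add: euclidean_representation)
    also have "\<dots> = (\<Sum>b\<in>Basis. (z \<bullet> b) * ?D y b)" using lin[OF that] by (simp add: linear_sum linear_cmul)
    finally show ?thesis .
  qed
  have i: "x + t *\<^sub>R z \<in> cball x \<rho>" "x - t *\<^sub>R z \<in> cball x \<rho>" using tz by (auto simp: dist_norm)
  have "\<phi> 1 - \<phi> 0 = ?D (x + t *\<^sub>R z) z - ?D (x - t *\<^sub>R z) z"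
    using t(3) linear_neg[OF lin[OF i(2)], of z] by simp
  also have "\<dots> = (\<Sum>b\<in>Basis. (z \<bullet> b) * (?D (x + t *\<^sub>R z) b - ?D (x - t *\<^sub>R z) b))"
    using i by (simp add: expand right_diff_distrib sum_subtractf)
  also have "\<bar>\<dots>\<bar> \<le> (\<Sum>b\<in>(Basis::'a set). C * norm z powr (1 + \<gamma>))"
  proof (rule order_trans[OF sum_abs], rule sum_mono)
    fix b :: 'a assume b: "b \<in> Basis"
    have "\<bar>z \<bullet> b\<bar> * \<bar>?D (x + t *\<^sub>R z) b - ?D (x - t *\<^sub>R z) b\<bar> \<le> norm z * (C * norm (t *\<^sub>R z) powr \<gamma>)"
      using b h[OF b tz(1)] by (intro mult_mono Basis_le_norm) auto
    also have "\<dots> \<le> norm z * (C * norm z powr \<gamma>)"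
      using tz C \<gamma> by (intro mult_left_mono powr_mono2) auto
    also have "\<dots> = C * norm z powr (1 + \<gamma>)" using z by (simp add: powr_add)
    finally show "\<bar>(z \<bullet> b) * (?D (x + t *\<^sub>R z) b - ?D (x - t *\<^sub>R z) b)\<bar> \<le> C * norm z powr (1 + \<gamma>)"
      by (simp add: abs_mult)
  qed
  also have "\<dots> = DIM('a) * C * norm z powr (1 + \<gamma>)" by simp
  finally have "\<bar>\<phi> 1 - \<phi> 0\<bar> \<le> DIM('a) * C * norm z powr (1 + \<gamma>)" .
  moreover have "\<phi> 1 - \<phi> 0 = - (2 * u x - u (x + z) - u (x - z))" by (simp add: \<phi>_def)
  ultimately show ?thesis by simp
qed

lemma locally_hoelder_onD:
  assumes "locally_hoelder_on \<gamma> f \<Omega>" "compact K" "K \<subseteq> \<Omega>"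
  shows "\<exists>C\<ge>0. \<forall>x\<in>K. \<forall>y\<in>K. \<bar>f x - f y\<bar> \<le> C * norm (x - y) powr \<gamma>"
proof -
  obtain C where C: "\<forall>x\<in>K. \<forall>y\<in>K. \<bar>f x - f y\<bar> \<le> C * norm (x - y) powr \<gamma>"
    using assms unfolding locally_hoelder_on_def by blast
  have "C * norm (x - y) powr \<gamma> \<le> \<bar>C\<bar> * norm (x - y) powr \<gamma>" for x y by (intro mult_right_mono) auto
  then have "\<bar>f x - f y\<bar> \<le> \<bar>C\<bar> * norm (x - y) powr \<gamma>" if "x \<in> K" "y \<in> K" for x y
    using C that order_trans by blast
  then show ?thesis by (intro exI[of _ "\<bar>C\<bar>"]) auto
qed

text \<open>Any exponent above \<open>2 * s\<close> will do. For \<alpha> up to 1 the function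
  itself is Hoelder, for \<alpha> up to 2 its gradient is, and beyond 2 the gradient is Lipschitz.
  The constants are uniform because everything happens in a compact neighbourhood of K.\<close>

lemma second_difference_of_C_real_loc:
  fixes u :: "'a::euclidean_space \<Rightarrow> real"
  assumes u: "C_real_loc \<alpha> u \<Omega>" and \<alpha>: "0 < \<alpha>" "\<alpha> < 3" and s: "2 * s < \<alpha>" "0 < s" "s < 1"
    and \<Omega>: "open \<Omega>" and K: "compact K" "K \<subseteq> \<Omega>"
  shows "\<exists>\<rho> C \<alpha>'. 0 < \<rho> \<and> 0 \<le> C \<and> 2 * s < \<alpha>' \<and>
    (\<forall>x\<in>K. \<forall>z. norm z \<le> \<rho> \<longrightarrow> \<bar>2 * u x - u (x + z) - u (x - z)\<bar> \<le> C * norm z powr \<alpha>')"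
proof -
  obtain \<rho> where \<rho>: "0 < \<rho>" "(\<Union>x\<in>K. cball x \<rho>) \<subseteq> \<Omega>"
    using compact_subset_open_imp_cball_epsilon_subset[OF K(1) \<Omega> K(2)] by blast
  \<comment> \<open>The closed \<rho>-neighbourhood of K: the local Hoelder bounds come with compact
    sets and are needed at \<open>x + z\<close> and \<open>x - z\<close>.\<close>
  define K' where "K' = (\<Union>x\<in>K. \<Union>z\<in>cball 0 \<rho>. {x + z})"
  have K': "compact K'" unfolding K'_def using K(1) by (intro compact_sums') auto
  have mem: "x + z \<in> K'" "x - z \<in> K'" "cball x \<rho> \<subseteq> K'" if x: "x \<in> K" and z: "norm z \<le> \<rho>" for x z
  proof -
    have g: "x + w \<in> K'" if "norm w \<le> \<rho>" for w using x that unfolding K'_def by force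
    show "x + z \<in> K'" using g[OF z] .
    show "x - z \<in> K'" using g[of "- z"] z by simp
    show "cball x \<rho> \<subseteq> K'"
    proof
      fix y assume "y \<in> cball x \<rho>"
      then show "y \<in> K'" using g[of "y - x"] by (simp add: dist_norm norm_minus_commute)
    qed
  qed
  have K'\<Omega>: "K' \<subseteq> \<Omega>"
  proof
    fix y assume "y \<in> K'"
    then obtain x z where "x \<in> K" "norm z \<le> \<rho>" "y = x + z" unfolding K'_def by auto
    then have "y \<in> cball x \<rho>" by (simp add: dist_norm)
    then show "y \<in> \<Omega>" using \<rho> \<open>x \<in> K\<close> by blast
  qed
  have grad: "\<exists>C \<alpha>'. 0 \<le> C \<and> 2 * s < \<alpha>' \<and>
      (\<forall>x\<in>K. \<forall>z. norm z \<le> \<rho> \<longrightarrow> \<bar>2 * u x - u (x + z) - u (x - z)\<bar> \<le> C * norm z powr \<alpha>')"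
    if d: "\<And>y. y \<in> \<Omega> \<Longrightarrow> u differentiable (at y)" and \<gamma>: "0 \<le> \<gamma>" "2 * s < 1 + \<gamma>"
      and h: "\<And>b. b \<in> Basis \<Longrightarrow> \<exists>C\<ge>0. \<forall>x\<in>K. \<forall>z. norm z \<le> \<rho> \<longrightarrow>
        \<bar>frechet_derivative u (at (x + z)) b - frechet_derivative u (at (x - z)) b\<bar> \<le> C * norm z powr \<gamma>" for \<gamma>
  proof -
    have "\<forall>b. \<exists>C. b \<in> Basis \<longrightarrow> 0 \<le> C \<and> (\<forall>x\<in>K. \<forall>z. norm z \<le> \<rho> \<longrightarrow>
        \<bar>frechet_derivative u (at (x + z)) b - frechet_derivative u (at (x - z)) b\<bar> \<le> C * norm z powr \<gamma>)"
      using h by blast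
    from choice[OF this] obtain C where C': "\<forall>b. b \<in> Basis \<longrightarrow> 0 \<le> C b \<and> (\<forall>x\<in>K. \<forall>z. norm z \<le> \<rho> \<longrightarrow>
        \<bar>frechet_derivative u (at (x + z)) b - frechet_derivative u (at (x - z)) b\<bar> \<le> C b * norm z powr \<gamma>)"
      by (rule exE)
    have C: "\<And>b. b \<in> Basis \<Longrightarrow> 0 \<le> C b" "\<And>b x z. b \<in> Basis \<Longrightarrow> x \<in> K \<Longrightarrow> norm z \<le> \<rho> \<Longrightarrow>
        \<bar>frechet_derivative u (at (x + z)) b - frechet_derivative u (at (x - z)) b\<bar> \<le> C b * norm z powr \<gamma>"
      using C' by blast+
    define S where "S = (\<Sum>b\<in>Basis. C b)"
    have S: "0 \<le> S" "\<And>b. b \<in> Basis \<Longrightarrow> C b \<le> S"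
      unfolding S_def using C(1) by (auto intro!: sum_nonneg member_le_sum)
    have "\<bar>2 * u x - u (x + z) - u (x - z)\<bar> \<le> (DIM('a) * S) * norm z powr (1 + \<gamma>)" if x: "x \<in> K" and z: "norm z \<le> \<rho>" for x z
    proof (cases "z = 0")
      case False
      show ?thesis
      proof (rule second_difference_of_hoelder_gradient[OF _ _ \<gamma>(1) S(1) z False])
        show "u differentiable (at y)" if "y \<in> cball x \<rho>" for y
          using that x \<rho>(2) by (intro d) blast
        show "\<bar>frechet_derivative u (at (x + w)) b - frechet_derivative u (at (x - w)) b\<bar> \<le> S * norm w powr \<gamma>"
          if "b \<in> Basis" "norm w \<le> \<rho>" for b w
        proof -
          have "C b * norm w powr \<gamma> \<le> S * norm w powr \<gamma>" using S(2)[OF that(1)] by (intro mult_right_mono) auto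
          then show ?thesis using C(2)[OF that(1) x that(2)] by linarith
        qed
      qed
    qed simp
    then show ?thesis using S \<gamma> by (intro exI[of _ "DIM('a) * S"] exI[of _ "1 + \<gamma>"]) auto
  qed
  have hoelder: "\<exists>C\<ge>0. \<forall>x\<in>K. \<forall>z. norm z \<le> \<rho> \<longrightarrow> \<bar>f (x + z) - f (x - z)\<bar> \<le> C * norm z powr \<gamma>"
    if f: "locally_hoelder_on \<gamma> f \<Omega>" and \<gamma>: "0 \<le> \<gamma>" for f \<gamma>
  proof -
    obtain C where C: "0 \<le> C" "\<forall>x\<in>K'. \<forall>y\<in>K'. \<bar>f x - f y\<bar> \<le> C * norm (x - y) powr \<gamma>"
      using locally_hoelder_onD[OF f K' K'\<Omega>] by blast
    have "\<bar>f (x + z) - f (x - z)\<bar> \<le> (C * 2 powr \<gamma>) * norm z powr \<gamma>" if "x \<in> K" "norm z \<le> \<rho>" for x z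
    proof -
      have "\<bar>f (x + z) - f (x - z)\<bar> \<le> C * norm ((x + z) - (x - z)) powr \<gamma>" using C mem(1,2)[OF that] by blast
      also have "(x + z) - (x - z) = 2 *\<^sub>R z" by (simp add: scaleR_2)
      also have "C * norm (2 *\<^sub>R z) powr \<gamma> = (C * 2 powr \<gamma>) * norm z powr \<gamma>" by (simp add: powr_mult)
      finally show ?thesis .
    qed
    then show ?thesis using C(1) by (intro exI[of _ "C * 2 powr \<gamma>"]) auto
  qed
  consider "\<alpha> \<le> 1" | "1 < \<alpha>" "\<alpha> \<le> 2" | "2 < \<alpha>" by linarith
  then have "\<exists>C \<alpha>'. 0 \<le> C \<and> 2 * s < \<alpha>' \<and>
      (\<forall>x\<in>K. \<forall>z. norm z \<le> \<rho> \<longrightarrow> \<bar>2 * u x - u (x + z) - u (x - z)\<bar> \<le> C * norm z powr \<alpha>')"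
  proof cases
    case 1
    then have "\<lceil>\<alpha>\<rceil> = 1" using \<alpha> by (simp add: ceiling_eq_iff)
    then have "locally_hoelder_on \<alpha> u \<Omega>" using u by (simp add: C_real_loc_def)
    then obtain C where C: "0 \<le> C" "\<forall>x\<in>K'. \<forall>y\<in>K'. \<bar>u x - u y\<bar> \<le> C * norm (x - y) powr \<alpha>"
      using locally_hoelder_onD[OF _ K' K'\<Omega>] by blast
    have "\<bar>2 * u x - u (x + z) - u (x - z)\<bar> \<le> 2 * C * norm z powr \<alpha>" if "x \<in> K" "norm z \<le> \<rho>" for x z
    proof -
      have "x \<in> K'" using mem(1)[OF that(1), of 0] \<rho> by simp
      then have "\<bar>u x - u (x + z)\<bar> \<le> C * norm (x - (x + z)) powr \<alpha>" "\<bar>u x - u (x - z)\<bar> \<le> C * norm (x - (x - z)) powr \<alpha>"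
        using C(2) mem(1,2)[OF that] by blast+
      then show ?thesis by simp
    qed
    then show ?thesis using C(1) s by (intro exI[of _ "2 * C"] exI[of _ \<alpha>]) auto
  next
    case 2
    then have "\<lceil>\<alpha>\<rceil> = 2" by (simp add: ceiling_eq_iff)
    then have "C_hoelder_loc (Suc 0) (\<alpha> - 1) u \<Omega>" using u by (simp add: C_real_loc_def Let_def del: C_hoelder_loc.simps)
    then have "\<And>y. y \<in> \<Omega> \<Longrightarrow> u differentiable (at y)"
      "\<And>b. b \<in> Basis \<Longrightarrow> locally_hoelder_on (\<alpha> - 1) (\<lambda>x. frechet_derivative u (at x) b) \<Omega>" by auto
    then show ?thesis using 2 s by (intro grad[of "\<alpha> - 1"] hoelder) auto
  next
    \<comment> \<open>The second derivatives are Hoelder on the compact set \<open>K'\<close>, hence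
      bounded there. So the gradient is Lipschitz on balls around points of K, and the exponent
      becomes 2, which exceeds \<open>2 * s\<close>.\<close>
    case 3
    then have "\<lceil>\<alpha>\<rceil> = 3" using \<alpha> by (simp add: ceiling_eq_iff)
    then have c: "C_hoelder_loc (Suc (Suc 0)) (\<alpha> - 2) u \<Omega>" using u
      by (simp add: C_real_loc_def Let_def numeral_2_eq_2 del: C_hoelder_loc.simps)
    show ?thesis
    proof (rule grad[of 1])
      show "u differentiable (at y)" if "y \<in> \<Omega>" for y using c that by simp
      fix b :: 'a assume b: "b \<in> Basis"
      define f where "f = (\<lambda>x. frechet_derivative u (at x) b)"
      have fd: "f differentiable (at y)" if "y \<in> \<Omega>" for y using c that b by (simp add: f_def)
      have fh: "locally_hoelder_on (\<alpha> - 2) (\<lambda>x. frechet_derivative f (at x) b') \<Omega>" if "b' \<in> Basis" for b'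
        using c that b by (simp add: f_def)
      have "\<exists>B\<ge>0. \<forall>y\<in>K'. \<bar>frechet_derivative f (at y) b'\<bar> \<le> B" if b': "b' \<in> Basis" for b'
      proof (cases "K' = {}")
        case False
        then obtain y\<^sub>0 where y0: "y\<^sub>0 \<in> K'" by blast
        let ?p = "\<lambda>y. frechet_derivative f (at y) b'"
        obtain C where C: "0 \<le> C" "\<forall>x\<in>K'. \<forall>y\<in>K'. \<bar>?p x - ?p y\<bar> \<le> C * norm (x - y) powr (\<alpha> - 2)"
          using locally_hoelder_onD[OF fh[OF b'] K' K'\<Omega>] by blast
        obtain r where r: "\<And>y. y \<in> K' \<Longrightarrow> norm (y - y\<^sub>0) \<le> r"
          using compact_imp_bounded[OF K'] bounded_any_center[of K' y\<^sub>0] by (auto simp: dist_norm norm_minus_commute)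
        have "\<bar>?p y\<bar> \<le> \<bar>?p y\<^sub>0\<bar> + C * r powr (\<alpha> - 2)" if "y \<in> K'" for y
        proof -
          have "\<bar>?p y - ?p y\<^sub>0\<bar> \<le> C * norm (y - y\<^sub>0) powr (\<alpha> - 2)" using C y0 that by blast
          also have "\<dots> \<le> C * r powr (\<alpha> - 2)" using C r[OF that] 3 by (intro mult_left_mono powr_mono2) auto
          finally show ?thesis by linarith
        qed
        then show ?thesis using C(1) by (intro exI[of _ "\<bar>?p y\<^sub>0\<bar> + C * r powr (\<alpha> - 2)"]) auto
      qed auto
      then have "\<forall>b'. \<exists>B. b' \<in> Basis \<longrightarrow> 0 \<le> B \<and> (\<forall>y\<in>K'. \<bar>frechet_derivative f (at y) b'\<bar> \<le> B)" by blast
      from choice[OF this] obtain B where B': "\<forall>b'. b' \<in> Basis \<longrightarrow> 0 \<le> B b' \<and> (\<forall>y\<in>K'. \<bar>frechet_derivative f (at y) b'\<bar> \<le> B b')"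
        by (rule exE)
      have B: "\<And>b'. b' \<in> Basis \<Longrightarrow> 0 \<le> B b'" "\<And>b' y. b' \<in> Basis \<Longrightarrow> y \<in> K' \<Longrightarrow> \<bar>frechet_derivative f (at y) b'\<bar> \<le> B b'"
        using B' by blast+
      define S where "S = (\<Sum>b'\<in>Basis. B b')"
      have S0: "0 \<le> S" unfolding S_def using B(1) by (intro sum_nonneg)
      have on: "onorm (frechet_derivative f (at y)) \<le> S" if y: "y \<in> K'" for y
      proof (rule onorm_le)
        fix h :: 'a
        have lin: "linear (frechet_derivative f (at y))" using fd K'\<Omega> y by (intro linear_frechet_derivative) auto
        have "frechet_derivative f (at y) h = frechet_derivative f (at y) (\<Sum>b'\<in>Basis. (h \<bullet> b') *\<^sub>R b')"
          by (simp add: euclidean_representation)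
        also have "\<dots> = (\<Sum>b'\<in>Basis. (h \<bullet> b') * frechet_derivative f (at y) b')" using lin by (simp add: linear_sum linear_cmul)
        also have "norm \<dots> \<le> (\<Sum>b'\<in>Basis. norm h * B b')"
          by (rule order_trans[OF norm_sum], rule sum_mono) (auto simp: abs_mult intro!: mult_mono Basis_le_norm B(2)[OF _ y])
        also have "\<dots> = S * norm h" by (simp add: S_def sum_distrib_left mult.commute)
        finally show "norm (frechet_derivative f (at y) h) \<le> S * norm h" .
      qed
      have "\<bar>f (x + z) - f (x - z)\<bar> \<le> (2 * S) * norm z powr 1" if x: "x \<in> K" and z: "norm z \<le> \<rho>" for x z
      proof -
        have sub: "cball x \<rho> \<subseteq> K'" by (rule mem(3)[OF x z])
        have "norm (f (x + z) - f (x - z)) \<le> S * norm ((x + z) - (x - z))"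
        proof (rule differentiable_bound)
          show "convex (cball x \<rho>)" by simp
          show "(f has_derivative frechet_derivative f (at y)) (at y within cball x \<rho>)" if "y \<in> cball x \<rho>" for y
          proof (rule has_derivative_at_withinI)
            have "y \<in> \<Omega>" using that sub K'\<Omega> by blast
            then show "(f has_derivative frechet_derivative f (at y)) (at y)" by (rule fd[THEN frechet_derivative_works[THEN iffD1]])
          qed
          show "onorm (frechet_derivative f (at y)) \<le> S" if "y \<in> cball x \<rho>" for y using on that sub by blast
        qed (use z in \<open>auto simp: dist_norm\<close>)
        also have "(x + z) - (x - z) = 2 *\<^sub>R z" by (simp add: scaleR_2)
        finally show ?thesis by simp
      qed
      then show "\<exists>C\<ge>0. \<forall>x\<in>K. \<forall>z. norm z \<le> \<rho> \<longrightarrow>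
        \<bar>frechet_derivative u (at (x + z)) b - frechet_derivative u (at (x - z)) b\<bar> \<le> C * norm z powr 1"
        using S0 unfolding f_def by (intro exI[of _ "2 * S"]) auto
    qed (use s in auto)
  qed
  then show ?thesis using \<rho>(1) by blast
qed

text \<open>Averaging the truncated integral over \<open>y = x + z\<close> and
  \<open>y = x - z\<close> turns the principal value into an absolutely convergent integral: the
  second difference compensates the singularity, and dominated convergence removes the
  truncation.\<close>

lemma has_frac_laplacian_second_difference:
  fixes u :: "'a::euclidean_space \<Rightarrow> real"
  assumes s: "0 < s" and lap: "has_frac_laplacian s u x v"
    and u: "u \<in> borel_measurable borel"
    and D: "\<And>z. \<bar>2 * u x - u (x + z) - u (x - z)\<bar> \<le> C * min 1 (norm z powr \<alpha>)" and \<alpha>: "2 * s < \<alpha>"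
  shows "integrable lborel (\<lambda>z. (2 * u x - u (x + z) - u (x - z)) * singular_kernel s z)"
    "v = (\<integral>z. (2 * u x - u (x + z) - u (x - z)) * singular_kernel s z \<partial>lborel) / 2"
proof -
  note [measurable] = u
  let ?k = "\<lambda>z::'a. singular_kernel s z"
  let ?D = "\<lambda>z. 2 * u x - u (x + z) - u (x - z)"
  have w: "integrable lborel (\<lambda>z. C * (min 1 (norm z powr \<alpha>) * ?k z))"
    using s \<alpha> by (intro integrable_mult_right integrable_min_norm_powr)
  have bd: "\<bar>?D z * ?k z\<bar> \<le> C * (min 1 (norm z powr \<alpha>) * ?k z)" for z
    using mult_right_mono[OF D[of z], of "?k z"] by (simp add: abs_mult mult.assoc)
  show "integrable lborel (\<lambda>z. ?D z * ?k z)"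
  proof (rule Bochner_Integration.integrable_bound[OF w])
    show "AE z in lborel. norm (?D z * ?k z) \<le> norm (C * (min 1 (norm z powr \<alpha>) * ?k z))"
      unfolding real_norm_def using order_trans[OF bd abs_ge_self] by (rule AE_I2)
  qed simp
  have trunc: "(LINT y:{y. \<epsilon> < norm (x - y)}|lborel. frac_kernel_diff s u x y)
      = (\<integral>z. indicator {z. \<epsilon> < norm z} z * (?D z * ?k z) \<partial>lborel) / 2" if \<epsilon>: "0 < \<epsilon>" for \<epsilon>
  proof -
    define F where "F y = indicator {y. \<epsilon> < norm (x - y)} y * frac_kernel_diff s u x y" for y
    have Fi: "integrable lborel F"
      using lap \<epsilon> unfolding has_frac_laplacian_def set_integrable_def F_def[abs_def] by simp
    have FI: "(LINT y:{y. \<epsilon> < norm (x - y)}|lborel. frac_kernel_diff s u x y) = (\<integral>y. F y \<partial>lborel)"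
      by (simp add: set_lebesgue_integral_def F_def)
    have i: "integrable lborel (\<lambda>z. F (x + z))" "integrable lborel (\<lambda>z. F (x - z))"
      using Fi by (simp_all add: lborel_integrable_add_iff lborel_integrable_reflect_iff)
    have "2 * (\<integral>y. F y \<partial>lborel) = (\<integral>z. F (x + z) \<partial>lborel) + (\<integral>z. F (x - z) \<partial>lborel)"
      by (simp add: lborel_integral_add lborel_integral_reflect)
    also have "\<dots> = (\<integral>z. F (x + z) + F (x - z) \<partial>lborel)" using i by simp
    also have "\<dots> = (\<integral>z. indicator {z. \<epsilon> < norm z} z * (?D z * ?k z) \<partial>lborel)"
    proof (intro Bochner_Integration.integral_cong refl)
      fix z
      have "a / norm z powr (real DIM('a) + 2 * s) = a * ?k z" for a :: real
        by (simp only: powr_minus divide_inverse)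
      then show "F (x + z) + F (x - z) = indicator {z. \<epsilon> < norm z} z * (?D z * ?k z)"
        by (auto simp: F_def frac_kernel_diff_def indicator_def algebra_simps)
    qed
    finally show ?thesis using FI by simp
  qed
  define \<epsilon> where "\<epsilon> n = 1 / real (Suc n)" for n
  have e: "filterlim \<epsilon> (at_right 0) sequentially"
  proof (rule tendsto_imp_filterlim_at_right)
    show "\<epsilon> \<longlonglongrightarrow> 0" unfolding \<epsilon>_def using LIMSEQ_inverse_real_of_nat by (simp add: inverse_eq_divide)
  qed (auto simp: \<epsilon>_def)
  have 1: "(\<lambda>n. (\<integral>z. indicator {z. \<epsilon> n < norm z} z * (?D z * ?k z) \<partial>lborel) / 2) \<longlonglongrightarrow> v"
  proof -
    have "(\<lambda>n. LINT y:{y. \<epsilon> n < norm (x - y)}|lborel. frac_kernel_diff s u x y) \<longlonglongrightarrow> v"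
      by (rule filterlim_compose[OF conjunct2[OF lap[unfolded has_frac_laplacian_def]] e])
    then show ?thesis by (simp add: trunc \<epsilon>_def)
  qed
  have 2: "(\<lambda>n. \<integral>z. indicator {z. \<epsilon> n < norm z} z * (?D z * ?k z) \<partial>lborel) \<longlonglongrightarrow> (\<integral>z. ?D z * ?k z \<partial>lborel)"
  proof (rule integral_dominated_convergence[OF _ _ w])
    show "AE z in lborel. (\<lambda>n. indicator {z. \<epsilon> n < norm z} z * (?D z * ?k z)) \<longlonglongrightarrow> ?D z * ?k z"
    proof (rule AE_I2)
      fix z :: 'a
      show "(\<lambda>n. indicator {z. \<epsilon> n < norm z} z * (?D z * ?k z)) \<longlonglongrightarrow> ?D z * ?k z"
      proof (cases "z = 0")
        case False
        have "\<epsilon> \<longlonglongrightarrow> 0" unfolding \<epsilon>_def using LIMSEQ_inverse_real_of_nat by (simp add: inverse_eq_divide)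
        then have "\<forall>\<^sub>F n in sequentially. \<epsilon> n < norm z" using False by (intro order_tendstoD) auto
        then have "\<forall>\<^sub>F n in sequentially. indicator {z. \<epsilon> n < norm z} z * (?D z * ?k z) = ?D z * ?k z"
          by eventually_elim simp
        then show ?thesis by (rule tendsto_eventually)
      qed simp
    qed
    fix n
    show "AE z in lborel. norm (indicator {z. \<epsilon> n < norm z} z * (?D z * ?k z)) \<le> C * (min 1 (norm z powr \<alpha>) * ?k z)"
    proof (rule AE_I2)
      fix z :: 'a
      have "norm (indicator {z. \<epsilon> n < norm z} z * (?D z * ?k z)) \<le> \<bar>?D z * ?k z\<bar>"
        by (cases "z \<in> {z. \<epsilon> n < norm z}") simp_all
      also note bd[of z]
      finally show "norm (indicator {z. \<epsilon> n < norm z} z * (?D z * ?k z)) \<le> C * (min 1 (norm z powr \<alpha>) * ?k z)" .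
    qed
  qed simp_all
  have "(\<lambda>n. (\<integral>z. indicator {z. \<epsilon> n < norm z} z * (?D z * ?k z) \<partial>lborel) / 2) \<longlonglongrightarrow> (\<integral>z. ?D z * ?k z \<partial>lborel) / 2"
    by (intro tendsto_divide 2 tendsto_const) auto
  then show "v = (\<integral>z. ?D z * ?k z \<partial>lborel) / 2" using 1 LIMSEQ_unique by blast
qed

text \<open>Dominated convergence along the parameters \<open>1 / real (Suc n)\<close>; monotonicity
  of the kernel in \<epsilon> extends the bound from one of them to all smaller \<epsilon>.\<close>

lemma kernel_defect_vanishes:
  assumes s: "0 < s" "2 * s < \<alpha>" and "0 < \<eta>"
  shows "\<exists>\<epsilon>\<^sub>0>0. \<forall>\<epsilon>. 0 < \<epsilon> \<and> \<epsilon> < \<epsilon>\<^sub>0 \<longrightarrow>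
    integral\<^sup>L lborel (\<lambda>z::'a::euclidean_space. min 1 (norm z powr \<alpha>) * (singular_kernel s z - reg_kernel s \<epsilon> z)) \<le> \<eta>"
proof -
  let ?k = "\<lambda>z::'a. singular_kernel s z"
  let ?m = "\<lambda>z::'a. min 1 (norm z powr \<alpha>)"
  have w: "integrable lborel (\<lambda>z. ?m z * ?k z)" using s by (rule integrable_min_norm_powr)
  have bd: "0 \<le> ?m z * (?k z - reg_kernel s \<epsilon> z) \<and> ?m z * (?k z - reg_kernel s \<epsilon> z) \<le> ?m z * ?k z" for z \<epsilon>
    using reg_kernel_le[OF s(1), of z \<epsilon>] by (cases "z = 0") (auto intro!: mult_left_mono mult_nonneg_nonneg)
  have int: "integrable lborel (\<lambda>z. ?m z * (?k z - reg_kernel s \<epsilon> z))" for \<epsilon>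
    by (rule Bochner_Integration.integrable_bound[OF w]) (use bd in auto)
  have "(\<lambda>n. \<integral>z. ?m z * (?k z - reg_kernel s (1 / real (Suc n)) z) \<partial>lborel) \<longlonglongrightarrow> integral\<^sup>L lborel (\<lambda>z::'a. 0)"
  proof (rule integral_dominated_convergence[OF _ _ w])
    show "AE z in lborel. (\<lambda>n. ?m z * (?k z - reg_kernel s (1 / real (Suc n)) z)) \<longlonglongrightarrow> 0"
    proof (rule AE_I2)
      fix z :: 'a
      show "(\<lambda>n. ?m z * (?k z - reg_kernel s (1 / real (Suc n)) z)) \<longlonglongrightarrow> 0"
      proof (cases "z = 0")
        case False
        have e: "(\<lambda>n. 1 / real (Suc n)) \<longlonglongrightarrow> 0" using LIMSEQ_inverse_real_of_nat by (simp add: inverse_eq_divide)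
        have "(\<lambda>n. reg_kernel s (1 / real (Suc n)) z) \<longlonglongrightarrow> reg_kernel s 0 z"
          unfolding reg_kernel_def using False by (intro tendsto_powr tendsto_add tendsto_power e tendsto_const) auto
        then have "(\<lambda>n. ?m z * (?k z - reg_kernel s (1 / real (Suc n)) z)) \<longlonglongrightarrow> ?m z * (?k z - reg_kernel s 0 z)"
          by (intro tendsto_intros)
        then show ?thesis using False by (simp add: reg_kernel_zero)
      qed simp
    qed
  qed (use bd in auto)
  then have "\<forall>\<^sub>F n in sequentially. (\<integral>z. ?m z * (?k z - reg_kernel s (1 / real (Suc n)) z) \<partial>lborel) < \<eta>"
    using assms by (intro order_tendstoD) auto
  then obtain n where n: "(\<integral>z. ?m z * (?k z - reg_kernel s (1 / real (Suc n)) z) \<partial>lborel) < \<eta>"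
    by (auto simp: eventually_sequentially)
  have "(\<integral>z. ?m z * (?k z - reg_kernel s \<epsilon> z) \<partial>lborel) \<le> \<eta>" if \<epsilon>: "0 < \<epsilon>" "\<epsilon> < 1 / real (Suc n)" for \<epsilon>
  proof -
    have "reg_kernel s (1 / real (Suc n)) z \<le> reg_kernel s \<epsilon> z" for z :: 'a
      using \<epsilon> s by (intro reg_kernel_antimono) (auto intro!: power_mono)
    then have "(\<integral>z. ?m z * (?k z - reg_kernel s \<epsilon> z) \<partial>lborel) \<le> (\<integral>z. ?m z * (?k z - reg_kernel s (1 / real (Suc n)) z) \<partial>lborel)"
      by (intro integral_mono int mult_left_mono) auto
    then show ?thesis using n by linarith
  qed
  then show ?thesis by (intro exI[of _ "1 / real (Suc n)"]) auto
qed

text \<open>The two operators differ by an integral of at most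
  \<open>C' * min 1 (norm z powr \<alpha>')\<close> times the kernel defect. This bound does not
  involve x, which gives the uniformity on K.\<close>

lemma reg_lap_uniform_limit:
  fixes u v :: "'a::euclidean_space \<Rightarrow> real"
  assumes u: "C_real_loc \<alpha> u \<Omega>" and \<alpha>: "0 < \<alpha>" "\<alpha> < 3" and s: "2 * s < \<alpha>" "0 < s" "s < 1"
    and \<Omega>: "open \<Omega>" and K: "compact K" "K \<subseteq> \<Omega>"
    and um: "u \<in> borel_measurable borel" and ub: "\<And>x. \<bar>u x\<bar> \<le> M"
    and lap: "\<And>x. x \<in> K \<Longrightarrow> has_frac_laplacian s u x (v x)" and \<eta>: "0 < \<eta>"
  shows "\<exists>\<epsilon>\<^sub>0>0. \<forall>\<epsilon>. 0 < \<epsilon> \<and> \<epsilon> < \<epsilon>\<^sub>0 \<longrightarrow> (\<forall>x\<in>K. \<bar>reg_lap s \<epsilon> u x - v x\<bar> \<le> \<eta>)"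
proof -
  note [measurable] = um
  obtain \<rho> C \<alpha>' where h: "0 < \<rho>" "0 \<le> C" "2 * s < \<alpha>'"
    "\<And>x z. x \<in> K \<Longrightarrow> norm z \<le> \<rho> \<Longrightarrow> \<bar>2 * u x - u (x + z) - u (x - z)\<bar> \<le> C * norm z powr \<alpha>'"
    using second_difference_of_C_real_loc[OF u \<alpha> s \<Omega> K] by blast
  define \<rho>' where "\<rho>' = min \<rho> 1"
  have r: "0 < \<rho>'" "\<rho>' \<le> \<rho>" "\<rho>' \<le> 1" using h by (auto simp: \<rho>'_def)
  have a0: "0 < \<alpha>'" using h s by simp
  have M: "0 \<le> M" using ub[of 0] by linarith
  \<comment> \<open>Beyond \<open>\<rho>'\<close> the second difference is at most
    \<open>4 * M\<close>; the added term turns this into a multiple of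
    \<open>min 1 (norm z powr \<alpha>')\<close>.\<close>
  define C' where "C' = C + 4 * M / \<rho>' powr \<alpha>'"
  have C': "0 \<le> C'" "C \<le> C'" "4 * M / \<rho>' powr \<alpha>' \<le> C'" using h M by (auto simp: C'_def)
  have D: "\<bar>2 * u x - u (x + z) - u (x - z)\<bar> \<le> C' * min 1 (norm z powr \<alpha>')" if x: "x \<in> K" for x z
  proof (cases "norm z \<le> \<rho>'")
    case True
    have "norm z powr \<alpha>' \<le> 1 powr \<alpha>'" using True r a0 by (intro powr_mono2) auto
    then have "min 1 (norm z powr \<alpha>') = norm z powr \<alpha>'" by simp
    moreover have "C * norm z powr \<alpha>' \<le> C' * norm z powr \<alpha>'" using C' by (intro mult_right_mono) auto
    ultimately show ?thesis using h(4)[OF x, of z] True r by simp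
  next
    case False
    have "\<bar>2 * u x - u (x + z) - u (x - z)\<bar> \<le> 4 * M" using ub[of x] ub[of "x + z"] ub[of "x - z"] by linarith
    also have "\<dots> = 4 * M / \<rho>' powr \<alpha>' * \<rho>' powr \<alpha>'" using r by simp
    also have "\<dots> \<le> C' * min 1 (norm z powr \<alpha>')"
    proof (intro mult_mono C')
      have "\<rho>' powr \<alpha>' \<le> 1 powr \<alpha>'" "\<rho>' powr \<alpha>' \<le> norm z powr \<alpha>'" using False r a0 by (intro powr_mono2; simp)+
      then show "\<rho>' powr \<alpha>' \<le> min 1 (norm z powr \<alpha>')" by simp
    qed auto
    finally show ?thesis .
  qed
  have e1: "0 < 2 * \<eta> / (C' + 1)" using \<eta> C' by (intro divide_pos_pos) auto
  obtain \<epsilon>\<^sub>0 where e0: "0 < \<epsilon>\<^sub>0" "\<And>\<epsilon>. 0 < \<epsilon> \<Longrightarrow> \<epsilon> < \<epsilon>\<^sub>0 \<Longrightarrow>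
      integral\<^sup>L lborel (\<lambda>z::'a. min 1 (norm z powr \<alpha>') * (singular_kernel s z - reg_kernel s \<epsilon> z)) \<le> 2 * \<eta> / (C' + 1)"
    using kernel_defect_vanishes[OF s(2) h(3) e1, where 'a = 'a] by blast
  have "\<bar>reg_lap s \<epsilon> u x - v x\<bar> \<le> \<eta>" if x: "x \<in> K" and \<epsilon>: "0 < \<epsilon>" "\<epsilon> < \<epsilon>\<^sub>0" for x \<epsilon>
  proof -
    let ?k = "\<lambda>z::'a. singular_kernel s z"
    let ?D = "\<lambda>z. 2 * u x - u (x + z) - u (x - z)"
    let ?m = "\<lambda>z::'a. min 1 (norm z powr \<alpha>')"
    note V = has_frac_laplacian_second_difference[OF s(2) lap[OF x] um D[OF x] h(3)]
    note R = reg_lap_second_difference_integrable[OF s(2) \<epsilon>(1) um ub, of x]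
    have i: "integrable lborel (\<lambda>z. ?m z * (?k z - reg_kernel s \<epsilon> z))"
    proof (rule Bochner_Integration.integrable_bound[OF integrable_min_norm_powr[OF s(2) h(3)]])
      show "AE z in lborel. norm (?m z * (?k z - reg_kernel s \<epsilon> z)) \<le> norm (?m z * ?k z)"
      proof (rule AE_I2)
        fix z :: 'a
        show "norm (?m z * (?k z - reg_kernel s \<epsilon> z)) \<le> norm (?m z * ?k z)"
          using reg_kernel_le[OF s(2), of z \<epsilon>] by (cases "z = 0") (auto simp: abs_mult intro!: mult_left_mono)
      qed
    qed simp
    have "2 * (v x - reg_lap s \<epsilon> u x) = (\<integral>z. ?D z * ?k z - ?D z * reg_kernel s \<epsilon> z \<partial>lborel)"
      using V R by (simp add: reg_lap_second_difference[OF s(2) \<epsilon>(1) um ub])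
    then have "\<bar>2 * (v x - reg_lap s \<epsilon> u x)\<bar> = \<bar>(\<integral>z. ?D z * ?k z - ?D z * reg_kernel s \<epsilon> z \<partial>lborel)\<bar>"
      by (simp only:)
    then have "2 * \<bar>reg_lap s \<epsilon> u x - v x\<bar> = \<bar>(\<integral>z. ?D z * ?k z - ?D z * reg_kernel s \<epsilon> z \<partial>lborel)\<bar>"
      by (simp only: abs_mult abs_numeral abs_minus_commute)
    also have "\<dots> \<le> (\<integral>z. \<bar>?D z * ?k z - ?D z * reg_kernel s \<epsilon> z\<bar> \<partial>lborel)" by (rule integral_abs_bound)
    also have "\<dots> \<le> (\<integral>z. C' * (?m z * (?k z - reg_kernel s \<epsilon> z)) \<partial>lborel)"
    proof (rule integral_mono)
      show "integrable lborel (\<lambda>z. \<bar>?D z * ?k z - ?D z * reg_kernel s \<epsilon> z\<bar>)"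
        using V R by (intro integrable_abs Bochner_Integration.integrable_diff)
      show "integrable lborel (\<lambda>z. C' * (?m z * (?k z - reg_kernel s \<epsilon> z)))" using i by simp
      fix z
      show "\<bar>?D z * ?k z - ?D z * reg_kernel s \<epsilon> z\<bar> \<le> C' * (?m z * (?k z - reg_kernel s \<epsilon> z))"
      proof (cases "z = 0")
        case False
        then have p: "0 \<le> ?k z - reg_kernel s \<epsilon> z" using reg_kernel_le[OF s(2) False, of \<epsilon>] by simp
        have "\<bar>?D z * ?k z - ?D z * reg_kernel s \<epsilon> z\<bar> = \<bar>?D z\<bar> * (?k z - reg_kernel s \<epsilon> z)"
          using p by (simp add: right_diff_distrib[symmetric] abs_mult del: right_diff_distrib_numeral)
        also have "\<dots> \<le> (C' * ?m z) * (?k z - reg_kernel s \<epsilon> z)" using p D[OF x, of z] by (intro mult_right_mono)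
        finally show ?thesis by (simp only: mult.assoc)
      qed simp
    qed
    also have "\<dots> = C' * (\<integral>z. ?m z * (?k z - reg_kernel s \<epsilon> z) \<partial>lborel)" by simp
    also have "\<dots> \<le> C' * (2 * \<eta> / (C' + 1))" using e0(2)[OF \<epsilon>] C' by (intro mult_left_mono)
    also have "\<dots> \<le> 2 * \<eta>" using C' \<eta> by (simp add: field_simps)
    finally show ?thesis by simp
  qed
  then show ?thesis using e0(1) by blast
qed

section \<open>Averaging in the tangential variables\<close>

text \<open>For \<open>norm h \<le> 1\<close> the integrand vanishes outside the ball of radius 2,
  and \<open>bump_second_difference\<close> applies; otherwise four times the integral of
  \<open>bump\<close> is enough. The L1 norm is the right one because the cutoff will carry the
  shifts while u is merely bounded.\<close>

lemma bump_second_difference_L1: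
  obtains C where "0 < C"
    "\<And>h::'a::euclidean_space. integral\<^sup>L lborel (\<lambda>w. \<bar>bump (w + h) + bump (w - h) - 2 * bump w\<bar>) \<le> C * min 1 ((norm h)\<^sup>2)"
proof
  let ?H = "integral\<^sup>L lborel (bump :: 'a \<Rightarrow> real)"
  let ?V = "measure lborel (cball (0::'a) 2)"
  have H: "0 < ?H" by (rule bump_integral_pos)
  show "0 < 4 * ?H + 36 * ?V" using H by (simp add: add_pos_nonneg)
  fix h :: 'a
  have i: "integrable lborel (\<lambda>w::'a. bump (w + h))" "integrable lborel (\<lambda>w::'a. bump (w - h))"
    using lborel_integrable_add_iff[of "bump :: 'a \<Rightarrow> real" h] lborel_integrable_diff_iff[of "bump :: 'a \<Rightarrow> real" h] bump_integrable
    by (simp_all add: add.commute)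
  have e: "integral\<^sup>L lborel (\<lambda>w::'a. bump (w + h)) = ?H" "integral\<^sup>L lborel (\<lambda>w::'a. bump (w - h)) = ?H"
    using lborel_integral_add[of "bump :: 'a \<Rightarrow> real" h] lborel_integral_diff[of "bump :: 'a \<Rightarrow> real" h]
    by (simp_all add: add.commute)
  have ia: "integrable lborel (\<lambda>w::'a. \<bar>bump (w + h) + bump (w - h) - 2 * bump w\<bar>)"
    using i bump_integrable by (intro integrable_abs Bochner_Integration.integrable_diff Bochner_Integration.integrable_add integrable_mult_right)
  show "integral\<^sup>L lborel (\<lambda>w::'a. \<bar>bump (w + h) + bump (w - h) - 2 * bump w\<bar>) \<le> (4 * ?H + 36 * ?V) * min 1 ((norm h)\<^sup>2)"
  proof (cases "norm h \<le> 1")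
    case True
    have m: "min 1 ((norm h)\<^sup>2) = (norm h)\<^sup>2" using True by (simp add: power_le_one)
    have iv: "integrable lborel (indicator (cball 0 2) :: 'a \<Rightarrow> real)"
      by (intro integrable_real_indicator emeasure_lborel_cball_finite) auto
    have "integral\<^sup>L lborel (\<lambda>w::'a. \<bar>bump (w + h) + bump (w - h) - 2 * bump w\<bar>) \<le> integral\<^sup>L lborel (\<lambda>w::'a. 36 * (norm h)\<^sup>2 * indicator (cball 0 2) w)"
    proof (rule integral_mono[OF ia])
      show "integrable lborel (\<lambda>w::'a. 36 * (norm h)\<^sup>2 * indicator (cball 0 2) w)" using iv by simp
      fix w :: 'a
      show "\<bar>bump (w + h) + bump (w - h) - 2 * bump w\<bar> \<le> 36 * (norm h)\<^sup>2 * indicator (cball 0 2) w"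
      proof (cases "norm w \<le> 2")
        case True
        then show ?thesis using bump_second_difference[of w h] m by simp
      next
        case False
        then have "1 \<le> norm w" "1 \<le> norm (w + h)" "1 \<le> norm (w - h)"
          using \<open>norm h \<le> 1\<close> norm_diff_ineq[of w h] norm_triangle_ineq2[of w h] by auto
        then show ?thesis by (simp add: bump_eq_0)
      qed
    qed
    also have "\<dots> = 36 * ?V * (norm h)\<^sup>2" using iv by simp
    also have "\<dots> \<le> (4 * ?H + 36 * ?V) * (norm h)\<^sup>2" using H by (intro mult_right_mono) auto
    finally show ?thesis unfolding m .
  next
    case False
    then have m: "min 1 ((norm h)\<^sup>2) = 1" using one_le_power[of "norm h" 2] by simp
    have "integral\<^sup>L lborel (\<lambda>w::'a. \<bar>bump (w + h) + bump (w - h) - 2 * bump w\<bar>) \<le> integral\<^sup>L lborel (\<lambda>w::'a. bump (w + h) + bump (w - h) + 2 * bump w)"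
    proof (rule integral_mono[OF ia])
      show "integrable lborel (\<lambda>w::'a. bump (w + h) + bump (w - h) + 2 * bump w)"
        using i bump_integrable by (intro Bochner_Integration.integrable_add integrable_mult_right)
      show "\<bar>bump (w + h) + bump (w - h) - 2 * bump w\<bar> \<le> bump (w + h) + bump (w - h) + 2 * bump w" for w :: 'a
        using bump_nonneg[of "w + h"] bump_nonneg[of "w - h"] bump_nonneg[of w] by linarith
    qed
    also have "\<dots> = 4 * ?H" using Bochner_Integration.integral_add[OF Bochner_Integration.integrable_add[OF i] integrable_mult_right[OF bump_integrable]]
        Bochner_Integration.integral_add[OF i] e by simp
    finally show ?thesis unfolding m by (simp add: add_increasing2)
  qed
qed

section \<open>Homogeneity and marginals of the kernels\<close>

lemma reg_kernel_scale:
  fixes z :: "'a::euclidean_space"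
  assumes "0 < l"
  shows "reg_kernel s \<epsilon> ((1 / l) *\<^sub>R z) = l powr (real DIM('a) + 2 * s) * reg_kernel s (l * \<epsilon>) z"
proof -
  have "(norm ((1 / l) *\<^sub>R z))\<^sup>2 + \<epsilon>\<^sup>2 = ((norm z)\<^sup>2 + (l * \<epsilon>)\<^sup>2) / l\<^sup>2"
    using assms by (simp add: power_divide power_mult_distrib add_divide_distrib)
  then have "reg_kernel s \<epsilon> ((1 / l) *\<^sub>R z) = ((norm z)\<^sup>2 + (l * \<epsilon>)\<^sup>2) powr (- ((real DIM('a) + 2 * s) / 2)) / (l\<^sup>2) powr (- ((real DIM('a) + 2 * s) / 2))"
    unfolding reg_kernel_def by (simp only:) (intro powr_divide; simp)
  also have "l\<^sup>2 = l powr 2" using assms by (simp add: powr_numeral)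
  also have "(l powr 2) powr (- ((real DIM('a) + 2 * s) / 2)) = l powr - (real DIM('a) + 2 * s)"
  proof -
    have "2 * - ((real DIM('a) + 2 * s) / 2) = - (real DIM('a) + 2 * s)" by (simp add: field_simps)
    then show ?thesis by (simp only: powr_powr)
  qed
  finally have "reg_kernel s \<epsilon> ((1 / l) *\<^sub>R z) = reg_kernel s (l * \<epsilon>) z / l powr - (real DIM('a) + 2 * s)"
    by (simp only: reg_kernel_def)
  then show ?thesis by (simp only: powr_minus divide_inverse inverse_inverse_eq mult.commute)
qed

lemma kernel_mass_scale:
  assumes "0 < l"
  shows "kernel_mass s (l * \<epsilon>) TYPE('a::euclidean_space) = l powr - (2 * s) * kernel_mass s \<epsilon> TYPE('a)"
proof -
  have "integral\<^sup>L lborel (\<lambda>z::'a. reg_kernel s \<epsilon> ((1 / l) *\<^sub>R z)) = kernel_mass s \<epsilon> TYPE('a) / \<bar>1 / l\<bar> ^ DIM('a)"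
    using lborel_integral_affine[of "1 / l" "reg_kernel s \<epsilon> :: 'a \<Rightarrow> real" 0] assms by simp
  also have "integral\<^sup>L lborel (\<lambda>z::'a. reg_kernel s \<epsilon> ((1 / l) *\<^sub>R z)) = l powr (real DIM('a) + 2 * s) * kernel_mass s (l * \<epsilon>) TYPE('a)"
    unfolding reg_kernel_scale[OF assms] by simp
  finally have "l powr (real DIM('a) + 2 * s) * kernel_mass s (l * \<epsilon>) TYPE('a) = l powr real DIM('a) * kernel_mass s \<epsilon> TYPE('a)"
    using assms by (simp add: powr_realpow power_one_over field_simps)
  then have "l powr - (real DIM('a) + 2 * s) * (l powr (real DIM('a) + 2 * s) * kernel_mass s (l * \<epsilon>) TYPE('a))
    = l powr - (real DIM('a) + 2 * s) * (l powr real DIM('a) * kernel_mass s \<epsilon> TYPE('a))" by (simp only:)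
  then show ?thesis using assms by (simp add: mult.assoc[symmetric] powr_add[symmetric])
qed

text \<open>The operator has order \<open>2 * s\<close>. The dilation also acts on the parameter,
  which is harmless for statements about all small \<epsilon>.\<close>

lemma reg_lap_scale:
  fixes U :: "'a::euclidean_space \<Rightarrow> real"
  assumes "0 < l"
  shows "reg_lap s \<epsilon> (\<lambda>x. U (l *\<^sub>R x)) x = l powr (2 * s) * reg_lap s (l * \<epsilon>) U (l *\<^sub>R x)"
proof -
  define g where "g w = reg_kernel s \<epsilon> ((1 / l) *\<^sub>R (w - l *\<^sub>R x)) * U w" for w
  have "(\<integral>y. reg_kernel s \<epsilon> (y - x) * U (l *\<^sub>R y) \<partial>lborel) = (\<integral>y. g (0 + l *\<^sub>R y) \<partial>lborel)"
    using assms by (simp add: g_def scaleR_diff_right)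
  also have "\<dots> = (\<integral>w. g w \<partial>lborel) / \<bar>l\<bar> ^ DIM('a)"
    using assms by (intro lborel_integral_affine) simp
  also have "(\<integral>w. g w \<partial>lborel) = l powr (real DIM('a) + 2 * s) * (\<integral>w. reg_kernel s (l * \<epsilon>) (w - l *\<^sub>R x) * U w \<partial>lborel)"
    unfolding g_def reg_kernel_scale[OF assms] by (simp add: mult.assoc)
  also have "\<dots> / \<bar>l\<bar> ^ DIM('a) = l powr (2 * s) * (\<integral>w. reg_kernel s (l * \<epsilon>) (w - l *\<^sub>R x) * U w \<partial>lborel)"
    using assms by (simp add: powr_add powr_realpow)
  finally have 1: "(\<integral>y. reg_kernel s \<epsilon> (y - x) * U (l *\<^sub>R y) \<partial>lborel) = l powr (2 * s) * (\<integral>w. reg_kernel s (l * \<epsilon>) (w - l *\<^sub>R x) * U w \<partial>lborel)" .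
  have "kernel_mass s \<epsilon> TYPE('a) = l powr (2 * s) * kernel_mass s (l * \<epsilon>) TYPE('a)"
    using assms by (simp add: kernel_mass_scale mult.assoc[symmetric] powr_add[symmetric])
  then show ?thesis by (simp only: reg_lap_def 1 right_diff_distrib mult.assoc)
qed

text \<open>Only dimension plus \<open>2 * s\<close> enters the exponent, so losing one coordinate
  raises s by 1/2; the coordinate held fixed joins the parameter.\<close>

lemma reg_kernel_Pair:
  fixes x :: "'a::euclidean_space" and t :: real
  assumes "0 < \<epsilon>"
  shows "reg_kernel s \<epsilon> (x, t) = reg_kernel (s + 1 / 2) (sqrt (t\<^sup>2 + \<epsilon>\<^sup>2)) x"
proof -
  have "(norm (x, t))\<^sup>2 = (norm x)\<^sup>2 + t\<^sup>2" by (simp add: norm_Pair)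
  then show ?thesis by (simp add: reg_kernel_def algebra_simps)
qed

text \<open>By \<open>reg_kernel_Pair\<close> the variable t only dilates the parameter, and
  \<open>kernel_mass_scale\<close> produces the power \<open>- (2 * s + 1)\<close> of
  \<open>sqrt (t\<^sup>2 + \<epsilon>\<^sup>2)\<close>. This is the one-dimensional kernel with the
  same s and \<epsilon>.\<close>

lemma kernel_marginal:
  assumes "0 < s" "0 < \<epsilon>"
  shows "integral\<^sup>L lborel (\<lambda>x::'a::euclidean_space. reg_kernel s \<epsilon> (x, t::real)) = kernel_mass (s + 1 / 2) 1 TYPE('a) * reg_kernel s \<epsilon> t"
proof -
  define \<rho> where "\<rho> = sqrt (t\<^sup>2 + \<epsilon>\<^sup>2)"
  have p: "0 < t\<^sup>2 + \<epsilon>\<^sup>2" using assms by (simp add: add_nonneg_pos)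
  then have \<rho>: "0 < \<rho>" by (simp add: \<rho>_def)
  have "integral\<^sup>L lborel (\<lambda>x::'a. reg_kernel s \<epsilon> (x, t)) = kernel_mass (s + 1 / 2) (\<rho> * 1) TYPE('a)"
    by (simp add: reg_kernel_Pair[OF assms(2)] \<rho>_def)
  also have "\<dots> = \<rho> powr - (2 * (s + 1 / 2)) * kernel_mass (s + 1 / 2) 1 TYPE('a)" by (rule kernel_mass_scale[OF \<rho>])
  also have "\<rho> powr - (2 * (s + 1 / 2)) = reg_kernel s \<epsilon> t"
  proof -
    have "\<rho> = (t\<^sup>2 + \<epsilon>\<^sup>2) powr (1 / 2)" using p by (simp add: \<rho>_def powr_half_sqrt)
    then have "\<rho> powr - (2 * (s + 1 / 2)) = (t\<^sup>2 + \<epsilon>\<^sup>2) powr (1 / 2 * - (2 * (s + 1 / 2)))" by (simp only: powr_powr)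
    also have "1 / 2 * - (2 * (s + 1 / 2)) = - ((real DIM(real) + 2 * s) / 2)" by (simp add: field_simps)
    finally show ?thesis by (simp only: reg_kernel_def real_norm_def power2_abs)
  qed
  finally show ?thesis by (simp add: mult.commute)
qed

lemma kernel_mass_pos:
  assumes "0 < s" shows "0 < kernel_mass s 1 TYPE('a::euclidean_space)"
proof -
  have i: "integrable lborel (indicator (cball 0 1) :: 'a \<Rightarrow> real)"
    by (intro integrable_real_indicator emeasure_lborel_cball_finite) auto
  let ?c = "2 powr (- ((real DIM('a) + 2 * s) / 2))"
  have "0 < ?c * measure lborel (cball (0::'a) 1)" by (intro mult_pos_pos) auto
  also have "\<dots> = integral\<^sup>L lborel (\<lambda>x::'a. ?c * indicator (cball 0 1) x)" using i by simp
  also have "\<dots> \<le> kernel_mass s 1 TYPE('a)"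
  proof (rule integral_mono[OF _ reg_kernel_integrable[OF assms]])
    show "integrable lborel (\<lambda>x::'a. ?c * indicator (cball 0 1) x)" using i by simp
    fix x :: 'a
    show "?c * indicator (cball 0 1) x \<le> reg_kernel s 1 x"
    proof (cases "norm x \<le> 1")
      case True
      then have "(norm x)\<^sup>2 + 1\<^sup>2 \<le> 2" by (simp add: power_le_one)
      then have "?c \<le> reg_kernel s 1 x" unfolding reg_kernel_def using assms
        by (intro powr_mono2') (auto simp: add_nonneg_pos)
      then show ?thesis using True by simp
    qed simp
  qed simp
  finally show ?thesis .
qed

text \<open>This integral measures the averaging error at radius R. It tends to 0 along integer
  radii, dominated by its integrand at \<open>R = 1\<close>.\<close>

lemma norm_powr_min_vanishes:
  assumes s: "0 < s" "s < 1" and "0 < \<eta>"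
  shows "\<exists>R>0. integral\<^sup>L lborel (\<lambda>z::'a::euclidean_space. min 1 ((norm z)\<^sup>2 / R\<^sup>2) * singular_kernel s z) \<le> \<eta>
    \<and> integrable lborel (\<lambda>z::'a. min 1 ((norm z)\<^sup>2 / R\<^sup>2) * singular_kernel s z)"
proof -
  let ?k = "\<lambda>z::'a. singular_kernel s z"
  have w: "integrable lborel (\<lambda>z. min 1 (norm z powr 2) * ?k z)" using s by (intro integrable_min_norm_powr) auto
  have bd: "norm (min 1 ((norm z)\<^sup>2 / (real (Suc n))\<^sup>2) * ?k z) \<le> min 1 (norm z powr 2) * ?k z" for n and z :: 'a
  proof (cases "z = 0")
    case False
    have "(norm z)\<^sup>2 / (real (Suc n))\<^sup>2 \<le> (norm z)\<^sup>2 / 1" by (intro divide_left_mono) auto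
    then have "min 1 ((norm z)\<^sup>2 / (real (Suc n))\<^sup>2) \<le> min 1 (norm z powr 2)" using False by (simp add: powr_numeral min.coboundedI2)
    then show ?thesis using mult_right_mono[of "min 1 ((norm z)\<^sup>2 / (real (Suc n))\<^sup>2)" "min 1 (norm z powr 2)" "?k z"]
      by (simp add: abs_mult)
  qed simp
  have "(\<lambda>n. integral\<^sup>L lborel (\<lambda>z. min 1 ((norm z)\<^sup>2 / (real (Suc n))\<^sup>2) * ?k z)) \<longlonglongrightarrow> integral\<^sup>L lborel (\<lambda>z::'a. 0)"
  proof (rule integral_dominated_convergence[OF _ _ w])
    show "AE z in lborel. (\<lambda>n. min 1 ((norm z)\<^sup>2 / (real (Suc n))\<^sup>2) * ?k z) \<longlonglongrightarrow> 0"
    proof (rule AE_I2)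
      fix z :: 'a
      have "(\<lambda>n. (norm z)\<^sup>2 * (inverse (real (Suc n)))\<^sup>2) \<longlonglongrightarrow> (norm z)\<^sup>2 * 0\<^sup>2"
        by (intro tendsto_intros LIMSEQ_inverse_real_of_nat)
      then have "(\<lambda>n. (norm z)\<^sup>2 / (real (Suc n))\<^sup>2) \<longlonglongrightarrow> 0" by (simp add: divide_inverse power_inverse)
      then have "(\<lambda>n. min 1 ((norm z)\<^sup>2 / (real (Suc n))\<^sup>2) * ?k z) \<longlonglongrightarrow> min 1 0 * ?k z" by (intro tendsto_intros)
      then show "(\<lambda>n. min 1 ((norm z)\<^sup>2 / (real (Suc n))\<^sup>2) * ?k z) \<longlonglongrightarrow> 0" by simp
    qed
    show "AE z in lborel. norm (min 1 ((norm z)\<^sup>2 / (real (Suc n))\<^sup>2) * ?k z) \<le> min 1 (norm z powr 2) * ?k z" for n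
      by (rule AE_I2) (rule bd)
  qed simp_all
  then have "\<forall>\<^sub>F n in sequentially. integral\<^sup>L lborel (\<lambda>z. min 1 ((norm z)\<^sup>2 / (real (Suc n))\<^sup>2) * ?k z) < \<eta>"
    using assms by (intro order_tendstoD) auto
  then obtain n where n: "integral\<^sup>L lborel (\<lambda>z. min 1 ((norm z)\<^sup>2 / (real (Suc n))\<^sup>2) * ?k z) < \<eta>"
    by (auto simp: eventually_sequentially)
  have "integrable lborel (\<lambda>z. min 1 ((norm z)\<^sup>2 / (real (Suc n))\<^sup>2) * ?k z)"
  proof (rule Bochner_Integration.integrable_bound[OF w])
    show "AE z in lborel. norm (min 1 ((norm z)\<^sup>2 / (real (Suc n))\<^sup>2) * ?k z) \<le> norm (min 1 (norm z powr 2) * ?k z)"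
      using order_trans[OF bd abs_ge_self] unfolding real_norm_def by (rule AE_I2)
  qed simp
  then show ?thesis using n by (intro exI[of _ "real (Suc n)"]) auto
qed

lemma lborel_reflect_fst:
  fixes g :: "'a::euclidean_space \<times> real \<Rightarrow> real"
  assumes "integrable lborel g" "integrable lborel (\<lambda>z. g (- fst z, snd z))"
  shows "(\<integral>z. g (- fst z, snd z) \<partial>lborel) = (\<integral>z. g z \<partial>lborel)"
proof -
  have f: "(\<integral>z. h z \<partial>lborel) = (\<integral>b. \<integral>a. h (a, b) \<partial>lborel \<partial>lborel)" if "integrable lborel h" for h :: "'a \<times> real \<Rightarrow> real"
    using lborel_pair.integral_snd[of "\<lambda>a b. h (a, b)"] that by (simp add: lborel_prod case_prod_unfold)
  have r: "(\<integral>a. g (- a, b) \<partial>lborel) = (\<integral>a. g (a, b) \<partial>lborel)" for b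
    using lborel_integral_reflect[of "\<lambda>a. g (a, b)" 0] by simp
  show ?thesis unfolding f[OF assms(1)] f[OF assms(2)] by (simp add: r)
qed

section \<open>The tangential average and its equation\<close>

definition tangential_average :: "real \<Rightarrow> ('a::euclidean_space \<times> real \<Rightarrow> real) \<Rightarrow> real \<Rightarrow> real" where
  "tangential_average R u t = (\<integral>x. bump ((1 / R) *\<^sub>R x) * u (x, t) \<partial>lborel) / integral\<^sup>L lborel (\<lambda>x::'a. bump ((1 / R) *\<^sub>R x))"

context
  fixes R :: real and u :: "'a::euclidean_space \<times> real \<Rightarrow> real" and M :: real
  assumes R: "0 < R" and u_meas [measurable]: "u \<in> borel_measurable borel"
    and u_nonneg: "\<And>z. 0 \<le> u z" and u_le: "\<And>z. u z \<le> M"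
begin

abbreviation cutoff :: "'a \<Rightarrow> real" where "cutoff x \<equiv> bump ((1 / R) *\<^sub>R x)"
abbreviation cutoff_mass :: "'a itself \<Rightarrow> real" where "cutoff_mass _ \<equiv> integral\<^sup>L lborel (\<lambda>x::'a. cutoff x)"

lemma u_abs: "\<bar>u z\<bar> \<le> M" using u_nonneg[of z] u_le[of z] by simp

lemma M_nonneg: "0 \<le> M" using order_trans[OF u_nonneg u_le] .

lemma cutoff_integrable: "integrable lborel cutoff"
  using lborel_integrable_affine_iff[of "1 / R" "bump :: 'a \<Rightarrow> real" 0] R bump_integrable by simp

lemma cutoff_mass_eq: "cutoff_mass TYPE('a) = integral\<^sup>L lborel (bump :: 'a \<Rightarrow> real) * R ^ DIM('a)"
  using lborel_integral_affine[of "1 / R" "bump :: 'a \<Rightarrow> real" 0] R by (simp add: power_one_over)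

lemma cutoff_mass_pos: "0 < cutoff_mass TYPE('a)"
  unfolding cutoff_mass_eq using R bump_integral_pos[where 'a = 'a] by simp

lemma cutoff_times_integrable:
  assumes "g \<in> borel_measurable borel" "\<And>x. \<bar>g x\<bar> \<le> B"
  shows "integrable lborel (\<lambda>x. cutoff x * g x)"
  using assms by (intro integrable_mult_bounded(2)[OF cutoff_integrable, where C = B]) auto

lemma slice_measurable: "(\<lambda>y. u (y, c)) \<in> borel_measurable borel"
  by measurable

lemma slice_integrable: "integrable lborel (\<lambda>x. cutoff x * u (x + a, t))"
  using u_abs by (intro cutoff_times_integrable[where B = M]) auto

lemma slice_integrable0: "integrable lborel (\<lambda>x. cutoff x * u (x, t))"
  using slice_integrable[of 0 t] by simp

lemma snd_borel [measurable]: "(snd :: 'a \<times> real \<Rightarrow> real) \<in> borel_measurable borel"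
  by (intro borel_measurable_continuous_onI continuous_intros)

lemma average_measurable: "tangential_average R u \<in> borel_measurable borel"
  unfolding tangential_average_def[abs_def] by measurable

lemma average_bounds: "0 \<le> tangential_average R u t" "tangential_average R u t \<le> M"
proof -
  show "0 \<le> tangential_average R u t"
    unfolding tangential_average_def using u_nonneg cutoff_mass_pos
    by (intro divide_nonneg_pos integral_nonneg_AE AE_I2 mult_nonneg_nonneg) auto
  have "(\<integral>x. cutoff x * u (x, t) \<partial>lborel) \<le> (\<integral>x. cutoff x * M \<partial>lborel)"
    using cutoff_integrable slice_integrable0 u_le by (intro integral_mono) (auto intro: mult_left_mono)
  then show "tangential_average R u t \<le> M"
    unfolding tangential_average_def using cutoff_mass_pos by (simp add: field_simps)
qed

lemma average_le:
  assumes "\<And>x. norm x \<le> R \<Longrightarrow> u (x, t) \<le> \<eta>"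
  shows "tangential_average R u t \<le> \<eta>"
proof -
  have "cutoff x * u (x, t) \<le> cutoff x * \<eta>" for x
  proof (cases "norm x \<le> R")
    case True then show ?thesis using assms by (intro mult_left_mono) auto
  next
    case False
    then have "1 \<le> norm ((1 / R) *\<^sub>R x)" using R by (simp add: field_simps)
    then show ?thesis by (simp only: bump_eq_0)
  qed
  then have "(\<integral>x. cutoff x * u (x, t) \<partial>lborel) \<le> (\<integral>x. cutoff x * \<eta> \<partial>lborel)"
    using cutoff_integrable slice_integrable0 by (intro integral_mono) auto
  then show ?thesis
    unfolding tangential_average_def using cutoff_mass_pos by (simp add: field_simps)
qed

text \<open>Convolving in all variables and averaging in the tangential ones combine into one
  integral of the kernel against this function of the translation z.\<close>

definition slice_mean :: "'a \<times> real \<Rightarrow> real \<Rightarrow> real" where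
  "slice_mean z t = (\<integral>x. cutoff x * u (x + fst z, t + snd z) \<partial>lborel)"

lemma slice_mean_measurable [measurable]: "(\<lambda>z. slice_mean z t) \<in> borel_measurable borel"
proof -
  have "slice_mean z t = (\<integral>x. cutoff x * u ((x, t) + z) \<partial>lborel)" for z
    by (simp add: slice_mean_def plus_prod_def)
  moreover have "(\<lambda>z. \<integral>x. cutoff x * u ((x, t) + z) \<partial>lborel) \<in> borel_measurable borel" by measurable
  ultimately show ?thesis by (simp only:)
qed

lemma slice_mean_bound: "\<bar>slice_mean z t\<bar> \<le> M * cutoff_mass TYPE('a)"
proof -
  have "\<bar>slice_mean z t\<bar> \<le> (\<integral>x. \<bar>cutoff x * u (x + fst z, t + snd z)\<bar> \<partial>lborel)"
    unfolding slice_mean_def by (rule integral_abs_bound)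
  also have "\<dots> \<le> (\<integral>x. cutoff x * M \<partial>lborel)"
    using cutoff_integrable integrable_abs[OF slice_integrable] u_abs
    by (intro integral_mono) (auto simp: abs_mult intro: mult_left_mono)
  finally show ?thesis by (simp add: mult.commute)
qed

text \<open>The tangential translation is moved from u to the cutoff, so that only the bound M for u
  enters. Rescaling by R gives the factor \<open>R ^ DIM('a)\<close> and the ratio of
  \<open>norm a\<close> to R.\<close>

lemma slice_mean_second_difference:
  assumes C: "\<And>h::'a. integral\<^sup>L lborel (\<lambda>w. \<bar>bump (w + h) + bump (w - h) - 2 * bump w\<bar>) \<le> C * min 1 ((norm h)\<^sup>2)"
  shows "\<bar>slice_mean (a, b) t + slice_mean (- a, b) t - 2 * slice_mean (0, b) t\<bar> \<le> M * (R ^ DIM('a) * (C * min 1 ((norm a)\<^sup>2 / R\<^sup>2)))"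
proof -
  have sh: "slice_mean (c, b) t = (\<integral>y. cutoff (y - c) * u (y, t + b) \<partial>lborel)" for c
    using lborel_integral_diff[of "\<lambda>x. cutoff x * u (x + c, t + b)" c] by (simp add: slice_mean_def)
  have i: "integrable lborel (\<lambda>y. cutoff (y - c) * u (y, t + b))" for c
    using lborel_integrable_diff_iff[of "\<lambda>x. cutoff x * u (x + c, t + b)" c] slice_integrable[of c "t + b"] by simp
  let ?\<Delta> = "\<lambda>y. cutoff (y - a) + cutoff (y + a) - 2 * cutoff y"
  have \<Delta>i: "integrable lborel ?\<Delta>"
    using lborel_integrable_diff_iff[of cutoff a] lborel_integrable_add_iff[of cutoff a] cutoff_integrable
    by (intro Bochner_Integration.integrable_diff Bochner_Integration.integrable_add integrable_mult_right) (simp_all only: add.commute)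
  have eq: "slice_mean (a, b) t + slice_mean (- a, b) t - 2 * slice_mean (0, b) t = (\<integral>y. ?\<Delta> y * u (y, t + b) \<partial>lborel)"
  proof -
    have "slice_mean (a, b) t + slice_mean (- a, b) t - 2 * slice_mean (0, b) t =
       (\<integral>y. cutoff (y - a) * u (y, t + b) + cutoff (y - (- a)) * u (y, t + b) - 2 * (cutoff (y - 0) * u (y, t + b)) \<partial>lborel)"
      unfolding sh Bochner_Integration.integral_diff[OF Bochner_Integration.integrable_add[OF i[of a] i[of "- a"]] integrable_mult_right[OF i[of 0]]]
        Bochner_Integration.integral_add[OF i[of a] i[of "- a"]] by simp
    also have "\<dots> = (\<integral>y. ?\<Delta> y * u (y, t + b) \<partial>lborel)"
      by (intro Bochner_Integration.integral_cong refl)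
        (simp only: diff_minus_eq_add diff_zero left_diff_distrib distrib_right mult.assoc)
    finally show ?thesis .
  qed
  have "\<bar>(\<integral>y. ?\<Delta> y * u (y, t + b) \<partial>lborel)\<bar> \<le> (\<integral>y. \<bar>?\<Delta> y * u (y, t + b)\<bar> \<partial>lborel)" by (rule integral_abs_bound)
  also have "\<dots> \<le> (\<integral>y. M * \<bar>?\<Delta> y\<bar> \<partial>lborel)"
  proof (rule integral_mono)
    have "integrable lborel (\<lambda>y. ?\<Delta> y * u (y, t + b))"
    proof (rule integrable_mult_bounded(2)[OF \<Delta>i])
      show "(\<lambda>y. u (y, t + b)) \<in> borel_measurable lborel" by (simp add: slice_measurable)
    qed (rule u_abs)
    then show "integrable lborel (\<lambda>y. \<bar>?\<Delta> y * u (y, t + b)\<bar>)" by (rule integrable_abs)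
    show "integrable lborel (\<lambda>y. M * \<bar>?\<Delta> y\<bar>)" using integrable_abs[OF \<Delta>i] by (rule integrable_mult_right)
    show "\<bar>?\<Delta> y * u (y, t + b)\<bar> \<le> M * \<bar>?\<Delta> y\<bar>" for y
    proof -
      have "\<bar>u (y, t + b)\<bar> * \<bar>?\<Delta> y\<bar> \<le> M * \<bar>?\<Delta> y\<bar>" using u_abs by (intro mult_right_mono) auto
      then show ?thesis by (simp only: abs_mult mult.commute)
    qed
  qed
  also have "\<dots> = M * (\<integral>y. \<bar>?\<Delta> y\<bar> \<partial>lborel)" by (rule integral_mult_right_zero)
  also have "\<dots> \<le> M * (R ^ DIM('a) * (C * min 1 ((norm a)\<^sup>2 / R\<^sup>2)))"
  proof (intro mult_left_mono M_nonneg)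
    let ?h = "(1 / R) *\<^sub>R a"
    let ?f = "\<lambda>w::'a. \<bar>bump (w + ?h) + bump (w - ?h) - 2 * bump w\<bar>"
    have "(\<integral>y. \<bar>?\<Delta> y\<bar> \<partial>lborel) = (\<integral>y. ?f (0 + (1 / R) *\<^sub>R y) \<partial>lborel)"
      by (intro Bochner_Integration.integral_cong refl) (simp add: scaleR_add_right scaleR_diff_right algebra_simps)
    also have "\<dots> = (\<integral>w. ?f w \<partial>lborel) / \<bar>1 / R\<bar> ^ DIM('a)" using R by (intro lborel_integral_affine) simp
    also have "\<dots> = R ^ DIM('a) * (\<integral>w. ?f w \<partial>lborel)" using R by (simp add: power_one_over)
    also have "\<dots> \<le> R ^ DIM('a) * (C * min 1 ((norm ?h)\<^sup>2))" using C[of ?h] R by (intro mult_left_mono) auto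
    also have "(norm ?h)\<^sup>2 = (norm a)\<^sup>2 / R\<^sup>2" using R by (simp add: power_divide)
    finally show "(\<integral>y. \<bar>?\<Delta> y\<bar> \<partial>lborel) \<le> R ^ DIM('a) * (C * min 1 ((norm a)\<^sup>2 / R\<^sup>2))" .
  qed
  finally show ?thesis unfolding eq .
qed

context
  fixes s \<epsilon> :: real
  assumes s: "0 < s" and \<epsilon>: "0 < \<epsilon>"
begin

lemma kernel_times_bounded_integrable_prod:
  assumes [measurable]: "g \<in> borel_measurable borel" and g: "\<And>z. \<bar>g z\<bar> \<le> B"
  shows "integrable lborel (\<lambda>z :: 'a \<times> real. reg_kernel s \<epsilon> z * g z)"
  using g by (intro integrable_mult_bounded(2)[OF reg_kernel_integrable[OF s \<epsilon>], where C = B]) auto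

lemma average_of_convolution:
  "(\<integral>x. cutoff x * (\<integral>y. reg_kernel s \<epsilon> (y - (x, t)) * u y \<partial>lborel) \<partial>lborel) = (\<integral>z. reg_kernel s \<epsilon> z * slice_mean z t \<partial>lborel)"
  "integrable lborel (\<lambda>x. cutoff x * (\<integral>y. reg_kernel s \<epsilon> (y - (x, t)) * u y \<partial>lborel))"
proof -
  have e: "(\<integral>y. reg_kernel s \<epsilon> (y - (x, t)) * u y \<partial>lborel) = (\<integral>z. reg_kernel s \<epsilon> z * u ((x, t) + z) \<partial>lborel)" for x
    using lborel_integral_add[of "\<lambda>y. reg_kernel s \<epsilon> (y - (x, t)) * u y" "(x, t)"] by simp
  have P: "integrable (lborel \<Otimes>\<^sub>M lborel) (\<lambda>(x, z). cutoff x * (reg_kernel s \<epsilon> z * u ((x, t) + z)))"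
  proof (rule Bochner_Integration.integrable_bound)
    show "integrable (lborel \<Otimes>\<^sub>M lborel) (\<lambda>p. M * (case p of (x, z) \<Rightarrow> cutoff x * reg_kernel s \<epsilon> (z :: 'a \<times> real)))"
      by (intro integrable_mult_right integrable_tensor_product cutoff_integrable reg_kernel_integrable[OF s \<epsilon>])
    show "(\<lambda>(x, z). cutoff x * (reg_kernel s \<epsilon> z * u ((x, t) + z))) \<in> borel_measurable (lborel \<Otimes>\<^sub>M lborel)" by measurable
    have "\<bar>cutoff x * (reg_kernel s \<epsilon> z * u ((x, t) + z))\<bar> \<le> \<bar>M * (cutoff x * reg_kernel s \<epsilon> z)\<bar>" for x z
    proof -
      have "cutoff x * reg_kernel s \<epsilon> z * \<bar>u ((x, t) + z)\<bar> \<le> cutoff x * reg_kernel s \<epsilon> z * M" using u_abs by (intro mult_left_mono) auto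
      then show ?thesis using M_nonneg by (simp add: abs_mult mult_ac)
    qed
    then show "AE p in lborel \<Otimes>\<^sub>M lborel. norm (case p of (x, z) \<Rightarrow> cutoff x * (reg_kernel s \<epsilon> z * u ((x, t) + z)))
       \<le> norm (M * (case p of (x, z) \<Rightarrow> cutoff x * reg_kernel s \<epsilon> (z :: 'a \<times> real)))" by auto
  qed
  have inner: "(\<integral>x. cutoff x * (reg_kernel s \<epsilon> z * u ((x, t) + z)) \<partial>lborel) = reg_kernel s \<epsilon> z * slice_mean z t" for z
  proof -
    have "(\<integral>x. cutoff x * (reg_kernel s \<epsilon> z * u ((x, t) + z)) \<partial>lborel) = (\<integral>x. reg_kernel s \<epsilon> z * (cutoff x * u (x + fst z, t + snd z)) \<partial>lborel)"
      by (intro Bochner_Integration.integral_cong refl) (simp add: plus_prod_def)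
    then show ?thesis by (simp add: slice_mean_def)
  qed
  have "(\<integral>x. cutoff x * (\<integral>y. reg_kernel s \<epsilon> (y - (x, t)) * u y \<partial>lborel) \<partial>lborel) = (\<integral>x. \<integral>z. cutoff x * (reg_kernel s \<epsilon> z * u ((x, t) + z)) \<partial>lborel \<partial>lborel)"
    by (simp add: e)
  also have "\<dots> = (\<integral>z. \<integral>x. cutoff x * (reg_kernel s \<epsilon> z * u ((x, t) + z)) \<partial>lborel \<partial>lborel)"
    using lborel_pair.Fubini_integral[OF P] by simp
  finally show "(\<integral>x. cutoff x * (\<integral>y. reg_kernel s \<epsilon> (y - (x, t)) * u y \<partial>lborel) \<partial>lborel) = (\<integral>z. reg_kernel s \<epsilon> z * slice_mean z t \<partial>lborel)"
    by (simp add: inner)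
  show "integrable lborel (\<lambda>x. cutoff x * (\<integral>y. reg_kernel s \<epsilon> (y - (x, t)) * u y \<partial>lborel))"
    using lborel_pair.integrable_fst'[OF P] by (simp add: e)
qed

lemma integrate_out_tangential:
  assumes [measurable]: "g \<in> borel_measurable borel" and g: "\<And>\<sigma>. \<bar>g \<sigma>\<bar> \<le> B"
  shows "(\<integral>z. reg_kernel s \<epsilon> (z :: 'a \<times> real) * g (snd z) \<partial>lborel) = kernel_mass (s + 1 / 2) 1 TYPE('a) * (\<integral>\<sigma>. reg_kernel s \<epsilon> \<sigma> * g \<sigma> \<partial>lborel)"
proof -
  have i: "integrable lborel (\<lambda>z :: 'a \<times> real. reg_kernel s \<epsilon> z * g (snd z))"
  proof (rule kernel_times_bounded_integrable_prod[OF _ g])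
    show "(\<lambda>z :: 'a \<times> real. g (snd z)) \<in> borel_measurable borel"
      by (rule measurable_compose[OF snd_borel]) fact
  qed
  then have "(\<integral>z. reg_kernel s \<epsilon> (z :: 'a \<times> real) * g (snd z) \<partial>lborel) = (\<integral>\<sigma>. \<integral>a. reg_kernel s \<epsilon> (a :: 'a, \<sigma>) * g \<sigma> \<partial>lborel \<partial>lborel)"
    using lborel_pair.integral_snd[of "\<lambda>a \<sigma>. reg_kernel s \<epsilon> (a :: 'a, \<sigma>) * g \<sigma>"] by (simp add: lborel_prod case_prod_unfold)
  also have "\<dots> = (\<integral>\<sigma>. kernel_mass (s + 1 / 2) 1 TYPE('a) * (reg_kernel s \<epsilon> \<sigma> * g \<sigma>) \<partial>lborel)"
    by (simp add: kernel_marginal[OF s \<epsilon>] mult.assoc)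
  finally show ?thesis by simp
qed

text \<open>Dropping the tangential part of the shift in \<open>slice_mean\<close> gives
  \<open>J\<^sub>0\<close>, a multiple of the one-dimensional convolution of the average. The kernel
  is even in the tangential variable, so \<open>J - J\<^sub>0\<close> is half an integral of
  tangential second differences. The resulting bound does not depend on \<epsilon> or t.\<close>

lemma reg_lap_average:
  assumes C: "\<And>h::'a. integral\<^sup>L lborel (\<lambda>w. \<bar>bump (w + h) + bump (w - h) - 2 * bump w\<bar>) \<le> C * min 1 ((norm h)\<^sup>2)"
    and C0: "0 \<le> C"
    and int: "integrable lborel (\<lambda>z :: 'a \<times> real. min 1 ((norm z)\<^sup>2 / R\<^sup>2) * singular_kernel s z)"
  shows "\<bar>kernel_mass (s + 1 / 2) 1 TYPE('a) * reg_lap s \<epsilon> (tangential_average R u) t - (\<integral>x. cutoff x * reg_lap s \<epsilon> u (x, t) \<partial>lborel) / cutoff_mass TYPE('a)\<bar>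
    \<le> M * C / integral\<^sup>L lborel (bump :: 'a \<Rightarrow> real) * integral\<^sup>L lborel (\<lambda>z :: 'a \<times> real. min 1 ((norm z)\<^sup>2 / R\<^sup>2) * singular_kernel s z)"
    (is "\<bar>_\<bar> \<le> M * C / ?H\<^sub>1 * ?I")
    "integrable lborel (\<lambda>x. cutoff x * reg_lap s \<epsilon> u (x, t))"
proof -
  let ?c = "kernel_mass (s + 1 / 2) 1 TYPE('a)"
  let ?\<kappa> = "kernel_mass s \<epsilon> TYPE('a \<times> real)"
  let ?U = "tangential_average R u"
  let ?H = "cutoff_mass TYPE('a)"
  define J where "J = (\<integral>z. reg_kernel s \<epsilon> z * slice_mean z t \<partial>lborel)"
  define J\<^sub>0 where "J\<^sub>0 = integral\<^sup>L lborel (\<lambda>z :: 'a \<times> real. reg_kernel s \<epsilon> z * slice_mean (0, snd z) t)"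
  have split: "cutoff x * reg_lap s \<epsilon> u (x, t) = ?\<kappa> * (cutoff x * u (x, t)) - cutoff x * (\<integral>y. reg_kernel s \<epsilon> (y - (x, t)) * u y \<partial>lborel)" for x
    by (simp add: reg_lap_def algebra_simps)
  show "integrable lborel (\<lambda>x. cutoff x * reg_lap s \<epsilon> u (x, t))"
    unfolding split by (intro Bochner_Integration.integrable_diff integrable_mult_right slice_integrable0 average_of_convolution)
  have A: "(\<integral>x. cutoff x * reg_lap s \<epsilon> u (x, t) \<partial>lborel) = ?\<kappa> * (\<integral>x. cutoff x * u (x, t) \<partial>lborel) - J"
    unfolding split J_def average_of_convolution(1)[symmetric]
    using Bochner_Integration.integral_diff[OF integrable_mult_right[OF slice_integrable0] average_of_convolution(2)] by simp
  have HU: "?H * ?U \<sigma> = (\<integral>x. cutoff x * u (x, \<sigma>) \<partial>lborel)" for \<sigma>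
    unfolding tangential_average_def using cutoff_mass_pos by simp
  have s0: "slice_mean (0, \<sigma>) t = ?H * ?U (t + \<sigma>)" for \<sigma> by (simp add: HU slice_mean_def)
  have Um [measurable]: "?U \<in> borel_measurable borel" by (rule average_measurable)
  have Ub: "\<bar>?U \<sigma>\<bar> \<le> M" for \<sigma> using average_bounds[of \<sigma>] by simp
  have \<kappa>: "?\<kappa> = ?c * kernel_mass s \<epsilon> TYPE(real)"
    using integrate_out_tangential[of "\<lambda>_. 1" 1] by simp
  have J0: "J\<^sub>0 = ?c * ?H * (\<integral>y. reg_kernel s \<epsilon> (y - t) * ?U y \<partial>lborel)"
  proof -
    have "J\<^sub>0 = ?c * (\<integral>\<sigma>. reg_kernel s \<epsilon> \<sigma> * (?H * ?U (t + \<sigma>)) \<partial>lborel)"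
      unfolding J\<^sub>0_def s0
    proof (rule integrate_out_tangential[where g = "\<lambda>\<sigma>. ?H * ?U (t + \<sigma>)"])
      show "\<bar>?H * ?U (t + \<sigma>)\<bar> \<le> ?H * M" for \<sigma>
        using Ub[of "t + \<sigma>"] cutoff_mass_pos by (simp add: abs_mult mult_left_mono)
    qed measurable
    also have "(\<integral>\<sigma>. reg_kernel s \<epsilon> \<sigma> * (?H * ?U (t + \<sigma>)) \<partial>lborel) = (\<integral>\<sigma>. ?H * (reg_kernel s \<epsilon> ((t + \<sigma>) - t) * ?U (t + \<sigma>)) \<partial>lborel)"
      by (intro Bochner_Integration.integral_cong refl) simp
    also have "\<dots> = ?H * (\<integral>\<sigma>. reg_kernel s \<epsilon> ((t + \<sigma>) - t) * ?U (t + \<sigma>) \<partial>lborel)" by (rule integral_mult_right_zero)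
    also have "(\<integral>\<sigma>. reg_kernel s \<epsilon> ((t + \<sigma>) - t) * ?U (t + \<sigma>) \<partial>lborel) = (\<integral>y. reg_kernel s \<epsilon> (y - t) * ?U y \<partial>lborel)"
      by (rule lborel_integral_add)
    finally show ?thesis by simp
  qed
  have key: "?H * (?c * reg_lap s \<epsilon> ?U t) - (\<integral>x. cutoff x * reg_lap s \<epsilon> u (x, t) \<partial>lborel) = J - J\<^sub>0"
  proof -
    have "?H * (?c * reg_lap s \<epsilon> ?U t) = ?c * kernel_mass s \<epsilon> TYPE(real) * (?H * ?U t) - J\<^sub>0"
      unfolding J0 reg_lap_def by (simp add: algebra_simps)
    then show ?thesis unfolding A by (simp only: HU \<kappa>)
  qed
  have i1: "integrable lborel (\<lambda>z. reg_kernel s \<epsilon> z * slice_mean z t)"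
    by (rule kernel_times_bounded_integrable_prod[OF _ slice_mean_bound]) measurable
  have i2: "integrable lborel (\<lambda>z :: 'a \<times> real. reg_kernel s \<epsilon> z * slice_mean (- fst z, snd z) t)"
    by (intro kernel_times_bounded_integrable_prod[OF measurable_compose[OF _ slice_mean_measurable] slice_mean_bound]
        borel_measurable_continuous_onI continuous_intros)
  have i0: "integrable lborel (\<lambda>z :: 'a \<times> real. reg_kernel s \<epsilon> z * slice_mean (0, snd z) t)"
    by (intro kernel_times_bounded_integrable_prod[OF measurable_compose[OF _ slice_mean_measurable] slice_mean_bound]
        borel_measurable_continuous_onI continuous_intros)
  have Kr: "reg_kernel s \<epsilon> (- fst z, snd z) = reg_kernel s \<epsilon> z" for z :: "'a \<times> real"
    by (simp add: reg_kernel_def norm_prod_def)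
  have J2: "J = (\<integral>z. reg_kernel s \<epsilon> z * slice_mean (- fst z, snd z) t \<partial>lborel)"
    unfolding J_def using lborel_reflect_fst[of "\<lambda>z. reg_kernel s \<epsilon> z * slice_mean z t"] i1 i2 by (simp add: Kr)
  have eq: "2 * (J - J\<^sub>0) = (\<integral>z. reg_kernel s \<epsilon> z * slice_mean z t + reg_kernel s \<epsilon> z * slice_mean (- fst z, snd z) t - 2 * (reg_kernel s \<epsilon> z * slice_mean (0, snd z) t) \<partial>lborel)"
    using i1 i2 i0 J2 by (simp add: J_def[symmetric] J\<^sub>0_def[symmetric])
  have "\<bar>2 * (J - J\<^sub>0)\<bar> \<le> (\<integral>z. \<bar>reg_kernel s \<epsilon> z * slice_mean z t + reg_kernel s \<epsilon> z * slice_mean (- fst z, snd z) t - 2 * (reg_kernel s \<epsilon> z * slice_mean (0, snd z) t)\<bar> \<partial>lborel)"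
    unfolding eq by (rule integral_abs_bound)
  also have "\<dots> \<le> integral\<^sup>L lborel (\<lambda>z :: 'a \<times> real. M * (R ^ DIM('a) * C) * (min 1 ((norm z)\<^sup>2 / R\<^sup>2) * singular_kernel s z))"
  proof (rule integral_mono)
    show "integrable lborel (\<lambda>z. \<bar>reg_kernel s \<epsilon> z * slice_mean z t + reg_kernel s \<epsilon> z * slice_mean (- fst z, snd z) t - 2 * (reg_kernel s \<epsilon> z * slice_mean (0, snd z) t)\<bar>)"
      using i1 i2 i0 by (intro integrable_abs Bochner_Integration.integrable_diff Bochner_Integration.integrable_add integrable_mult_right)
    show "integrable lborel (\<lambda>z :: 'a \<times> real. M * (R ^ DIM('a) * C) * (min 1 ((norm z)\<^sup>2 / R\<^sup>2) * singular_kernel s z))"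
      using int by (rule integrable_mult_right)
    fix z :: "'a \<times> real"
    show "\<bar>reg_kernel s \<epsilon> z * slice_mean z t + reg_kernel s \<epsilon> z * slice_mean (- fst z, snd z) t - 2 * (reg_kernel s \<epsilon> z * slice_mean (0, snd z) t)\<bar>
      \<le> M * (R ^ DIM('a) * C) * (min 1 ((norm z)\<^sup>2 / R\<^sup>2) * singular_kernel s z)"
    proof (cases "z = 0")
      case False
      let ?S = "slice_mean (fst z, snd z) t + slice_mean (- fst z, snd z) t - 2 * slice_mean (0, snd z) t"
      have "(norm (fst z))\<^sup>2 / R\<^sup>2 \<le> (norm z)\<^sup>2 / R\<^sup>2" using norm_fst_le[of "fst z" "snd z"] by (intro divide_right_mono power_mono) auto
      then have "M * (R ^ DIM('a) * (C * min 1 ((norm (fst z))\<^sup>2 / R\<^sup>2))) \<le> M * (R ^ DIM('a) * (C * min 1 ((norm z)\<^sup>2 / R\<^sup>2)))"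
        using M_nonneg R C0 by (intro mult_left_mono) auto
      then have S: "\<bar>?S\<bar> \<le> M * (R ^ DIM('a) * (C * min 1 ((norm z)\<^sup>2 / R\<^sup>2)))"
        using slice_mean_second_difference[OF C, of "fst z" "snd z" t] by linarith
      have "reg_kernel s \<epsilon> z * slice_mean z t + reg_kernel s \<epsilon> z * slice_mean (- fst z, snd z) t - 2 * (reg_kernel s \<epsilon> z * slice_mean (0, snd z) t) = reg_kernel s \<epsilon> z * ?S"
        by (simp add: algebra_simps)
      then have "\<bar>reg_kernel s \<epsilon> z * slice_mean z t + reg_kernel s \<epsilon> z * slice_mean (- fst z, snd z) t - 2 * (reg_kernel s \<epsilon> z * slice_mean (0, snd z) t)\<bar> = reg_kernel s \<epsilon> z * \<bar>?S\<bar>"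
        by (simp only: abs_mult abs_of_nonneg[OF reg_kernel_nonneg])
      also have "\<dots> \<le> singular_kernel s z * (M * (R ^ DIM('a) * (C * min 1 ((norm z)\<^sup>2 / R\<^sup>2))))"
        using reg_kernel_le[OF s False, of \<epsilon>] S by (intro mult_mono) auto
      also have "\<dots> = M * (R ^ DIM('a) * C) * (min 1 ((norm z)\<^sup>2 / R\<^sup>2) * singular_kernel s z)"
        by (simp only: mult_ac)
      finally show ?thesis .
    next
      case True
      have "slice_mean (0 :: 'a \<times> real) t = slice_mean (0, 0) t" by (simp add: zero_prod_def)
      then show ?thesis using True by simp
    qed
  qed
  also have "\<dots> = M * (R ^ DIM('a) * C) * ?I" by (rule integral_mult_right_zero)
  finally have "\<bar>2 * (J - J\<^sub>0)\<bar> \<le> M * (R ^ DIM('a) * C) * ?I" .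
  then have "\<bar>J - J\<^sub>0\<bar> \<le> M * (R ^ DIM('a) * C) * ?I"
    by (rule order_trans[rotated]) simp
  then have "\<bar>J - J\<^sub>0\<bar> / ?H \<le> M * (R ^ DIM('a) * C) * ?I / ?H" using cutoff_mass_pos by (intro divide_right_mono) auto
  also have "\<dots> = M * C / ?H\<^sub>1 * ?I" unfolding cutoff_mass_eq using R by simp
  also have "\<bar>J - J\<^sub>0\<bar> / ?H = \<bar>?c * reg_lap s \<epsilon> ?U t - (\<integral>x. cutoff x * reg_lap s \<epsilon> u (x, t) \<partial>lborel) / ?H\<bar>"
  proof -
    have "?c * reg_lap s \<epsilon> ?U t - (\<integral>x. cutoff x * reg_lap s \<epsilon> u (x, t) \<partial>lborel) / ?H = (J - J\<^sub>0) / ?H"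
      unfolding key[symmetric] using cutoff_mass_pos by (simp add: diff_divide_distrib)
    then show ?thesis using cutoff_mass_pos by simp
  qed
  finally show "\<bar>?c * reg_lap s \<epsilon> ?U t - (\<integral>x. cutoff x * reg_lap s \<epsilon> u (x, t) \<partial>lborel) / ?H\<bar> \<le> M * C / ?H\<^sub>1 * ?I" .
qed

text \<open>The right-hand side is affine in u and therefore commutes with averaging. The cutoff
  sees only points with \<open>norm x \<le> R\<close>.\<close>

lemma average_equation:
  assumes i: "integrable lborel (\<lambda>x. cutoff x * reg_lap s \<epsilon> u (x, t))"
    and eq: "\<And>x. norm x \<le> R \<Longrightarrow> \<bar>reg_lap s \<epsilon> u (x, t) - (u (x, t) - 1)\<bar> \<le> \<eta>"
  shows "\<bar>(\<integral>x. cutoff x * reg_lap s \<epsilon> u (x, t) \<partial>lborel) / cutoff_mass TYPE('a) - (tangential_average R u t - 1)\<bar> \<le> \<eta>"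
proof -
  let ?d = "\<lambda>x. cutoff x * reg_lap s \<epsilon> u (x, t) - (cutoff x * u (x, t) - cutoff x)"
  have id: "integrable lborel ?d" using i slice_integrable0 cutoff_integrable
    by (intro Bochner_Integration.integrable_diff)
  have pw: "\<bar>?d x\<bar> \<le> \<eta> * cutoff x" for x
  proof (cases "norm x \<le> R")
    case True
    have "?d x = cutoff x * (reg_lap s \<epsilon> u (x, t) - (u (x, t) - 1))" by (simp add: algebra_simps)
    then have "\<bar>?d x\<bar> = cutoff x * \<bar>reg_lap s \<epsilon> u (x, t) - (u (x, t) - 1)\<bar>" by (simp only: abs_mult abs_of_nonneg[OF bump_nonneg])
    also have "\<dots> \<le> cutoff x * \<eta>" using eq[OF True] by (intro mult_left_mono) auto
    finally show ?thesis by (simp only: mult.commute)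
  next
    case False
    then have "1 \<le> norm ((1 / R) *\<^sub>R x)" using R by (simp add: field_simps)
    then show ?thesis by (simp add: bump_eq_0 del: norm_scaleR)
  qed
  have "(\<integral>x. ?d x \<partial>lborel) = (\<integral>x. cutoff x * reg_lap s \<epsilon> u (x, t) \<partial>lborel) - ((\<integral>x. cutoff x * u (x, t) \<partial>lborel) - cutoff_mass TYPE('a))"
    using i slice_integrable0[of t] cutoff_integrable by simp
  moreover have "\<bar>(\<integral>x. ?d x \<partial>lborel)\<bar> \<le> \<eta> * cutoff_mass TYPE('a)"
  proof -
    have "\<bar>(\<integral>x. ?d x \<partial>lborel)\<bar> \<le> (\<integral>x. \<bar>?d x\<bar> \<partial>lborel)" by (rule integral_abs_bound)
    also have "\<dots> \<le> (\<integral>x. \<eta> * cutoff x \<partial>lborel)"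
      using integrable_mult_right[OF cutoff_integrable] by (intro integral_mono integrable_abs[OF id] pw)
    also have "\<dots> = \<eta> * cutoff_mass TYPE('a)" by (rule integral_mult_right_zero)
    finally show ?thesis .
  qed
  ultimately have "\<bar>(\<integral>x. cutoff x * reg_lap s \<epsilon> u (x, t) \<partial>lborel) - ((\<integral>x. cutoff x * u (x, t) \<partial>lborel) - cutoff_mass TYPE('a))\<bar> / cutoff_mass TYPE('a) \<le> \<eta> * cutoff_mass TYPE('a) / cutoff_mass TYPE('a)"
    using cutoff_mass_pos by (intro divide_right_mono) auto
  also have "\<eta> * cutoff_mass TYPE('a) / cutoff_mass TYPE('a) = \<eta>" using cutoff_mass_pos by simp
  also have "\<bar>(\<integral>x. cutoff x * reg_lap s \<epsilon> u (x, t) \<partial>lborel) - ((\<integral>x. cutoff x * u (x, t) \<partial>lborel) - cutoff_mass TYPE('a))\<bar> / cutoff_mass TYPE('a) =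
     \<bar>(\<integral>x. cutoff x * reg_lap s \<epsilon> u (x, t) \<partial>lborel) / cutoff_mass TYPE('a) - (tangential_average R u t - 1)\<bar>"
  proof -
    have "(\<integral>x. cutoff x * reg_lap s \<epsilon> u (x, t) \<partial>lborel) / cutoff_mass TYPE('a) - (tangential_average R u t - 1) =
      ((\<integral>x. cutoff x * reg_lap s \<epsilon> u (x, t) \<partial>lborel) - ((\<integral>x. cutoff x * u (x, t) \<partial>lborel) - cutoff_mass TYPE('a))) / cutoff_mass TYPE('a)"
      unfolding tangential_average_def using cutoff_mass_pos by (simp add: diff_divide_distrib)
    then show ?thesis using cutoff_mass_pos by simp
  qed
  finally show ?thesis .
qed

end

end

section \<open>From the half space to the half line\<close>

theorem corollary3:
  fixes s :: real
  assumes "0 < s" and "s < 1"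
  shows "\<not> (\<exists>u :: (real ^ 'm) \<times> real \<Rightarrow> real.
            bounded_classical_solution s (\<lambda>t. t - 1) u \<and>
            (\<forall>x. 0 \<le> u x) \<and> (\<exists>x. u x \<noteq> 0))"
proof
  assume "\<exists>u :: (real ^ 'm) \<times> real \<Rightarrow> real. bounded_classical_solution s (\<lambda>t. t - 1) u \<and>
            (\<forall>x. 0 \<le> u x) \<and> (\<exists>x. u x \<noteq> 0)"
  then obtain u :: "(real ^ 'm) \<times> real \<Rightarrow> real" where sol: "bounded_classical_solution s (\<lambda>t. t - 1) u"
    and u_nonneg: "\<And>x. 0 \<le> u x" by blast
  obtain M where M: "0 < M" "\<And>x. u x \<le> M"
  proof -
    have "bounded (range u)" using sol by (simp add: bounded_classical_solution_def)
    then obtain B where "0 < B" "\<And>x. \<bar>u x\<bar> \<le> B" by (auto simp: bounded_pos)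
    then show ?thesis using that abs_le_D1 by blast
  qed
  have u_cont: "continuous_on UNIV u" and u_eq: "\<And>x. x \<in> half_space \<Longrightarrow> has_frac_laplacian s u x (u x - 1)"
    and u_zero: "\<And>x. x \<notin> half_space \<Longrightarrow> u x = 0"
    using sol by (auto simp: bounded_classical_solution_def)
  obtain \<beta> where \<beta>: "0 < \<beta>" "\<beta> < 1" "C_real_loc (2 * s + \<beta>) u half_space"
    using sol by (auto simp: bounded_classical_solution_def)
  have u_meas: "u \<in> borel_measurable borel" using u_cont by (rule borel_measurable_continuous_onI)
  have u_abs: "\<bar>u x\<bar> \<le> M" for x using u_nonneg[of x] M(2)[of x] by simp
  have hs_open: "open (half_space :: ((real ^ 'm) \<times> real) set)"
    unfolding half_space_def by (intro open_Collect_less continuous_intros)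
  define c where "c = kernel_mass (s + 1 / 2) 1 TYPE(real ^ 'm)"
  have c: "0 < c" unfolding c_def using assms by (intro kernel_mass_pos) simp
  obtain \<mu> where \<mu>: "0 < \<mu>" and prof: "\<forall>M>0. \<exists>\<nu>>0. \<forall>U. \<not> approx_half_line_solution s \<mu> M \<nu> U"
    using no_bounded_profile[OF assms] by blast
  obtain \<nu> where \<nu>: "0 < \<nu>" and no_prof: "\<And>U. \<not> approx_half_line_solution s \<mu> M \<nu> U"
    using prof M(1) by blast
  \<comment> \<open>Averaging leaves the factor c, the constant of the marginal kernel, in front of
    the operator, and a dilation by l multiplies it by \<open>l powr (2 * s)\<close>. This choice
    removes c and installs the prescribed \<mu>.\<close>
  define l where "l = (c * \<mu>) powr (1 / (2 * s))"
  have l: "0 < l" "l powr (2 * s) = c * \<mu>" using c \<mu> assms by (simp_all add: l_def powr_powr)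
  obtain C where C: "0 < C" "\<And>h::real ^ 'm. integral\<^sup>L lborel (\<lambda>w. \<bar>bump (w + h) + bump (w - h) - 2 * bump w\<bar>) \<le> C * min 1 ((norm h)\<^sup>2)"
    using bump_second_difference_L1 by blast
  define H where "H = integral\<^sup>L lborel (bump :: real ^ 'm \<Rightarrow> real)"
  have H: "0 < H" unfolding H_def by (rule bump_integral_pos)
  \<comment> \<open>Averaging and the equation for u contribute an error \<eta> each, and the
    dilation multiplies their sum by \<mu>.\<close>
  define \<eta> where "\<eta> = \<nu> / \<mu> / 2"
  have \<eta>: "0 < \<eta>" using \<nu> \<mu> by (simp add: \<eta>_def)
  \<comment> \<open>The averaging error is \<open>M * C / H\<close> times an integral that is small
    for large R; below this quotient, the error is at most \<eta>.\<close>
  have "0 < \<eta> * H / (M * C)" using \<eta> H M C by simp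
  from norm_powr_min_vanishes[OF assms this, where 'a = "(real ^ 'm) \<times> real"]
  obtain R where R: "0 < R"
    "integral\<^sup>L lborel (\<lambda>z::(real ^ 'm) \<times> real. min 1 ((norm z)\<^sup>2 / R\<^sup>2) * singular_kernel s z) \<le> \<eta> * H / (M * C)"
    "integrable lborel (\<lambda>z::(real ^ 'm) \<times> real. min 1 ((norm z)\<^sup>2 / R\<^sup>2) * singular_kernel s z)"
    by blast
  let ?A = "tangential_average R u"
  note ctx = R(1) u_meas u_nonneg M(2)
  define U where "U t = ?A (l * t)" for t
  have "approx_half_line_solution s \<mu> M \<nu> U"
    unfolding approx_half_line_solution_def
  proof (intro conjI)
    show "U \<in> borel_measurable borel"
      unfolding U_def[abs_def] using average_measurable[OF ctx] by measurable
    show "\<forall>x. 0 \<le> U x \<and> U x \<le> M" unfolding U_def using average_bounds[OF ctx] by blast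
    show "\<forall>\<eta>>0. \<exists>\<delta>>0. \<forall>t\<le>\<delta>. U t \<le> \<eta>"
    proof (intro allI impI)
      fix \<eta> :: real assume \<eta>: "0 < \<eta>"
      \<comment> \<open>Since u vanishes at \<open>t = 0\<close> and the average sees only
        \<open>norm x \<le> R\<close>, uniform continuity on a compact set gives smallness near the
        boundary.\<close>
      have "compact (cball (0::real ^ 'm) R \<times> {-1..1::real})" by (intro compact_Times) auto
      then have "uniformly_continuous_on (cball (0::real ^ 'm) R \<times> {-1..1::real}) u"
        using u_cont by (intro compact_uniformly_continuous) (auto intro: continuous_on_subset)
      then obtain d where d: "0 < d" "\<And>z w. z \<in> cball 0 R \<times> {-1..1} \<Longrightarrow> w \<in> cball 0 R \<times> {-1..1} \<Longrightarrow> dist w z < d \<Longrightarrow> dist (u w) (u z) < \<eta>"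
        unfolding uniformly_continuous_on_def using \<eta> by metis
      define \<delta> where "\<delta> = min 1 (d / 2)"
      have \<delta>: "0 < \<delta>" "\<delta> \<le> 1" "\<delta> < d" using d(1) by (auto simp: \<delta>_def)
      have "?A t \<le> \<eta>" if t: "t \<le> \<delta>" for t
      proof (rule average_le[OF ctx])
        fix x :: "real ^ 'm" assume x: "norm x \<le> R"
        show "u (x, t) \<le> \<eta>"
        proof (cases "0 < t")
          case True
          have "dist (x, t) (x, 0) < d" using True t \<delta> by (simp add: dist_Pair_Pair)
          then have "dist (u (x, t)) (u (x, 0)) < \<eta>" using x True t \<delta> by (intro d(2)) auto
          moreover have "u (x, 0) = 0" by (rule u_zero) (simp add: half_space_def)
          ultimately show ?thesis by (simp add: dist_real_def)
        next
          case False
          then have "u (x, t) = 0" by (intro u_zero) (simp add: half_space_def)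
          then show ?thesis using \<eta> by simp
        qed
      qed
      moreover have "l * t \<le> \<delta>" if "t \<le> \<delta> / l" for t using that l(1) by (simp add: field_simps)
      ultimately show "\<exists>\<delta>>0. \<forall>t\<le>\<delta>. U t \<le> \<eta>" using \<delta>(1) l(1) unfolding U_def by (intro exI[of _ "\<delta> / l"]) auto
    qed
    show "\<forall>a b. 0 < a \<longrightarrow> (\<exists>\<epsilon>\<^sub>0>0. \<forall>\<epsilon>. 0 < \<epsilon> \<and> \<epsilon> < \<epsilon>\<^sub>0 \<longrightarrow> (\<forall>t\<in>{a..b}. \<bar>reg_lap s \<epsilon> U t - \<mu> * (U t - 1)\<bar> \<le> \<nu>))"
    proof (intro allI impI)
      fix a b :: real assume a: "0 < a"
      define K where "K = cball (0::real ^ 'm) R \<times> {l * a..l * b}"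
      have K: "compact K" unfolding K_def by (intro compact_Times) auto
      have Khs: "K \<subseteq> half_space"
      proof
        fix z assume "z \<in> K"
        then have "l * a \<le> snd z" by (auto simp: K_def)
        moreover have "0 < l * a" using l a by simp
        ultimately show "z \<in> half_space" by (simp add: half_space_def)
      qed
      have "\<exists>\<epsilon>\<^sub>0>0. \<forall>\<epsilon>. 0 < \<epsilon> \<and> \<epsilon> < \<epsilon>\<^sub>0 \<longrightarrow> (\<forall>x\<in>K. \<bar>reg_lap s \<epsilon> u x - (u x - 1)\<bar> \<le> \<eta>)"
        using assms \<beta> Khs u_eq by (intro reg_lap_uniform_limit[OF \<beta>(3) _ _ _ _ _ hs_open K Khs u_meas u_abs _ \<eta>]) auto
      then obtain \<epsilon>\<^sub>0 where \<epsilon>\<^sub>0: "0 < \<epsilon>\<^sub>0" "\<And>\<epsilon> x. 0 < \<epsilon> \<Longrightarrow> \<epsilon> < \<epsilon>\<^sub>0 \<Longrightarrow> x \<in> K \<Longrightarrow> \<bar>reg_lap s \<epsilon> u x - (u x - 1)\<bar> \<le> \<eta>"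
        by blast
      have "\<bar>reg_lap s \<epsilon> U t - \<mu> * (U t - 1)\<bar> \<le> \<nu>" if \<epsilon>: "0 < \<epsilon>" "\<epsilon> < \<epsilon>\<^sub>0 / l" and t: "t \<in> {a..b}" for \<epsilon> t
      proof -
        have e: "0 < l * \<epsilon>" "l * \<epsilon> < \<epsilon>\<^sub>0" using \<epsilon> l(1) by (auto simp: field_simps)
        note av = reg_lap_average[OF ctx assms(1) e(1) C(2) less_imp_le[OF C(1)] R(3), of "l * t"]
        have "\<bar>c * reg_lap s (l * \<epsilon>) ?A (l * t) - (\<integral>x. bump ((1 / R) *\<^sub>R x) * reg_lap s (l * \<epsilon>) u (x, l * t) \<partial>lborel) / integral\<^sup>L lborel (\<lambda>x::real ^ 'm. bump ((1 / R) *\<^sub>R x))\<bar> \<le> \<eta>"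
        proof -
          have "M * C / H * integral\<^sup>L lborel (\<lambda>z::(real ^ 'm) \<times> real. min 1 ((norm z)\<^sup>2 / R\<^sup>2) * singular_kernel s z)
              \<le> M * C / H * (\<eta> * H / (M * C))"
            using R(2) M(1) C(1) H by (intro mult_left_mono) auto
          also have "\<dots> = \<eta>" using M(1) C(1) H by simp
          finally show ?thesis using av(1) unfolding c_def H_def by linarith
        qed
        moreover have "\<bar>(\<integral>x. bump ((1 / R) *\<^sub>R x) * reg_lap s (l * \<epsilon>) u (x, l * t) \<partial>lborel) / integral\<^sup>L lborel (\<lambda>x::real ^ 'm. bump ((1 / R) *\<^sub>R x)) - (?A (l * t) - 1)\<bar> \<le> \<eta>"
        proof (rule average_equation[OF ctx assms(1) e(1) av(2)])
          fix x :: "real ^ 'm" assume "norm x \<le> R"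
          then have "(x, l * t) \<in> K" using t l(1) by (auto simp: K_def)
          then show "\<bar>reg_lap s (l * \<epsilon>) u (x, l * t) - (u (x, l * t) - 1)\<bar> \<le> \<eta>" by (rule \<epsilon>\<^sub>0(2)[OF e])
        qed
        ultimately have "\<bar>c * reg_lap s (l * \<epsilon>) ?A (l * t) - (?A (l * t) - 1)\<bar> \<le> 2 * \<eta>" by linarith
        then have "\<mu> * \<bar>c * reg_lap s (l * \<epsilon>) ?A (l * t) - (?A (l * t) - 1)\<bar> \<le> \<mu> * (2 * \<eta>)" using \<mu> by (intro mult_left_mono) auto
        also have "\<mu> * (2 * \<eta>) = \<nu>" using \<mu> by (simp add: \<eta>_def)
        also have "\<mu> * \<bar>c * reg_lap s (l * \<epsilon>) ?A (l * t) - (?A (l * t) - 1)\<bar> = \<bar>reg_lap s \<epsilon> U t - \<mu> * (U t - 1)\<bar>"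
        proof -
          have "reg_lap s \<epsilon> U t = c * \<mu> * reg_lap s (l * \<epsilon>) ?A (l * t)"
            using reg_lap_scale[OF l(1), of s \<epsilon> ?A t] l(2) by (simp add: U_def[abs_def])
          then have "reg_lap s \<epsilon> U t - \<mu> * (U t - 1) = \<mu> * (c * reg_lap s (l * \<epsilon>) ?A (l * t) - (?A (l * t) - 1))"
            by (simp add: U_def algebra_simps)
          then show ?thesis using \<mu> by (simp add: abs_mult)
        qed
        finally show ?thesis .
      qed
      then show "\<exists>\<epsilon>\<^sub>0>0. \<forall>\<epsilon>. 0 < \<epsilon> \<and> \<epsilon> < \<epsilon>\<^sub>0 \<longrightarrow> (\<forall>t\<in>{a..b}. \<bar>reg_lap s \<epsilon> U t - \<mu> * (U t - 1)\<bar> \<le> \<nu>)"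
        using \<epsilon>\<^sub>0(1) l(1) by (intro exI[of _ "\<epsilon>\<^sub>0 / l"]) auto
    qed
  qed
  then show False using no_prof by blast
qed

end
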